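(* Let $K$ be a field, $R=K[x_1,\ldots,x_n]$, and let $I\subset R$ be a squarefree monomial ideal of degree $\geq n-2$, i.e. every minimal monomial generator of $I$ has degree at least $n-2$. Let $I^{\vee}$ be the Alexander dual of $I$. Then $R/I^{\vee}$ is sequentially Cohen-Macaulay if and only if $R/I^{\vee}$ is pretty clean.
   Context: For a simplicial complex $\Delta$ on $V=\{x_1,\ldots,x_n\}$, the Stanley-Reisner ideal $I_\Delta\subset R$ is generated by the squarefree monomials $x_F=\prod_{x_j\in F}x_j$ with $F\subseteq V$, $F\notin\Delta$. The Alexander dual complex is $\Delta^{\vee}=\{V\setminus A : A\subseteq V,\ A\notin\Delta\}$. Every squarefree monomial ideal $I$ equals $I_\Delta$ for a unique $\Delta$, and its Alexander dual is $I^{\vee}=I_{\Delta^{\vee}}$. For a monomial ideal $J\subset R$, a monomial prime filtration of $R/J$ is a chain of monomial ideals $J=I_0\subset I_1\subset\cdots\subset I_r=R$ such that for each $i=1,\ldots,r$ one has $I_i/I_{i-1}\cong R/\mathfrak{p}_i$ with $\mathfrak{p}_i$ a monomial prime ideal; equivalently, $I_i=(I_{i-1},u_i)$ and $\mathfrak{p}_i=(I_{i-1}:u_i)$ for some monomial $u_i\in I_i$. The module $R/J$ is pretty clean if it has a monomial prime filtration such that whenever $\mathfrak{p}_i\subsetneq\mathfrak{p}_j$, then $j<i$. The module $R/J$ is sequentially Cohen-Macaulay if there is a chain of monomial ideals $J=I_0\subset I_1\subset\cdots\subset I_r=R$ such that each factor $I_i/I_{i-1}$ is Cohen-Macaulay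 and $\dim I_i/I_{i-1}<\dim I_{i+1}/I_i$ for $i=1,\ldots,r-1$. *)

theory Defs
  imports
    "HOL-Algebra.Algebraic_Closure_Type"
    "HOL-Algebra.QuotRing"
    "HOL-Algebra.Module"
    "HOL-Library.Poly_Mapping"
    "HOL-Library.Extended_Nat"
    "HOL-Library.Cardinality"
begin

section \<open>Modules and Cohen-Macaulayness\<close>

subsection \<open>Subquotients and isomorphisms\<close>

definition ideal_module :: "('a, 'c) ring_scheme \<Rightarrow> 'a set \<Rightarrow> ('a, 'a) module" where
  "ideal_module R I =
     \<lparr>carrier = I, monoid.mult = (\<otimes>\<^bsub>R\<^esub>), one = one R, ring.zero = zero R, add = add R, module.smult = (\<otimes>\<^bsub>R\<^esub>)\<rparr>"

text \<open>The fields \<open>mult\<close> and \<open>one\<close>, which a module record inherits from the ring record, carry no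
  meaning for a module and are left undefined.\<close>

definition quotient_module :: "('a, 'b, 'c) module_scheme \<Rightarrow> 'b set \<Rightarrow> ('a, 'b set) module" where
  "quotient_module M N =
     \<lparr>carrier = a_rcosets\<^bsub>M\<^esub> N, monoid.mult = undefined, one = undefined, ring.zero = N, add = set_add M,
      module.smult = (\<lambda>a C. \<Union>x\<in>C. N +>\<^bsub>M\<^esub> (a \<odot>\<^bsub>M\<^esub> x))\<rparr>"

definition subquotient :: "('a, 'c) ring_scheme \<Rightarrow> 'a set \<Rightarrow> 'a set \<Rightarrow> ('a, 'a set) module" where
  "subquotient R I J = quotient_module (ideal_module R I) J"

lemma subquotient_is_module:
  assumes "cring R" "ideal I R" "ideal J R" "J \<subseteq> I"
  shows "module R (subquotient R I J)"
proof -
  interpret cring R by fact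
  interpret I: ideal I R by fact
  interpret J: ideal J R by fact
  let ?M = "ideal_module R I"
  have [simp]: "a_r_coset ?M = a_r_coset R" "set_add ?M = set_add R"
    by (auto simp: fun_eq_iff a_r_coset_def' set_add_defs ideal_module_def)
  have IR: "x \<in> I \<Longrightarrow> x \<in> carrier R" for x by (rule I.a_Hcarr)
  have C: "carrier (subquotient R I J) = (\<lambda>x. J +>\<^bsub>R\<^esub> x) ` I"
    by (auto simp: subquotient_def quotient_module_def A_RCOSETS_def' ideal_module_def a_r_coset_def')
  have A: "(J +>\<^bsub>R\<^esub> x) \<oplus>\<^bsub>subquotient R I J\<^esub> (J +>\<^bsub>R\<^esub> y) = J +>\<^bsub>R\<^esub> (x \<oplus>\<^bsub>R\<^esub> y)" 
    if "x \<in> I" "y \<in> I" for x y using that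
    by (simp add: subquotient_def quotient_module_def J.a_rcos_sum IR)
  have S: "a \<odot>\<^bsub>subquotient R I J\<^esub> (J +>\<^bsub>R\<^esub> x) = J +>\<^bsub>R\<^esub> (a \<otimes>\<^bsub>R\<^esub> x)"
    if "x \<in> I" "a \<in> carrier R" for a x
  proof -
    have "J +>\<^bsub>R\<^esub> (a \<otimes>\<^bsub>R\<^esub> y) = J +>\<^bsub>R\<^esub> (a \<otimes>\<^bsub>R\<^esub> x)" if y: "y \<in> J +>\<^bsub>R\<^esub> x" for y
    proof -
      from y obtain j where j: "j \<in> J" "y = j \<oplus>\<^bsub>R\<^esub> x" by (auto simp: a_r_coset_def')
      hence "a \<otimes>\<^bsub>R\<^esub> y = a \<otimes>\<^bsub>R\<^esub> j \<oplus>\<^bsub>R\<^esub> a \<otimes>\<^bsub>R\<^esub> x"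
        using \<open>x \<in> I\<close> \<open>a \<in> carrier R\<close> IR J.a_Hcarr by (simp add: r_distr)
      moreover have "a \<otimes>\<^bsub>R\<^esub> j \<in> J" using j \<open>a \<in> carrier R\<close> by (simp add: J.I_l_closed)
      ultimately have "a \<otimes>\<^bsub>R\<^esub> y \<in> J +>\<^bsub>R\<^esub> (a \<otimes>\<^bsub>R\<^esub> x)" by (auto simp: a_r_coset_def')
      thus ?thesis using J.a_repr_independence'[of "a \<otimes>\<^bsub>R\<^esub> y" "a \<otimes>\<^bsub>R\<^esub> x"] \<open>x \<in> I\<close> \<open>a \<in> carrier R\<close> IR by simp
    qed
    moreover have "x \<in> J +>\<^bsub>R\<^esub> x" using that IR J.a_rcos_self by blast
    moreover have "a \<odot>\<^bsub>subquotient R I J\<^esub> (J +>\<^bsub>R\<^esub> x) = (\<Union>y\<in>J +>\<^bsub>R\<^esub> x. J +>\<^bsub>R\<^esub> (a \<otimes>\<^bsub>R\<^esub> y))"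
      unfolding subquotient_def quotient_module_def by (simp, simp add: ideal_module_def)
    ultimately show ?thesis by blast
  qed
  have Z: "\<zero>\<^bsub>subquotient R I J\<^esub> = J +>\<^bsub>R\<^esub> \<zero>\<^bsub>R\<^esub>"
    using J.a_Hcarr by (auto simp: subquotient_def quotient_module_def a_r_coset_def')
  have AG: "abelian_group (subquotient R I J)"
  proof (rule abelian_groupI, goal_cases)
    case (6 Y) 
    then obtain x where x: "x \<in> I" "Y = J +>\<^bsub>R\<^esub> x" by (auto simp: C)
    have "(J +>\<^bsub>R\<^esub> (\<ominus>\<^bsub>R\<^esub> x)) \<oplus>\<^bsub>subquotient R I J\<^esub> Y = J +>\<^bsub>R\<^esub> \<zero>\<^bsub>R\<^esub>"
      using x IR by (simp add: A l_neg)
    thus ?case using x by (auto simp: C Z)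
  qed (use IR in \<open>auto simp: C Z A a_ac\<close>)
  show ?thesis
    by (rule moduleI[OF assms(1) AG]) (use IR in \<open>auto simp: C A S I.I_l_closed l_distr r_distr m_assoc\<close>)
qed

definition module_isomorphic ::
    "('a, 'c) ring_scheme \<Rightarrow> ('a, 'b, 'd) module_scheme \<Rightarrow> ('a, 'e, 'f) module_scheme \<Rightarrow> bool" where
  "module_isomorphic R M N \<longleftrightarrow>
     (\<exists>\<phi> \<in> iso (add_monoid M) (add_monoid N).
        \<forall>a\<in>carrier R. \<forall>m\<in>carrier M. \<phi> (a \<odot>\<^bsub>M\<^esub> m) = a \<odot>\<^bsub>N\<^esub> \<phi> m)"


subsection \<open>Dimension and depth\<close>

definition krull_dim :: "('a, 'c) ring_scheme \<Rightarrow> enat" where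
  "krull_dim R = Sup {enat l | l. \<exists>P :: nat \<Rightarrow> 'a set.
     (\<forall>i\<le>l. primeideal (P i) R) \<and> (\<forall>i<l. P i \<subset> P (Suc i))}"

definition annihilator :: "('a, 'c) ring_scheme \<Rightarrow> ('a, 'b, 'd) module_scheme \<Rightarrow> 'a set" where
  "annihilator R M = {a \<in> carrier R. \<forall>m\<in>carrier M. a \<odot>\<^bsub>M\<^esub> m = \<zero>\<^bsub>M\<^esub>}"

text \<open>The zero module gets dimension and depth \<open>0\<close>; below, only nonzero modules are considered.\<close>

definition module_dim :: "('a, 'c) ring_scheme \<Rightarrow> ('a, 'b, 'd) module_scheme \<Rightarrow> enat" where
  "module_dim R M = krull_dim (R Quot annihilator R M)"

definition seq_submodule :: "('a, 'b, 'd) module_scheme \<Rightarrow> 'a list \<Rightarrow> 'b set" where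
  "seq_submodule M fs =
     {finsum M (\<lambda>j. (fs ! j) \<odot>\<^bsub>M\<^esub> v j) {..<length fs} | v. v \<in> {..<length fs} \<rightarrow> carrier M}"

definition regular_sequence ::
    "('a, 'c) ring_scheme \<Rightarrow> ('a, 'b, 'd) module_scheme \<Rightarrow> 'a list \<Rightarrow> bool" where
  "regular_sequence R M fs \<longleftrightarrow>
     set fs \<subseteq> carrier R \<and>
     (\<forall>i<length fs. \<forall>m\<in>carrier M.
        (fs ! i) \<odot>\<^bsub>M\<^esub> m \<in> seq_submodule M (take i fs) \<longrightarrow> m \<in> seq_submodule M (take i fs)) \<and>
     seq_submodule M fs \<noteq> carrier M"

definition depth ::
    "('a, 'c) ring_scheme \<Rightarrow> 'a set \<Rightarrow> ('a, 'b, 'd) module_scheme \<Rightarrow> enat" where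
  "depth R \<mm> M = Sup {enat (length fs) | fs. set fs \<subseteq> \<mm> \<and> regular_sequence R M fs}"


section \<open>Monomial ideals\<close>

text \<open>The ring \<open>K[x\<^sub>1, \<dots>, x\<^sub>n]\<close>: the variables are indexed by a finite type \<open>'x\<close>, so that
  \<open>n = CARD('x)\<close>, and the field \<open>K\<close> is a type \<open>'k\<close>.\<close>

type_synonym ('x, 'k) mpoly = "('x \<Rightarrow>\<^sub>0 nat) \<Rightarrow>\<^sub>0 'k"

abbreviation polyring :: "('x::finite, 'k::field) mpoly ring" where
  "polyring \<equiv> ring_of_type_algebra"

definition monomial :: "('x::finite \<Rightarrow>\<^sub>0 nat) \<Rightarrow> ('x, 'k::field) mpoly" where
  "monomial t = Poly_Mapping.single t 1"

definition variable :: "'x::finite \<Rightarrow> ('x, 'k::field) mpoly" where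
  "variable j = monomial (Poly_Mapping.single j 1)"

definition squarefree_monomial :: "'x::finite set \<Rightarrow> ('x, 'k::field) mpoly" where
  "squarefree_monomial F = (\<Prod>j\<in>F. variable j)"

definition monomial_degree :: "('x::finite \<Rightarrow>\<^sub>0 nat) \<Rightarrow> nat" where
  "monomial_degree t = (\<Sum>j\<in>UNIV. Poly_Mapping.lookup t j)"

definition monomial_ideal :: "('x::finite, 'k::field) mpoly set \<Rightarrow> bool" where
  "monomial_ideal I \<longleftrightarrow> (\<exists>T. I = Idl\<^bsub>polyring\<^esub> (monomial ` T))"

definition squarefree_monomial_ideal :: "('x::finite, 'k::field) mpoly set \<Rightarrow> bool" where
  "squarefree_monomial_ideal I \<longleftrightarrow> (\<exists>\<F>. I = Idl\<^bsub>polyring\<^esub> (squarefree_monomial ` \<F>))"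

text \<open>The exponents of the minimal monomial generators of a monomial ideal, i.e. of the monomials
  in the ideal that are minimal with respect to divisibility.\<close>

definition minimal_generators ::
    "('x::finite, 'k::field) mpoly set \<Rightarrow> ('x \<Rightarrow>\<^sub>0 nat) set" where
  "minimal_generators I =
     {t. (monomial t :: ('x, 'k) mpoly) \<in> I \<and>
         (\<forall>s. (monomial s :: ('x, 'k) mpoly) \<in> I \<and>
              (monomial s :: ('x, 'k) mpoly) dvd monomial t \<longrightarrow> s = t)}"

text \<open>A squarefree monomial ideal without minimal generators (the zero ideal) satisfies the
  condition for every \<open>d\<close>.\<close>

definition degree_at_least :: "('x::finite, 'k::field) mpoly set \<Rightarrow> int \<Rightarrow> bool" where
  "degree_at_least I d \<longleftrightarrow> (\<forall>t\<in>minimal_generators I. d \<le> int (monomial_degree t))"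


section \<open>Stanley-Reisner ideals and Alexander duality\<close>

text \<open>The void complex \<open>{}\<close> is allowed, and the vertices need not be faces; otherwise not every
  squarefree monomial ideal would be a Stanley-Reisner ideal.\<close>

definition simplicial_complex :: "'x::finite set set \<Rightarrow> bool" where
  "simplicial_complex \<Delta> \<longleftrightarrow> (\<forall>F\<in>\<Delta>. \<forall>G. G \<subseteq> F \<longrightarrow> G \<in> \<Delta>)"

definition stanley_reisner_ideal :: "'x::finite set set \<Rightarrow> ('x, 'k::field) mpoly set" where
  "stanley_reisner_ideal \<Delta> = Idl\<^bsub>polyring\<^esub> (squarefree_monomial ` {F. F \<notin> \<Delta>})"

definition dual_complex :: "'x::finite set set \<Rightarrow> 'x set set" where
  "dual_complex \<Delta> = {UNIV - A | A. A \<notin> \<Delta>}"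

definition stanley_reisner_complex :: "('x::finite, 'k::field) mpoly set \<Rightarrow> 'x set set" where
  "stanley_reisner_complex I = (THE \<Delta>. simplicial_complex \<Delta> \<and> I = stanley_reisner_ideal \<Delta>)"

definition alexander_dual ::
    "('x::finite, 'k::field) mpoly set \<Rightarrow> ('x, 'k) mpoly set" where
  "alexander_dual I = stanley_reisner_ideal (dual_complex (stanley_reisner_complex I))"

text \<open>The description in \<open>stanley_reisner_complex\<close> is well-defined: every squarefree monomial ideal
  is the Stanley-Reisner ideal of exactly one complex.\<close>

lemma keys_times_obtain: 
  assumes "t \<in> Poly_Mapping.keys (p * q :: ('x::finite, 'k::field) mpoly)"
  shows "\<exists>s\<in>Poly_Mapping.keys p. \<exists>u\<in>Poly_Mapping.keys q. t = s + u"
  using assms keys_mult[of p q] by blast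

lemma squarefree_monomial_eq:
  "squarefree_monomial F = (monomial (\<Sum>j\<in>F. Poly_Mapping.single j (Suc 0)) :: ('x::finite, 'k::field) mpoly)"
  unfolding squarefree_monomial_def
  by (induction F rule: infinite_finite_induct)
     (auto simp: variable_def monomial_def mult_single)

lemma lookup_squarefree: "Poly_Mapping.lookup (\<Sum>j\<in>F. Poly_Mapping.single j (Suc 0)) (i::'x::finite) = (if i \<in> F then 1 else 0)"
  by (simp add: lookup_sum lookup_single when_def)

lemma squarefree_monomial_in_ideal_iff:
  "(squarefree_monomial F :: ('x::finite, 'k::field) mpoly) \<in> Idl\<^bsub>polyring\<^esub> (squarefree_monomial ` \<F>)
     \<longleftrightarrow> (\<exists>G\<in>\<F>. G \<subseteq> F)"
proof
  let ?R = "polyring :: ('x, 'k) mpoly ring"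
  interpret cring ?R by (rule cring_from_type_algebra)
  note [simp] = ring_of_type_algebra_def
  let ?P = "{p :: ('x,'k) mpoly. \<forall>t\<in>Poly_Mapping.keys p. \<exists>G\<in>\<F>. \<forall>i\<in>G. Poly_Mapping.lookup t i \<ge> 1}"
  have "ideal ?P ?R"
  proof (rule idealI)
    show "subgroup ?P (add_monoid ?R)"
    proof (rule group.subgroupI[OF a_group])
      fix x assume x: "x \<in> ?P"
      have "inv\<^bsub>add_monoid ?R\<^esub> x = - x"
        by (rule group.inv_equality[OF a_group]) auto
      thus "inv\<^bsub>add_monoid ?R\<^esub> x \<in> ?P" using x by (simp add: in_keys_iff)
    next
      fix x y assume "x \<in> ?P" "y \<in> ?P"
      thus "x \<otimes>\<^bsub>add_monoid ?R\<^esub> y \<in> ?P" using Poly_Mapping.keys_add[of x y] by auto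
    next
      have "0 \<in> ?P" by simp
      thus "?P \<noteq> {}" by blast
    qed auto
  next
    fix a x assume "a \<in> ?P" "x \<in> carrier ?R"
    have "\<exists>G\<in>\<F>. \<forall>i\<in>G. Poly_Mapping.lookup t i \<ge> 1" if t: "t \<in> Poly_Mapping.keys (x * a)" for t
    proof -
      obtain s u where su: "u \<in> Poly_Mapping.keys a" "t = s + u"
        using keys_times_obtain[OF t] by blast
      then obtain G where "G \<in> \<F>" "\<forall>i\<in>G. Poly_Mapping.lookup u i \<ge> 1" using \<open>a \<in> ?P\<close> by blast
      thus ?thesis using su by (auto simp: lookup_add trans_le_add2 intro!: bexI[of _ G])
    qed
    thus "x \<otimes>\<^bsub>?R\<^esub> a \<in> ?P" by simp
    thus "a \<otimes>\<^bsub>?R\<^esub> x \<in> ?P" by (simp add: mult.commute)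
  qed (fact ring_from_type_algebra)
  moreover have "squarefree_monomial ` \<F> \<subseteq> ?P"
    by (force simp: squarefree_monomial_eq monomial_def lookup_squarefree)
  ultimately have "Idl\<^bsub>?R\<^esub> (squarefree_monomial ` \<F>) \<subseteq> ?P"
    by (rule genideal_minimal)
  moreover assume "(squarefree_monomial F :: ('x, 'k) mpoly) \<in> Idl\<^bsub>?R\<^esub> (squarefree_monomial ` \<F>)"
  ultimately have "(squarefree_monomial F :: ('x, 'k) mpoly) \<in> ?P" by blast
  then obtain G where "G \<in> \<F>" "\<forall>i\<in>G. Poly_Mapping.lookup (\<Sum>j\<in>F. Poly_Mapping.single j (Suc 0)) i \<ge> 1"
    by (auto simp: squarefree_monomial_eq monomial_def)
  hence "\<forall>i\<in>G. (1::nat) \<le> (if i \<in> F then 1 else 0)" by (simp only: lookup_squarefree)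
  hence "G \<subseteq> F" by (metis not_one_le_zero subsetI)
  with \<open>G \<in> \<F>\<close> show "\<exists>G\<in>\<F>. G \<subseteq> F" by blast
next
  let ?R = "polyring :: ('x, 'k) mpoly ring"
  interpret cring ?R by (rule cring_from_type_algebra)
  assume "\<exists>G\<in>\<F>. G \<subseteq> F"
  then obtain G where G: "G \<in> \<F>" "G \<subseteq> F" by blast
  let ?I = "Idl\<^bsub>?R\<^esub> (squarefree_monomial ` \<F>)"
  interpret I: ideal ?I ?R by (rule genideal_ideal) (simp add: ring_of_type_algebra_def)
  have "squarefree_monomial G \<in> ?I"
    using G genideal_self[of "squarefree_monomial ` \<F>"] by (auto simp: ring_of_type_algebra_def)
  hence "squarefree_monomial (F - G) * squarefree_monomial G \<in> ?I"
    using I.I_l_closed[of "squarefree_monomial G" "squarefree_monomial (F - G)"]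
    by (simp add: ring_of_type_algebra_def)
  also have "squarefree_monomial (F - G) * squarefree_monomial G = (squarefree_monomial F :: ('x, 'k) mpoly)"
    unfolding squarefree_monomial_def by (rule prod.subset_diff[symmetric]) (use G in auto)
  finally show "(squarefree_monomial F :: ('x, 'k) mpoly) \<in> ?I" .
qed

lemma ex1_stanley_reisner_complex:
  assumes "squarefree_monomial_ideal (I :: ('x::finite, 'k::field) mpoly set)"
  shows "\<exists>!\<Delta>. simplicial_complex \<Delta> \<and> I = stanley_reisner_ideal \<Delta>"
proof -
  let ?R = "polyring :: ('x, 'k) mpoly ring"
  interpret cring ?R by (rule cring_from_type_algebra)
  obtain \<F> where I: "I = Idl\<^bsub>?R\<^esub> (squarefree_monomial ` \<F>)"
    using assms by (auto simp: squarefree_monomial_ideal_def)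
  define \<Gamma> where "\<Gamma> = {F. squarefree_monomial F \<notin> I}"
  have U: "carrier ?R = UNIV" by (simp add: ring_of_type_algebra_def)
  have \<Gamma>: "F \<in> \<Gamma> \<longleftrightarrow> \<not> (\<exists>G\<in>\<F>. G \<subseteq> F)" for F
    by (simp add: \<Gamma>_def I squarefree_monomial_in_ideal_iff)
  have "simplicial_complex \<Gamma>"
    unfolding simplicial_complex_def Ball_def \<Gamma> by blast
  moreover have "I = stanley_reisner_ideal \<Gamma>"
  proof (rule antisym)
    have "\<F> \<subseteq> {F. F \<notin> \<Gamma>}" by (auto simp: \<Gamma>)
    thus "I \<subseteq> stanley_reisner_ideal \<Gamma>" unfolding I stanley_reisner_ideal_def
      by (intro genideal_minimal genideal_ideal order.trans[OF _ genideal_self]) (auto simp: U)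
    show "stanley_reisner_ideal \<Gamma> \<subseteq> I" unfolding I stanley_reisner_ideal_def
      by (intro genideal_minimal genideal_ideal) (auto simp: U \<Gamma> squarefree_monomial_in_ideal_iff, blast)
  qed
  moreover have "\<Delta> = \<Gamma>" if "simplicial_complex \<Delta>" "I = stanley_reisner_ideal \<Delta>" for \<Delta>
  proof -
    have "squarefree_monomial F \<in> I \<longleftrightarrow> F \<notin> \<Delta>" for F
      using that(1) unfolding that(2) stanley_reisner_ideal_def squarefree_monomial_in_ideal_iff simplicial_complex_def
      by blast
    thus ?thesis by (auto simp: \<Gamma>_def)
  qed
  ultimately show ?thesis by (intro ex1I[of _ \<Gamma>]) blast+
qed

section \<open>Sequentially Cohen-Macaulay and pretty clean quotients\<close>

text \<open>Cohen-Macaulayness of finitely generated graded modules over the standard graded ring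
  \<open>K[x\<^sub>1, \<dots>, x\<^sub>n]\<close>: depth is taken with respect to the graded maximal ideal \<open>(x\<^sub>1, \<dots>, x\<^sub>n)\<close>.\<close>

definition cohen_macaulay ::
    "(('x::finite, 'k::field) mpoly, 'b, 'd) module_scheme \<Rightarrow> bool" where
  "cohen_macaulay M \<longleftrightarrow> depth polyring (Idl\<^bsub>polyring\<^esub> (range variable)) M = module_dim polyring M"

text \<open>The two notions below are properties of the module \<open>R/J\<close>, stated in terms of the ideal \<open>J\<close>.
  The length \<open>r = 0\<close> occurs exactly for \<open>R/J = 0\<close>.\<close>

definition sequentially_cohen_macaulay_quotient ::
    "('x::finite, 'k::field) mpoly set \<Rightarrow> bool" where
  "sequentially_cohen_macaulay_quotient J \<longleftrightarrow>
     (\<exists>(r::nat) I.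
        I 0 = J \<and> I r = carrier polyring \<and>
        (\<forall>i\<in>{0..r}. monomial_ideal (I i)) \<and>
        (\<forall>i\<in>{1..r}. I (i - 1) \<subset> I i \<and> cohen_macaulay (subquotient polyring (I i) (I (i - 1)))) \<and>
        (\<forall>i. 1 \<le> i \<and> i < r \<longrightarrow>
           module_dim polyring (subquotient polyring (I i) (I (i - 1)))
             < module_dim polyring (subquotient polyring (I (i + 1)) (I i))))"

definition monomial_prime_filtration ::
    "('x::finite, 'k::field) mpoly set \<Rightarrow> nat \<Rightarrow> (nat \<Rightarrow> ('x, 'k) mpoly set) \<Rightarrow>
     (nat \<Rightarrow> ('x, 'k) mpoly set) \<Rightarrow> bool" where
  "monomial_prime_filtration J r I \<pp> \<longleftrightarrow>
     I 0 = J \<and> I r = carrier polyring \<and>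
     (\<forall>i\<in>{0..r}. monomial_ideal (I i)) \<and>
     (\<forall>i\<in>{1..r}. I (i - 1) \<subset> I i \<and>
        monomial_ideal (\<pp> i) \<and> primeideal (\<pp> i) polyring \<and>
        module_isomorphic polyring
          (subquotient polyring (I i) (I (i - 1))) (subquotient polyring (carrier polyring) (\<pp> i)))"

definition pretty_clean_quotient :: "('x::finite, 'k::field) mpoly set \<Rightarrow> bool" where
  "pretty_clean_quotient J \<longleftrightarrow>
     (\<exists>r I \<pp>. monomial_prime_filtration J r I \<pp> \<and>
        (\<forall>i\<in>{1..r}. \<forall>j\<in>{1..r}. \<pp> i \<subset> \<pp> j \<longrightarrow> j < i))"

end

theory Submission
  imports Defs
begin

text \<open>
  Let \<open>\<Gamma>\<close> be the complex dual to that of \<open>I\<close>, so that the dual ideal is \<open>I\<^sub>\<Gamma>\<close>. If all minimal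
  generators of \<open>I\<close> have degree at least \<open>n - 2\<close>, then the faces of \<open>\<Gamma>\<close> have at most two elements:
  \<open>\<Gamma>\<close> is a graph, possibly with isolated vertices. For such complexes sequential Cohen-Macaulayness and pretty
  cleanness of \<open>R / I\<^sub>\<Gamma>\<close> are both equivalent to one combinatorial condition, \<open>edge_connected\<close>: all
  edges lie in one connected component. Write \<open>P\<^sub>F\<close> for the prime generated by the variables outside \<open>F\<close>,
  and \<open>x\<^sub>F\<close> for the product of the variables in \<open>F\<close>.

  If the edges are connected, they can be attached one after the other so that each new edge touches the
  previous ones; the isolated vertices follow. Every step adds an interval \<open>[G, F]\<close> of faces;
  undoing it enlarges the ideal by the single generator \<open>x\<^sub>G\<close>, whose annihilator modulo the smaller
  ideal is \<open>P\<^sub>F\<close>. This yields a prime filtration whose primes belong to facets, so they are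
  incomparable and the filtration is pretty clean (\<open>pretty_clean_if_shelling\<close>). The sum of the variables and the sum of their pairwise products form a
  regular sequence on every \<open>R / P\<^sub>e\<close> with \<open>e\<close> an edge, and regularity passes to extensions; so the part of
  \<open>\<Gamma>\<close> generated by the edges is Cohen-Macaulay of dimension two, and the isolated vertices contribute
  a Cohen-Macaulay factor of dimension one below it
  (\<open>sequentially_cohen_macaulay_if_edge_connected\<close>).

  Conversely, suppose that a set \<open>A\<close> of vertices separates the edges into two nonempty groups. In a filtration
  that witnesses sequential Cohen-Macaulayness, the last proper ideal \<open>L\<close> lies in \<open>P\<^sub>e\<close> for every edge \<open>e\<close>,
  and \<open>R / L\<close> has a regular sequence of length two. Splitting its two elements along \<open>A\<close> produces an element that
  acts as \<open>0\<close> on one side and as \<open>1\<close> on the other, which is impossible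
  (\<open>no_regular_pair_if_separated\<close>). In a pretty clean filtration, consider the last step whose face meets
  one of the groups. Its face is an edge, and unless it is the very last step, its generator divides powers
  of both variables of this edge modulo \<open>P\<^sub>e\<close> and so is a unit there, although it lies in the maximal ideal
  (\<open>separated_meets_top\<close>). But the face of the very last step cannot meet both groups.

  The dimensions and depths involved are bounded from above by one principle: the elements of a chain of
  successive nonzerodivisors modulo growing ideals are algebraically independent, and counting
  monomials leaves room for only \<open>d\<close> independent elements modulo an ideal that contains all monomials in
  more than \<open>d\<close> variables (\<open>regular_chain_length_le\<close>). Chains of primes and regular sequences are both of
  this kind.
\<close>

section \<open>Monomials and ideals of the polynomial ring\<close>

abbreviation supp :: "('x::finite \<Rightarrow>\<^sub>0 nat) \<Rightarrow> 'x set" where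
  "supp \<equiv> Poly_Mapping.keys"

abbreviation terms :: "('x::finite, 'k::field) mpoly \<Rightarrow> ('x \<Rightarrow>\<^sub>0 nat) set" where
  "terms \<equiv> Poly_Mapping.keys"

lemma supp_add: "supp (s + t) = supp s \<union> supp t"
  by (auto simp: in_keys_iff lookup_add)

lemma terms_times_obtain:
  assumes "u \<in> terms (p * q)"
  obtains s t where "s \<in> terms p" "t \<in> terms q" "u = s + t"
  using keys_times_obtain[OF assms] by blast

lemma carrier_polyring [simp]: "carrier polyring = UNIV"
  and mult_polyring [simp]: "x \<otimes>\<^bsub>polyring\<^esub> y = x * y"
  and add_polyring [simp]: "x \<oplus>\<^bsub>polyring\<^esub> y = x + y"
  and zero_polyring [simp]: "\<zero>\<^bsub>polyring\<^esub> = 0"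
  and one_polyring [simp]: "\<one>\<^bsub>polyring\<^esub> = 1"
  for x y :: "('x::finite, 'k::field) mpoly"
  by (simp_all add: ring_of_type_algebra_def)

lemma cring_polyring: "cring (polyring :: ('x::finite, 'k::field) mpoly ring)"
  by (rule cring_from_type_algebra)

lemma ideal_polyringI:
  fixes N :: "('x::finite, 'k::field) mpoly set"
  assumes "0 \<in> N" "\<And>x y. x \<in> N \<Longrightarrow> y \<in> N \<Longrightarrow> x + y \<in> N" "\<And>a x. x \<in> N \<Longrightarrow> a * x \<in> N"
  shows "ideal N polyring"
proof -
  interpret cring "polyring :: ('x, 'k) mpoly ring" by (rule cring_polyring)
  have inv: "inv\<^bsub>add_monoid polyring\<^esub> x = - x" for x :: "('x, 'k) mpoly"
    by (rule group.inv_equality[OF a_group]) (auto simp: ring_of_type_algebra_def)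
  have m: "- x \<in> N" if "x \<in> N" for x using assms(3)[OF that, of "-1"] by simp
  show ?thesis
  proof (rule idealI)
    show "subgroup N (add_monoid polyring)"
    proof (rule group.subgroupI[OF a_group])
      show "inv\<^bsub>add_monoid polyring\<^esub> x \<in> N" if "x \<in> N" for x
        unfolding inv using m that .
    qed (use assms in auto)
  qed (use assms in \<open>auto simp: mult.commute ring_axioms\<close>)
qed

lemma ideal_zero: "ideal N polyring \<Longrightarrow> 0 \<in> N"
  and ideal_add: "ideal N polyring \<Longrightarrow> x \<in> N \<Longrightarrow> y \<in> N \<Longrightarrow> x + y \<in> N"
  and ideal_mult: "ideal N polyring \<Longrightarrow> x \<in> N \<Longrightarrow> a * x \<in> N"
  and ideal_mult_right: "ideal N polyring \<Longrightarrow> x \<in> N \<Longrightarrow> x * a \<in> N"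
  for N :: "('x::finite, 'k::field) mpoly set"
  using additive_subgroup.zero_closed[OF ideal.axioms(1), of N polyring]
    additive_subgroup.a_closed[OF ideal.axioms(1), of N polyring x y]
    ideal.I_l_closed[of N polyring x a] ideal.I_r_closed[of N polyring x a] by auto

lemma ideal_uminus: "ideal N polyring \<Longrightarrow> x \<in> N \<Longrightarrow> - x \<in> N"
  and ideal_diff: "ideal N polyring \<Longrightarrow> x \<in> N \<Longrightarrow> y \<in> N \<Longrightarrow> x - y \<in> N"
  for N :: "('x::finite, 'k::field) mpoly set"
  using ideal_mult[of N x "-1"] ideal_mult[of N y "-1"] ideal_add[of N x "-y"] by auto

lemma ideal_sum:
  fixes N :: "('x::finite, 'k::field) mpoly set"
  assumes "ideal N polyring" "\<And>i. i \<in> A \<Longrightarrow> f i \<in> N"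
  shows "sum f A \<in> N"
  using assms(2) by (induction A rule: infinite_finite_induct)
    (auto intro: ideal_zero[OF assms(1)] ideal_add[OF assms(1)])

lemma ideal_diff_cancel:
  fixes N :: "('x::finite, 'k::field) mpoly set"
  assumes "ideal N polyring" "x - y \<in> N"
  shows "x \<in> N \<longleftrightarrow> y \<in> N"
  using ideal_add[OF assms(1), of "x - y" y] ideal_diff[OF assms(1), of x "x - y"] assms(2) by auto

text \<open>Monomial ideals correspond to sets of exponents closed under addition of arbitrary exponents; all
  membership questions about them are decided one term at a time.\<close>

definition term_ideal :: "('x::finite \<Rightarrow>\<^sub>0 nat) set \<Rightarrow> ('x, 'k::field) mpoly set" where
  "term_ideal U = {p. terms p \<subseteq> U}"

definition upset :: "('x::finite \<Rightarrow>\<^sub>0 nat) set \<Rightarrow> bool" where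
  "upset U \<longleftrightarrow> (\<forall>s\<in>U. \<forall>t. s + t \<in> U)"

lemma term_ideal_ideal:
  assumes "upset U"
  shows "ideal (term_ideal U :: ('x::finite, 'k::field) mpoly set) polyring"
proof (rule ideal_polyringI)
  fix x y :: "('x, 'k) mpoly"
  assume "x \<in> term_ideal U" "y \<in> term_ideal U"
  thus "x + y \<in> term_ideal U" using Poly_Mapping.keys_add[of x y] by (auto simp: term_ideal_def)
next
  fix a x :: "('x, 'k) mpoly"
  assume "x \<in> term_ideal U"
  thus "a * x \<in> term_ideal U" using assms
    by (force simp: term_ideal_def upset_def add.commute elim!: terms_times_obtain)
qed (simp add: term_ideal_def)

lemma terms_monomial [simp]: "terms (monomial t :: ('x::finite, 'k::field) mpoly) = {t}"
  by (simp add: monomial_def)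

lemma monomial_in_term_ideal [simp]: "monomial t \<in> term_ideal U \<longleftrightarrow> t \<in> U"
  by (simp add: term_ideal_def)

lemma term_ideal_subset_iff [simp]:
  "(term_ideal U :: ('x::finite, 'k::field) mpoly set) \<subseteq> term_ideal V \<longleftrightarrow> U \<subseteq> V"
proof
  assume s: "(term_ideal U :: ('x, 'k) mpoly set) \<subseteq> term_ideal V"
  show "U \<subseteq> V"
  proof
    fix t assume "t \<in> U"
    hence "(monomial t :: ('x, 'k) mpoly) \<in> term_ideal U" by simp
    with s show "t \<in> V" by (metis monomial_in_term_ideal subsetD)
  qed
qed (auto simp: term_ideal_def)

lemma term_ideal_eq_iff [simp]:
  "(term_ideal U :: ('x::finite, 'k::field) mpoly set) = term_ideal V \<longleftrightarrow> U = V"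
  by (simp only: set_eq_subset term_ideal_subset_iff)

lemma poly_eq_sum_terms: 
  "p = (\<Sum>t\<in>terms p. Poly_Mapping.single 0 (Poly_Mapping.lookup p t) * monomial t)"
  by (rule poly_mapping_eqI)
    (auto simp: lookup_sum monomial_def mult_single lookup_single when_def in_keys_iff
       sum.delta' if_distrib cong: if_cong)

lemma term_ideal_genideal:
  "Idl\<^bsub>polyring\<^esub> (monomial ` T) =
     (term_ideal {s + t | s t. s \<in> T} :: ('x::finite, 'k::field) mpoly set)"
proof -
  interpret cring "polyring :: ('x, 'k) mpoly ring" by (rule cring_polyring)
  let ?U = "{s + t | s t. s \<in> T}"
  have "upset ?U" unfolding upset_def by (auto, metis add.assoc)
  hence "ideal (term_ideal ?U :: ('x, 'k) mpoly set) polyring" by (rule term_ideal_ideal)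
  moreover have "monomial ` T \<subseteq> (term_ideal ?U :: ('x, 'k) mpoly set)"
    by (auto, metis add.right_neutral)
  ultimately have "Idl\<^bsub>polyring\<^esub> (monomial ` T) \<subseteq> (term_ideal ?U :: ('x, 'k) mpoly set)"
    by (rule genideal_minimal)
  moreover have "(term_ideal ?U :: ('x, 'k) mpoly set) \<subseteq> Idl\<^bsub>polyring\<^esub> (monomial ` T)"
  proof
    fix p :: "('x, 'k) mpoly" assume p: "p \<in> term_ideal ?U"
    let ?I = "Idl\<^bsub>polyring\<^esub> (monomial ` T) :: ('x, 'k) mpoly set"
    have I: "ideal ?I polyring" by (rule genideal_ideal) simp
    have "monomial u \<in> ?I" if u: "u \<in> ?U" for u
    proof -
      obtain s t where st: "s \<in> T" "u = s + t" using u by blast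
      hence "monomial s \<in> ?I" using genideal_self[of "monomial ` T"] by auto
      hence "monomial t * monomial s \<in> ?I" by (rule ideal_mult[OF I])
      thus ?thesis by (simp add: monomial_def mult_single st add.commute)
    qed
    hence "(\<Sum>t\<in>terms p. Poly_Mapping.single 0 (Poly_Mapping.lookup p t) * monomial t) \<in> ?I"
      using p by (intro ideal_sum[OF I] ideal_mult[OF I]) (auto simp: term_ideal_def)
    thus "p \<in> ?I" using poly_eq_sum_terms[of p] by simp
  qed
  ultimately show ?thesis by blast
qed

lemma monomial_ideal_iff:
  "monomial_ideal (I :: ('x::finite, 'k::field) mpoly set) \<longleftrightarrow> (\<exists>U. upset U \<and> I = term_ideal U)"
proof
  assume "monomial_ideal I"
  moreover have "upset {s + t | s t. s \<in> T}" for T :: "('x \<Rightarrow>\<^sub>0 nat) set"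
    unfolding upset_def by (auto, metis add.assoc)
  ultimately show "\<exists>U. upset U \<and> I = term_ideal U"
    unfolding monomial_ideal_def term_ideal_genideal by blast
next
  assume "\<exists>U. upset U \<and> I = term_ideal U"
  then obtain U where U: "upset U" "I = term_ideal U" by blast
  hence e: "{s + t | s t. s \<in> U} = U" unfolding upset_def by (auto, metis add.right_neutral)
  show "monomial_ideal I" unfolding monomial_ideal_def term_ideal_genideal U(2)
    by (rule exI[of _ U]) (simp only: e)
qed

lemma monomial_ideal_ideal: "monomial_ideal I \<Longrightarrow> ideal I polyring"
  by (auto simp: monomial_ideal_iff intro: term_ideal_ideal)

section \<open>Face ideals and their primes\<close>

text \<open>The Stanley-Reisner ideal written without generators: a polynomial belongs to it iff the support of
  each of its terms is a nonface. The simplex \<open>Pow F\<close> gives the prime generated by the variables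
  outside \<open>F\<close>, and the simplex \<open>Pow {}\<close> gives the graded maximal ideal.\<close>

definition face_ideal :: "'x::finite set set \<Rightarrow> ('x, 'k::field) mpoly set" where
  "face_ideal \<Gamma> = term_ideal {t. supp t \<notin> \<Gamma>}"

abbreviation face_prime :: "'x::finite set \<Rightarrow> ('x, 'k::field) mpoly set" where
  "face_prime F \<equiv> face_ideal (Pow F)"

lemma face_ideal_iff: "p \<in> face_ideal \<Gamma> \<longleftrightarrow> (\<forall>t\<in>terms p. supp t \<notin> \<Gamma>)"
  by (auto simp: face_ideal_def term_ideal_def)

lemma face_prime_iff: "p \<in> face_prime F \<longleftrightarrow> (\<forall>t\<in>terms p. \<not> supp t \<subseteq> F)"
  by (simp add: face_ideal_iff)

lemma upset_nonfaces: "simplicial_complex \<Gamma> \<Longrightarrow> upset {t. supp t \<notin> \<Gamma>}"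
  by (auto simp: upset_def simplicial_complex_def supp_add)

lemma simplicial_complex_Pow [simp]: "simplicial_complex (Pow F)"
  by (auto simp: simplicial_complex_def)

lemma face_ideal_ideal: "simplicial_complex \<Gamma> \<Longrightarrow> ideal (face_ideal \<Gamma>) polyring"
  unfolding face_ideal_def by (intro term_ideal_ideal upset_nonfaces)

lemmas face_prime_ideal = face_ideal_ideal[OF simplicial_complex_Pow]

lemma monomial_face_ideal: "simplicial_complex \<Gamma> \<Longrightarrow> monomial_ideal (face_ideal \<Gamma>)"
  unfolding monomial_ideal_iff face_ideal_def using upset_nonfaces by blast

definition face_term :: "'x::finite set \<Rightarrow> ('x \<Rightarrow>\<^sub>0 nat)" where
  "face_term F = (\<Sum>j\<in>F. Poly_Mapping.single j (Suc 0))"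

lemma lookup_face_term: "Poly_Mapping.lookup (face_term F) i = (if i \<in> F then 1 else 0)"
  unfolding face_term_def by (rule lookup_squarefree)

lemma supp_face_term [simp]: "supp (face_term F) = F"
  by (auto simp: in_keys_iff lookup_face_term split: if_splits)

lemma squarefree_monomial_eq_face_term: "squarefree_monomial F = monomial (face_term F)"
  by (simp add: face_term_def squarefree_monomial_eq)

lemma face_term_decompose:
  assumes "F \<subseteq> supp t"
  shows "\<exists>s. t = face_term F + s"
proof
  show "t = face_term F + (t - face_term F)"
    using assms
    by (intro poly_mapping_eqI)
      (fastforce simp: lookup_add lookup_minus lookup_face_term in_keys_iff)
qed

lemma stanley_reisner_ideal_eq:
  assumes "simplicial_complex \<Gamma>"
  shows "stanley_reisner_ideal \<Gamma> = (face_ideal \<Gamma> :: ('x::finite, 'k::field) mpoly set)"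
proof -
  have 1: "squarefree_monomial ` {F. F \<notin> \<Gamma>} = (monomial ` (face_term ` {F. F \<notin> \<Gamma>}) :: ('x, 'k) mpoly set)"
    by (auto simp: squarefree_monomial_eq_face_term)
  have 2: "{s + t | s t. s \<in> face_term ` {F. F \<notin> \<Gamma>}} = {t. supp t \<notin> \<Gamma>}"
  proof (intro equalityI subsetI; clarsimp)
    fix t F assume "F \<notin> \<Gamma>" "supp (face_term F + t) \<in> \<Gamma>"
    thus False using assms unfolding simplicial_complex_def by (auto simp: supp_add)
  next
    fix t :: "'x \<Rightarrow>\<^sub>0 nat" assume "supp t \<notin> \<Gamma>"
    thus "\<exists>s. (\<exists>v. t = s + v) \<and> s \<in> face_term ` {F. F \<notin> \<Gamma>}"
      using face_term_decompose[of "supp t" t] by blast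
  qed
  show ?thesis
    unfolding stanley_reisner_ideal_def 1 term_ideal_genideal 2 face_ideal_def ..
qed

text \<open>An enumeration of the variables transports the lexicographic order of \<open>nat \<Rightarrow>\<^sub>0 nat\<close>; this supplies
  a total order of the exponents that is compatible with addition, although the index type of the
  variables carries no order.\<close>

lemma exists_additive_order_embedding:
  "\<exists>h :: ('x::finite \<Rightarrow>\<^sub>0 nat) \<Rightarrow> (nat \<Rightarrow>\<^sub>0 nat). inj h \<and> (\<forall>s t. h (s + t) = h s + h t)"
proof -
  obtain f :: "'x \<Rightarrow> nat" where f: "inj f"
    using finite_imp_inj_to_nat_seg[of "UNIV :: 'x set"] by auto
  define h where "h t = (\<Sum>x\<in>UNIV. Poly_Mapping.single (f x) (Poly_Mapping.lookup t x))" for t :: "'x \<Rightarrow>\<^sub>0 nat"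
  have l: "Poly_Mapping.lookup (h t) (f x) = Poly_Mapping.lookup t x" for t x
    unfolding h_def lookup_sum lookup_single using f by (simp add: when_def inj_eq)
  have "inj h" by (rule injI, rule poly_mapping_eqI, metis l)
  moreover have "h (s + t) = h s + h t" for s t
    by (simp add: h_def lookup_add single_add sum.distrib)
  ultimately show ?thesis by blast
qed

text \<open>A coefficient of a product consists of a single summand as soon as its exponent has only one
  decomposition into exponents of the factors, for example when both are leading ones.\<close>

lemma lookup_mult_extremal:
  fixes p q :: "('x::finite, 'k::field) mpoly"
  assumes "\<And>s t. s \<in> terms p \<Longrightarrow> t \<in> terms q \<Longrightarrow> s + t = s0 + t0 \<Longrightarrow> s = s0 \<and> t = t0"
  shows "Poly_Mapping.lookup (p * q) (s0 + t0) = Poly_Mapping.lookup p s0 * Poly_Mapping.lookup q t0"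
proof -
  have "Poly_Mapping.lookup (p * q) (s0 + t0) =
     (\<Sum>s\<in>terms p. \<Sum>t\<in>terms q. Poly_Mapping.lookup (Poly_Mapping.single s (Poly_Mapping.lookup p s) * 
         Poly_Mapping.single t (Poly_Mapping.lookup q t)) (s0 + t0))"
  proof -
    have e: "r = (\<Sum>s\<in>terms r. Poly_Mapping.single s (Poly_Mapping.lookup r s))" for r :: "('x, 'k) mpoly"
      using poly_eq_sum_terms[of r] by (simp add: monomial_def mult_single)
    show ?thesis
      by (subst (1) e[of p], subst (1) e[of q]) (simp add: sum_product lookup_sum)
  qed
  also have "\<dots> = (\<Sum>s\<in>terms p. \<Sum>t\<in>terms q. if s = s0 then if t = t0 then Poly_Mapping.lookup p s0 * Poly_Mapping.lookup q t0 else 0 else 0)"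
    by (intro sum.cong refl) (use assms in \<open>auto simp: mult_single lookup_single when_def\<close>)
  also have "\<dots> = (\<Sum>s\<in>terms p. if s = s0 then if t0 \<in> terms q then Poly_Mapping.lookup p s0 * Poly_Mapping.lookup q t0 else 0 else 0)"
    by (intro sum.cong refl) simp
  also have "\<dots> = Poly_Mapping.lookup p s0 * Poly_Mapping.lookup q t0"
    by (simp add: in_keys_iff)
  finally show ?thesis .
qed

text \<open>Among the terms with support inside \<open>F\<close>, the product of the leading terms of the two factors cannot
  cancel. Terms whose support leaves \<open>F\<close> do not interfere, since supports only grow under
  multiplication.\<close>

lemma face_prime_prime:
  fixes p q :: "('x::finite, 'k::field) mpoly"
  assumes "p * q \<in> face_prime F"
  shows "p \<in> face_prime F \<or> q \<in> face_prime F"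
proof (rule ccontr)
  assume n: "\<not> (p \<in> face_prime F \<or> q \<in> face_prime F)"
  obtain h :: "('x \<Rightarrow>\<^sub>0 nat) \<Rightarrow> (nat \<Rightarrow>\<^sub>0 nat)" where h: "inj h" "\<And>s t. h (s + t) = h s + h t"
    using exists_additive_order_embedding by blast
  have lead: "\<exists>s0. s0 \<in> terms r \<and> supp s0 \<subseteq> F \<and> (\<forall>s\<in>terms r. supp s \<subseteq> F \<longrightarrow> h s \<le> h s0)"
    if "r \<notin> face_prime F" for r :: "('x, 'k) mpoly"
  proof -
    let ?S = "{s\<in>terms r. supp s \<subseteq> F}"
    have f: "finite (h ` ?S)" by simp
    have "?S \<noteq> {}" using that by (auto simp: face_prime_iff)
    hence "Max (h ` ?S) \<in> h ` ?S" by (intro Max_in f) auto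
    then obtain s0 where s0: "s0 \<in> ?S" "Max (h ` ?S) = h s0" by blast
    have "h s \<le> h s0" if "s \<in> ?S" for s
      using Max_ge[OF f imageI[OF that]] by (simp only: s0(2))
    with s0(1) show ?thesis by blast
  qed
  obtain s0 where s0: "s0 \<in> terms p" "supp s0 \<subseteq> F" "\<And>s. s \<in> terms p \<Longrightarrow> supp s \<subseteq> F \<Longrightarrow> h s \<le> h s0"
    using lead[of p] n by blast
  obtain t0 where t0: "t0 \<in> terms q" "supp t0 \<subseteq> F" "\<And>s. s \<in> terms q \<Longrightarrow> supp s \<subseteq> F \<Longrightarrow> h s \<le> h t0"
    using lead[of q] n by blast
  have "s = s0 \<and> t = t0" if "s \<in> terms p" "t \<in> terms q" and e: "s + t = s0 + t0" for s t
  proof -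
    have "supp s \<union> supp t = supp s0 \<union> supp t0" using arg_cong[OF e, of supp] by (simp add: supp_add)
    hence "supp s \<subseteq> F" "supp t \<subseteq> F" using s0 t0 by auto
    hence l: "h s \<le> h s0" "h t \<le> h t0" using that s0 t0 by blast+
    have "h s + h t = h s0 + h t0" using e h(2) by metis
    hence "\<not> h s < h s0" "\<not> h t < h t0"
      using add_less_le_mono[of "h s" "h s0" "h t" "h t0"] add_le_less_mono[of "h s" "h s0" "h t" "h t0"] l
      by (metis less_irrefl)+
    hence "h s = h s0 \<and> h t = h t0" using l by (metis order_le_imp_less_or_eq)
    thus ?thesis using h(1) by (auto dest: injD)
  qed
  hence "Poly_Mapping.lookup (p * q) (s0 + t0) = Poly_Mapping.lookup p s0 * Poly_Mapping.lookup q t0"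
    by (rule lookup_mult_extremal)
  also have "\<dots> \<noteq> 0" using s0 t0 by (simp add: in_keys_iff)
  finally have "s0 + t0 \<in> terms (p * q)" by (simp add: in_keys_iff)
  with assms s0(2) t0(2) show False by (metis Un_least face_prime_iff supp_add)
qed

lemma one_notin_face_prime [simp]: "1 \<notin> face_prime F"
  by (simp add: face_prime_iff)

lemma face_prime_primeideal: "primeideal (face_prime F) polyring"
  by (rule primeidealI[OF face_prime_ideal cring_polyring])
    (use one_notin_face_prime in \<open>auto dest: face_prime_prime simp del: one_notin_face_prime\<close>)

lemma face_ideal_mono: "\<Gamma>' \<subseteq> \<Gamma> \<Longrightarrow> face_ideal \<Gamma> \<subseteq> face_ideal \<Gamma>'"
  unfolding face_ideal_iff subset_iff by blast

lemma face_ideal_subset_iff: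
  "(face_ideal \<Gamma> :: ('x::finite, 'k::field) mpoly set) \<subseteq> face_ideal \<Gamma>' \<longleftrightarrow> \<Gamma>' \<subseteq> \<Gamma>"
proof
  assume s: "(face_ideal \<Gamma> :: ('x, 'k) mpoly set) \<subseteq> face_ideal \<Gamma>'"
  show "\<Gamma>' \<subseteq> \<Gamma>"
  proof
    fix F assume "F \<in> \<Gamma>'"
    hence "face_term F \<notin> {t. supp t \<notin> \<Gamma>'}" by simp
    with s have "face_term F \<notin> {t. supp t \<notin> \<Gamma>}" unfolding face_ideal_def term_ideal_subset_iff by blast
    thus "F \<in> \<Gamma>" by simp
  qed
qed (rule face_ideal_mono)

lemma face_prime_psubset_iff:
  "(face_prime F :: ('x::finite, 'k::field) mpoly set) \<subset> face_prime G \<longleftrightarrow> G \<subset> F"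
proof -
  have "Pow A \<subseteq> Pow B \<longleftrightarrow> A \<subseteq> B" for A B :: "'x set" by blast
  thus ?thesis unfolding less_le_not_le face_ideal_subset_iff by simp
qed

lemma monomial_in_face_ideal [simp]: "monomial t \<in> face_ideal \<Gamma> \<longleftrightarrow> supp t \<notin> \<Gamma>"
  by (simp add: face_ideal_iff)

lemma variable_eq_monomial: "variable v = monomial (Poly_Mapping.single v 1)"
  by (simp add: variable_def)

lemma variable_in_face_ideal [simp]: "variable v \<in> face_ideal \<Gamma> \<longleftrightarrow> {v} \<notin> \<Gamma>"
  by (simp add: variable_eq_monomial)

lemma maximal_ideal_eq:
  "Idl\<^bsub>polyring\<^esub> (range variable) = (face_prime {} :: ('x::finite, 'k::field) mpoly set)"
proof -
  have "range (variable :: 'x \<Rightarrow> ('x, 'k) mpoly) = monomial ` range (\<lambda>v. Poly_Mapping.single v 1)"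
    by (simp add: variable_def image_image)
  moreover have "{s + t | s t. s \<in> range (\<lambda>v. Poly_Mapping.single v 1)} = {t :: 'x \<Rightarrow>\<^sub>0 nat. supp t \<notin> Pow {}}"
  proof (intro equalityI subsetI; clarsimp)
    fix t :: "'x \<Rightarrow>\<^sub>0 nat" and v assume "Poly_Mapping.single v (Suc 0) + t = 0"
    hence "supp (Poly_Mapping.single v (Suc 0) + t) = {}" by (simp only: keys_zero)
    thus False by (simp add: supp_add)
  next
    fix t :: "'x \<Rightarrow>\<^sub>0 nat" assume "t \<noteq> 0"
    then obtain v where "v \<in> supp t" by fastforce
    then obtain s where "t = face_term {v} + s" using face_term_decompose[of "{v}" t] by auto
    thus "\<exists>s. (\<exists>u. t = s + u) \<and> s \<in> range (\<lambda>v. Poly_Mapping.single v (Suc 0))"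
      by (auto simp: face_term_def)
  qed
  ultimately show ?thesis by (simp only: term_ideal_genideal face_ideal_def)
qed

section \<open>Algebraic independence along regular chains\<close>

text \<open>A homogeneous system of linear equations with more unknowns than equations has a nontrivial
  solution; Gaussian elimination removes one equation and one unknown at a time.\<close>

lemma exists_linear_dependence:
  fixes v :: "'e \<Rightarrow> 't \<Rightarrow> 'k::field"
  assumes "finite M" "finite E" "card M < card E"
  shows "\<exists>c. (\<exists>e\<in>E. c e \<noteq> 0) \<and> (\<forall>t\<in>M. (\<Sum>e\<in>E. c e * v e t) = 0)"
  using assms
proof (induction M arbitrary: E v rule: finite_induct)
  case empty
  hence "E \<noteq> {}" by auto
  thus ?case by (intro exI[of _ "\<lambda>_. 1"]) auto
next
  case (insert t M)
  show ?case
  proof (cases "\<forall>e\<in>E. v e t = 0")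
    case True
    have "card M < card E" using insert by simp
    then obtain c where "\<exists>e\<in>E. c e \<noteq> 0" "\<forall>t\<in>M. (\<Sum>e\<in>E. c e * v e t) = 0"
      using insert.IH[of E v] insert.prems by blast
    thus ?thesis using True by (intro exI[of _ c]) auto
  next
    case False
    then obtain e0 where e0: "e0 \<in> E" "v e0 t \<noteq> 0" by blast
    let ?E = "E - {e0}"
    have "card M < card ?E" using insert e0 by simp
    then obtain c where c: "\<exists>e\<in>?E. c e \<noteq> 0"
      "\<And>s. s \<in> M \<Longrightarrow> (\<Sum>e\<in>?E. c e * (v e s - v e t / v e0 t * v e0 s)) = 0"
      using insert.IH[of ?E "\<lambda>e s. v e s - v e t / v e0 t * v e0 s"] insert.prems by blast
    \<comment> \<open>the pivot unknown is chosen so that the equation for \<open>t\<close> holds\<close>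
    define b where "b = - (\<Sum>e\<in>?E. c e * v e t) / v e0 t"
    have split: "(\<Sum>e\<in>E. (c(e0 := b)) e * v e s) = b * v e0 s + (\<Sum>e\<in>?E. c e * v e s)" for s
      using insert.prems e0 by (simp add: sum.remove[of E e0])
    have "(\<Sum>e\<in>E. (c(e0 := b)) e * v e s) = 0" if "s \<in> insert t M" for s
    proof (cases "s = t")
      case True
      show ?thesis unfolding split unfolding True b_def using e0(2) by simp
    next
      case False
      hence "0 = (\<Sum>e\<in>?E. c e * (v e s - v e t / v e0 t * v e0 s))" using that c(2) by simp
      also have "\<dots> = (\<Sum>e\<in>?E. c e * v e s) - (\<Sum>e\<in>?E. c e * v e t / v e0 t * v e0 s)"
        by (simp add: algebra_simps sum_subtractf)
      also have "(\<Sum>e\<in>?E. c e * v e t / v e0 t * v e0 s) = - b * v e0 s"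
        by (simp add: b_def sum_distrib_right sum_divide_distrib)
      finally show ?thesis unfolding split by (simp add: add.commute)
    qed
    moreover have "\<exists>e\<in>E. (c(e0 := b)) e \<noteq> 0" using c(1) by auto
    ultimately show ?thesis by blast
  qed
qed

abbreviation const :: "'k::field \<Rightarrow> ('x::finite, 'k) mpoly" where
  "const \<equiv> Poly_Mapping.single 0"

lemma const_mult_inverse: "c \<noteq> 0 \<Longrightarrow> const (inverse c) * const c = 1"
  by (simp add: mult_single)

definition power_product :: "('x::finite, 'k::field) mpoly list \<Rightarrow> nat list \<Rightarrow> ('x, 'k) mpoly" where
  "power_product as e = prod_list (map2 (^) as e)"

lemma power_product_Nil [simp]: "power_product [] e = 1"
  and power_product_Cons [simp]: "power_product (a # as) (k # e) = a ^ k * power_product as e"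
  by (simp_all add: power_product_def)

text \<open>The common shape of a strictly increasing chain of primes and of a regular sequence: ideals
  \<open>N\<^sub>0 \<subseteq> N\<^sub>1 \<subseteq> \<dots>\<close> not containing \<open>1\<close> together with elements, each of which is a nonzerodivisor modulo one
  ideal of the chain and lies in the next. Both Krull dimension and depth are bounded by bounding the
  length of such chains.\<close>

inductive regular_chain :: "('x::finite, 'k::field) mpoly set \<Rightarrow> ('x, 'k) mpoly list \<Rightarrow> bool" where
  Nil: "ideal N polyring \<Longrightarrow> 1 \<notin> N \<Longrightarrow> regular_chain N []"
| Cons: "ideal N polyring \<Longrightarrow> (\<And>b. a * b \<in> N \<Longrightarrow> b \<in> N) \<Longrightarrow> N \<subseteq> N' \<Longrightarrow> a \<in> N' \<Longrightarrow>
     regular_chain N' as \<Longrightarrow> regular_chain N (a # as)"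

lemma power_cancel:
  fixes a :: "('x::finite, 'k::field) mpoly"
  assumes "\<And>b. a * b \<in> N \<Longrightarrow> b \<in> N" "a ^ k * b \<in> N"
  shows "b \<in> N"
  using assms(2) by (induction k) (use assms(1) in \<open>auto simp: mult.assoc\<close>)

lemma regular_chain_ideal: "regular_chain N as \<Longrightarrow> ideal N polyring"
  by (auto elim: regular_chain.cases)

text \<open>In a polynomial relation modulo \<open>N\<close> take the terms with the least power of the first element. This
  power can be cancelled, and modulo the next ideal only these terms survive; so they form a relation
  between the remaining elements. At the end a nonzero constant would lie in a proper ideal.\<close>

lemma regular_chain_algebraically_independent:
  fixes as :: "('x::finite, 'k::field) mpoly list"
  assumes "regular_chain N as" "finite E" "\<And>e. e \<in> E \<Longrightarrow> length e = length as"
    and "(\<Sum>e\<in>E. const (c e) * power_product as e) \<in> N"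
  shows "\<forall>e\<in>E. c e = 0"
  using assms
proof (induction arbitrary: E c rule: regular_chain.induct)
  case (Nil N)
  hence "E \<subseteq> {[]}" by auto
  then consider "E = {}" | "E = {[]}" by blast
  thus ?case
  proof cases
    case 2
    hence "const (c []) \<in> N" using Nil by simp
    hence "const (inverse (c [])) * const (c []) \<in> N" by (rule ideal_mult[OF Nil(1)])
    hence "c [] = 0" using const_mult_inverse Nil(2) by metis
    thus ?thesis using 2 by simp
  qed auto
next
  case (Cons N a N' as)
  show ?case
  proof (rule ccontr)
    assume nz: "\<not> (\<forall>e\<in>E. c e = 0)"
    define E0 where "E0 = {e\<in>E. c e \<noteq> 0}"
    have E0: "finite E0" "E0 \<noteq> {}" using nz Cons.prems by (auto simp: E0_def)
    have len: "\<exists>k e'. e = k # e' \<and> length e' = length as" if "e \<in> E0" for e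
      using Cons.prems(2)[of e] that by (cases e) (auto simp: E0_def)
    define k where "k = Min (hd ` E0)"
    have k_le: "k \<le> hd e" if "e \<in> E0" for e using E0 that by (simp add: k_def)
    have "k \<in> hd ` E0" unfolding k_def by (rule Min_in) (use E0 in auto)
    define E1 where "E1 = {e\<in>E0. hd e = k}"
    let ?t = "\<lambda>e. const (c e) * (a ^ (hd e - k) * power_product as (tl e))"
    have "(\<Sum>e\<in>E. const (c e) * power_product (a # as) e) = (\<Sum>e\<in>E0. const (c e) * power_product (a # as) e)"
      using Cons.prems(1) by (intro sum.mono_neutral_right) (auto simp: E0_def)
    also have "\<dots> = (\<Sum>e\<in>E0. a ^ k * ?t e)"
    proof (rule sum.cong[OF refl])
      fix e assume e: "e \<in> E0"
      then obtain j e' where je: "e = j # e'" using len by blast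
      hence "a ^ j = a ^ k * a ^ (j - k)" using k_le[OF e] by (simp flip: power_add)
      thus "const (c e) * power_product (a # as) e = a ^ k * ?t e" by (simp add: je mult_ac)
    qed
    finally have "a ^ k * (\<Sum>e\<in>E0. ?t e) \<in> N" using Cons.prems(3) by (simp add: sum_distrib_left)
    hence "(\<Sum>e\<in>E0. ?t e) \<in> N" using power_cancel[of a N] Cons.hyps(2) by blast
    hence all: "(\<Sum>e\<in>E0. ?t e) \<in> N'" using Cons.hyps by blast
    have id: "ideal N' polyring" by (rule regular_chain_ideal) fact
    have "?t e \<in> N'" if "e \<in> E0 - E1" for e
    proof -
      have "hd e - k = Suc (hd e - k - 1)" using k_le[of e] that by (auto simp: E1_def)
      hence "?t e = const (c e) * a ^ (hd e - k - 1) * power_product as (tl e) * a"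
        by (metis (no_types, lifting) mult.assoc mult.commute power_Suc)
      thus ?thesis using ideal_mult[OF id Cons.hyps(4)] by metis
    qed
    hence rest: "(\<Sum>e\<in>E0 - E1. ?t e) \<in> N'" by (rule ideal_sum[OF id])
    have "(\<Sum>e\<in>E0. ?t e) = (\<Sum>e\<in>E0 - E1. ?t e) + (\<Sum>e\<in>E1. ?t e)"
      by (rule sum.subset_diff) (use E0 in \<open>auto simp: E1_def\<close>)
    hence "(\<Sum>e\<in>E1. ?t e) = (\<Sum>e\<in>E0. ?t e) - (\<Sum>e\<in>E0 - E1. ?t e)" by simp
    hence "(\<Sum>e\<in>E1. ?t e) \<in> N'" using ideal_diff[OF id all rest] by simp
    moreover have "(\<Sum>e\<in>E1. ?t e) = (\<Sum>e'\<in>tl ` E1. const (c (k # e')) * power_product as e')"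
    proof (subst sum.reindex)
      show "inj_on tl E1"
      proof (rule inj_onI)
        fix x y assume "x \<in> E1" "y \<in> E1" "tl x = tl y"
        thus "x = y" using len[of x] len[of y] by (auto simp: E1_def)
      qed
      show "(\<Sum>e\<in>E1. ?t e) = sum ((\<lambda>e'. const (c (k # e')) * power_product as e') \<circ> tl) E1"
        using len by (intro sum.cong) (force simp: E1_def)+
    qed
    moreover have len_tl: "length e' = length as" if "e' \<in> tl ` E1" for e'
      using len that by (force simp: E1_def)
    ultimately have "\<forall>e'\<in>tl ` E1. c (k # e') = 0"
      using E0 len_tl by (intro Cons.IH) (auto simp: E1_def)
    moreover obtain e where "e \<in> E0" "hd e = k" using \<open>k \<in> hd ` E0\<close> by auto
    ultimately show False using len[of e] by (force simp: E1_def E0_def)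
  qed
qed

text \<open>The point is that the number of monomials with at most \<open>d\<close> variables and exponents up to \<open>D\<close> grows
  only like \<open>D ^ d\<close>.\<close>

lemma card_bounded_terms:
  "finite {t :: 'x::finite \<Rightarrow>\<^sub>0 nat. card (supp t) \<le> d \<and> (\<forall>x. Poly_Mapping.lookup t x \<le> D)}"
  "card {t :: 'x::finite \<Rightarrow>\<^sub>0 nat. card (supp t) \<le> d \<and> (\<forall>x. Poly_Mapping.lookup t x \<le> D)}
     \<le> 2 ^ CARD('x) * (D + 1) ^ d"
proof -
  let ?M = "{t :: 'x \<Rightarrow>\<^sub>0 nat. card (supp t) \<le> d \<and> (\<forall>x. Poly_Mapping.lookup t x \<le> D)}"
  let ?S = "SIGMA F:{F :: 'x set. card F \<le> d}. PiE F (\<lambda>_. {..D})"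
  let ?f = "\<lambda>t :: 'x \<Rightarrow>\<^sub>0 nat. (supp t, restrict (Poly_Mapping.lookup t) (supp t))"
  have inj: "inj_on ?f ?M"
  proof (rule inj_onI, rule poly_mapping_eqI)
    fix s t :: "'x \<Rightarrow>\<^sub>0 nat" and x
    assume e: "?f s = ?f t"
    show "Poly_Mapping.lookup s x = Poly_Mapping.lookup t x"
    proof (cases "x \<in> supp s")
      case True
      thus ?thesis using e by (metis (no_types, lifting) Pair_inject restrict_apply')
    next
      case False
      moreover have "x \<notin> supp t" using e False by simp
      ultimately show ?thesis by (simp add: in_keys_iff)
    qed
  qed
  have img: "?f ` ?M \<subseteq> ?S" by (auto intro!: restrict_PiE simp: PiE_iff)
  have fin: "finite ?S" by (intro finite_SigmaI finite_PiE) auto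
  show "finite ?M" using finite_imageD[OF finite_subset[OF img fin] inj] .
  have "card ?M \<le> card ?S" using card_inj_on_le[OF inj img fin] .
  also have "\<dots> = (\<Sum>F\<in>{F :: 'x set. card F \<le> d}. (D + 1) ^ card F)"
    by (subst card_SigmaI) (auto simp: finite_PiE card_PiE)
  also have "\<dots> \<le> (\<Sum>F\<in>{F :: 'x set. card F \<le> d}. (D + 1) ^ d)"
    by (intro sum_mono power_increasing) auto
  also have "\<dots> \<le> card (UNIV :: 'x set set) * (D + 1) ^ d"
    by (simp add: card_mono del: card_set)
  also have "card (UNIV :: 'x set set) = 2 ^ CARD('x)"
    using card_Pow[of "UNIV :: 'x set"] by simp
  finally show "card ?M \<le> 2 ^ CARD('x) * (D + 1) ^ d" .
qed

lemma terms_power_product_bound: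
  fixes as :: "('x::finite, 'k::field) mpoly list"
  assumes "\<And>a t x. a \<in> set as \<Longrightarrow> t \<in> terms a \<Longrightarrow> Poly_Mapping.lookup t x \<le> B"
    and "length e = length as" "t \<in> terms (power_product as e)"
  shows "Poly_Mapping.lookup t x \<le> B * sum_list e"
  using assms(2,1,3)
proof (induction e as arbitrary: t rule: list_induct2)
  case Nil
  thus ?case by simp
next
  case (Cons k e a as)
  have pow: "Poly_Mapping.lookup s x \<le> B * k" if "s \<in> terms (a ^ k)" for s
    using that
  proof (induction k arbitrary: s)
    case (Suc k)
    then obtain u v where "u \<in> terms a" "v \<in> terms (a ^ k)" "s = u + v"
      by (auto elim: terms_times_obtain)
    thus ?case using Suc.IH[of v] Cons.prems(1)[of a u x] by (simp add: lookup_add)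
  qed simp
  obtain u v where "u \<in> terms (a ^ k)" "v \<in> terms (power_product as e)" "t = u + v"
    using Cons.prems(2) by (auto elim: terms_times_obtain)
  moreover from this have "Poly_Mapping.lookup v x \<le> B * sum_list e"
    using Cons.prems(1) by (intro Cons.IH) auto
  ultimately show ?case using pow[of u] by (simp add: lookup_add algebra_simps)
qed

lemma exists_power_dominating:
  assumes "d < (m::nat)"
  shows "\<exists>K::nat. A * (B * K + 1) ^ d < K ^ m"
proof -
  \<comment> \<open>\<open>B K + 1 \<le> (B + 1) K\<close>, so a factor \<open>K\<close> above \<open>A (B + 1) ^ d\<close> is enough\<close>
  define K where "K = A * (B + 1) ^ d + 1"
  have K: "1 \<le> K" unfolding K_def by (rule le_add2)
  have "A * (B * K + 1) ^ d \<le> A * ((B + 1) * K) ^ d"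
    using K by (intro mult_left_mono power_mono) (auto simp: algebra_simps)
  also have "\<dots> = A * (B + 1) ^ d * K ^ d" by (simp only: power_mult_distrib mult.assoc)
  also have "\<dots> < K * K ^ d" using K by (simp add: K_def)
  also have "\<dots> \<le> K ^ m" using assms K power_increasing[of "Suc d" m K] by simp
  finally show ?thesis by blast
qed

text \<open>Modulo \<open>N\<close>, the power products of \<open>m\<close> elements with exponents below \<open>K\<close> are combinations of the
  monomials with at most \<open>d\<close> variables and exponents \<open>O(K)\<close>. There are \<open>K ^ m\<close> power products but only
  \<open>O(K ^ d)\<close> such monomials; for \<open>d < m\<close> and large \<open>K\<close> this forces a linear relation, against algebraic
  independence.\<close>

theorem regular_chain_length_le:
  fixes as :: "('x::finite, 'k::field) mpoly list"
  assumes chain: "regular_chain N as"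
    and d: "term_ideal {t. d < card (supp t)} \<subseteq> N"
  shows "length as \<le> d"
proof (rule ccontr)
  assume "\<not> length as \<le> d"
  define m where "m = length as"
  define B where "B = (\<Sum>a\<in>set as. \<Sum>t\<in>terms a. \<Sum>x\<in>UNIV. Poly_Mapping.lookup t x)"
  have B: "Poly_Mapping.lookup t x \<le> B" if "a \<in> set as" "t \<in> terms a" for a t x
  proof -
    have "Poly_Mapping.lookup t x \<le> (\<Sum>x\<in>UNIV. Poly_Mapping.lookup t x)" by (rule member_le_sum) auto
    also have "\<dots> \<le> (\<Sum>t\<in>terms a. \<Sum>x\<in>UNIV. Poly_Mapping.lookup t x)"
      by (rule member_le_sum[of t]) (use that in auto)
    also have "\<dots> \<le> B" unfolding B_def by (rule member_le_sum[of a]) (use that in auto)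
    finally show ?thesis .
  qed
  have "d < m" using \<open>\<not> length as \<le> d\<close> by (simp add: m_def)
  then obtain K where K: "2 ^ CARD('x) * (B * m * K + 1) ^ d < K ^ m"
    using exists_power_dominating by blast
  define D where "D = B * m * K"
  define E where "E = {e :: nat list. set e \<subseteq> {..<K} \<and> length e = m}"
  define M where "M = {t :: 'x \<Rightarrow>\<^sub>0 nat. card (supp t) \<le> d \<and> (\<forall>x. Poly_Mapping.lookup t x \<le> D)}"
  have E: "finite E" "card E = K ^ m"
    unfolding E_def by (auto simp: finite_lists_length_eq card_lists_length_eq)
  have "card M < card E"
    using K card_bounded_terms(2)[where 'x='x, of d D] by (simp add: E M_def D_def)
  then obtain c where c: "\<exists>e\<in>E. c e \<noteq> 0"
      "\<And>t. t \<in> M \<Longrightarrow> (\<Sum>e\<in>E. c e * Poly_Mapping.lookup (power_product as e) t) = 0"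
    using exists_linear_dependence[of M E "\<lambda>e. Poly_Mapping.lookup (power_product as e)"] E
      card_bounded_terms(1)[where 'x='x, of d D] unfolding M_def by blast
  let ?p = "\<Sum>e\<in>E. const (c e) * power_product as e"
  have "?p \<in> term_ideal {t. d < card (supp t)}"
    unfolding term_ideal_def
  proof (clarify, rule ccontr)
    fix t assume t: "t \<in> terms ?p" and n: "\<not> d < card (supp t)"
    have const_mult: "Poly_Mapping.lookup (const b * q) t = b * Poly_Mapping.lookup q t" 
      for b :: 'k and q :: "('x, 'k) mpoly"
    proof -
      have "Poly_Mapping.lookup (const b * q) (0 + t) =
          Poly_Mapping.lookup (const b :: ('x, 'k) mpoly) 0 * Poly_Mapping.lookup q t"
        by (rule lookup_mult_extremal) (simp split: if_splits)
      thus ?thesis by simp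
    qed
    have l: "Poly_Mapping.lookup ?p t = (\<Sum>e\<in>E. c e * Poly_Mapping.lookup (power_product as e) t)"
      by (simp add: lookup_sum const_mult)
    with t have "(\<Sum>e\<in>E. c e * Poly_Mapping.lookup (power_product as e) t) \<noteq> 0"
      by (simp add: in_keys_iff)
    then obtain e where e: "e \<in> E" "t \<in> terms (power_product as e)"
      by (metis (no_types, lifting) in_keys_iff mult_zero_right sum.neutral)
    have "Poly_Mapping.lookup t x \<le> D" for x
    proof -
      have "Poly_Mapping.lookup t x \<le> B * sum_list e"
        by (rule terms_power_product_bound[OF B _ e(2)]) (use e in \<open>auto simp: E_def m_def\<close>)
      also have "sum_list e \<le> m * K"
        using sum_list_mono[of e "\<lambda>x. x" "\<lambda>_. K"] e(1)
        by (auto simp: E_def sum_list_triv less_imp_le subset_iff)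
      finally show ?thesis by (simp add: D_def mult.assoc)
    qed
    hence "t \<in> M" using n by (simp add: M_def)
    with c(2) l t show False by (simp add: in_keys_iff)
  qed
  hence "?p \<in> N" using d by blast
  hence "\<forall>e\<in>E. c e = 0"
    by (intro regular_chain_algebraically_independent[OF chain]) (auto simp: E, auto simp: E_def m_def)
  with c(1) show False by blast
qed

section \<open>Subquotients and regular sequences\<close>

abbreviation coset :: "('x::finite, 'k::field) mpoly set \<Rightarrow> ('x, 'k) mpoly \<Rightarrow> ('x, 'k) mpoly set" where
  "coset J x \<equiv> J +>\<^bsub>polyring\<^esub> x"

lemma mem_coset_iff: "y \<in> coset J x \<longleftrightarrow> y - x \<in> J"
  by (auto simp: a_r_coset_def') (metis diff_add_cancel)

lemma coset_eq_iff:
  fixes J :: "('x::finite, 'k::field) mpoly set"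
  assumes "ideal J polyring"
  shows "coset J x = coset J y \<longleftrightarrow> x - y \<in> J"
proof
  assume "coset J x = coset J y"
  moreover have "x \<in> coset J x" using ideal_zero[OF assms] by (simp add: mem_coset_iff)
  ultimately show "x - y \<in> J" by (simp add: mem_coset_iff)
next
  assume d: "x - y \<in> J"
  have "z - x \<in> J \<longleftrightarrow> z - y \<in> J" for z
    by (rule ideal_diff_cancel[OF assms]) (use ideal_uminus[OF assms d] in simp)
  thus "coset J x = coset J y" by (auto simp: mem_coset_iff)
qed

lemma coset_zero: "coset J 0 = J"
  by (auto simp: mem_coset_iff)

lemma ideal_colon:
  fixes S :: "('x::finite, 'k::field) mpoly set"
  assumes "ideal S polyring"
  shows "ideal {b. \<forall>x\<in>T. b * x \<in> S} polyring"
  by (rule ideal_polyringI)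
    (simp_all add: distrib_right mult.assoc ideal_zero[OF assms] ideal_add[OF assms] ideal_mult[OF assms])

text \<open>Everything about the module \<open>I / J\<close> is translated into statements about ideals of the polynomial ring.\<close>

locale nested_ideals =
  fixes I J :: "('x::finite, 'k::field) mpoly set"
  assumes I: "ideal I polyring" and J: "ideal J polyring" and JI: "J \<subseteq> I"
begin

abbreviation "M \<equiv> subquotient polyring I J"

interpretation R: cring "polyring :: ('x, 'k) mpoly ring" by (rule cring_polyring)

interpretation M: Module.module "polyring :: ('x, 'k) mpoly ring" M
  by (rule subquotient_is_module[OF cring_polyring I J JI])

lemma subquotient_carrier: "carrier M = coset J ` I"
  by (auto simp: subquotient_def quotient_module_def A_RCOSETS_def' ideal_module_def a_r_coset_def')

lemma subquotient_add: "coset J x \<oplus>\<^bsub>M\<^esub> coset J y = coset J (x + y)"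
proof -
  have "set_add (ideal_module polyring I) = set_add (polyring :: ('x, 'k) mpoly ring)"
    by (auto simp: fun_eq_iff set_add_defs ideal_module_def)
  moreover have "coset J x <+>\<^bsub>polyring\<^esub> coset J y = coset J (x \<oplus>\<^bsub>polyring\<^esub> y)"
    by (rule abelian_subgroup.a_rcos_sum[OF abelian_subgroupI3[OF ideal.axioms(1)[OF J] R.abelian_group_axioms]])
      auto
  ultimately show ?thesis by (simp add: subquotient_def quotient_module_def)
qed

lemma subquotient_smult: "a \<odot>\<^bsub>M\<^esub> coset J x = coset J (a * x)"
proof -
  have "coset J (a * y) = coset J (a * x)" if "y \<in> coset J x" for y
    using that ideal_mult[OF J, of "y - x" a] by (simp add: coset_eq_iff[OF J] mem_coset_iff algebra_simps)
  moreover have "x \<in> coset J x" using ideal_zero[OF J] by (simp add: mem_coset_iff)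
  moreover have "a_r_coset (ideal_module polyring I) = a_r_coset (polyring :: ('x, 'k) mpoly ring)"
    by (auto simp: fun_eq_iff a_r_coset_def' ideal_module_def)
  hence "a \<odot>\<^bsub>M\<^esub> coset J x = (\<Union>y\<in>coset J x. coset J (a * y))"
    by (simp add: subquotient_def quotient_module_def) (simp add: ideal_module_def)
  ultimately show ?thesis by blast
qed

lemma subquotient_zero: "\<zero>\<^bsub>M\<^esub> = coset J 0"
  unfolding coset_zero by (simp add: subquotient_def quotient_module_def)

lemma subquotient_annihilator: "annihilator polyring M = {a. \<forall>x\<in>I. a * x \<in> J}"
  by (simp add: annihilator_def subquotient_carrier subquotient_smult subquotient_zero coset_eq_iff[OF J])

lemma subquotient_finsum:
  assumes "\<And>k. k < n \<Longrightarrow> v k \<in> I"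
  shows "finsum M (\<lambda>k. coset J (v k)) {..<n::nat} = coset J (\<Sum>k<n. v k)"
  using assms
proof (induction n)
  case 0
  show ?case by (simp add: subquotient_zero)
next
  case (Suc n)
  have "finsum M (\<lambda>k. coset J (v k)) (insert n {..<n}) = coset J (v n) \<oplus>\<^bsub>M\<^esub> finsum M (\<lambda>k. coset J (v k)) {..<n}"
    by (rule M.finsum_insert) (use Suc.prems in \<open>auto simp: subquotient_carrier\<close>)
  thus ?case using Suc by (simp add: lessThan_Suc subquotient_add)
qed

text \<open>The preimage in the ring of the submodule \<open>(f\<^sub>0, \<dots>, f\<^bsub>i-1\<^esub>) M\<close>, that is the ideal
  \<open>J + f\<^sub>0 I + \<dots> + f\<^bsub>i-1\<^esub> I\<close>.\<close>

definition seq_ideal :: "('x, 'k) mpoly list \<Rightarrow> nat \<Rightarrow> ('x, 'k) mpoly set" where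
  "seq_ideal fs i = {x. \<exists>v. (\<forall>k. v k \<in> I) \<and> x - (\<Sum>k<i. fs ! k * v k) \<in> J}"

lemma seq_idealI: "(\<And>k. v k \<in> I) \<Longrightarrow> x - (\<Sum>k<i. fs ! k * v k) \<in> J \<Longrightarrow> x \<in> seq_ideal fs i"
  by (auto simp: seq_ideal_def)

lemma coset_in_seq_submodule_iff:
  assumes i: "i \<le> length fs"
  shows "coset J x \<in> seq_submodule M (take i fs) \<longleftrightarrow> x \<in> seq_ideal fs i"
proof -
  have fs: "finsum M (\<lambda>j. (take i fs ! j) \<odot>\<^bsub>M\<^esub> w j) {..<length (take i fs)} = coset J (\<Sum>k<i. fs ! k * v k)"
    if "\<And>k. k < i \<Longrightarrow> w k = coset J (v k)" "\<And>k. k < i \<Longrightarrow> v k \<in> I" for w v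
  proof -
    have "finsum M (\<lambda>j. (take i fs ! j) \<odot>\<^bsub>M\<^esub> w j) {..<i} = finsum M (\<lambda>k. coset J (fs ! k * v k)) {..<i}"
      by (rule M.finsum_cong')
        (use that ideal_mult[OF I] in \<open>auto simp: subquotient_smult subquotient_carrier\<close>)
    also have "\<dots> = coset J (\<Sum>k<i. fs ! k * v k)"
      by (rule subquotient_finsum) (use that ideal_mult[OF I] in auto)
    finally show ?thesis using i by (simp add: min_absorb2)
  qed
  show ?thesis
  proof
    assume "coset J x \<in> seq_submodule M (take i fs)"
    then obtain w where w: "w \<in> {..<i} \<rightarrow> carrier M"
      "coset J x = finsum M (\<lambda>j. (take i fs ! j) \<odot>\<^bsub>M\<^esub> w j) {..<length (take i fs)}"
      using i by (auto simp: seq_submodule_def min_absorb2)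
    have "\<forall>k. \<exists>y. y \<in> I \<and> (k < i \<longrightarrow> w k = coset J y)"
      using w(1) ideal_zero[OF I] by (fastforce simp: subquotient_carrier)
    then obtain v where v: "\<And>k. v k \<in> I" "\<And>k. k < i \<Longrightarrow> w k = coset J (v k)" by metis
    have "coset J x = coset J (\<Sum>k<i. fs ! k * v k)" unfolding w(2) using fs[of w v] v by blast
    thus "x \<in> seq_ideal fs i" unfolding seq_ideal_def coset_eq_iff[OF J] using v(1) by blast
  next
    assume "x \<in> seq_ideal fs i"
    then obtain v where v: "\<And>k. v k \<in> I" "coset J x = coset J (\<Sum>k<i. fs ! k * v k)"
      unfolding seq_ideal_def coset_eq_iff[OF J] by blast
    hence "coset J x = finsum M (\<lambda>j. (take i fs ! j) \<odot>\<^bsub>M\<^esub> coset J (v j)) {..<length (take i fs)}"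
      using fs[of "\<lambda>k. coset J (v k)" v] by simp
    moreover have "(\<lambda>k. coset J (v k)) \<in> {..<length (take i fs)} \<rightarrow> carrier M"
      using v(1) by (auto simp: subquotient_carrier)
    ultimately show "coset J x \<in> seq_submodule M (take i fs)"
      unfolding seq_submodule_def mem_Collect_eq by (intro exI[of _ "\<lambda>k. coset J (v k)"] conjI)
  qed
qed

lemma seq_submodule_subset: "seq_submodule M fs \<subseteq> carrier M"
  by (auto simp: seq_submodule_def intro!: M.finsum_closed M.smult_closed)

lemma regular_sequence_iff:
  "regular_sequence polyring M fs \<longleftrightarrow>
     (\<forall>i<length fs. \<forall>b\<in>I. fs ! i * b \<in> seq_ideal fs i \<longrightarrow> b \<in> seq_ideal fs i) \<and>
     \<not> I \<subseteq> seq_ideal fs (length fs)"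
proof -
  have mem: "coset J x \<in> seq_submodule M fs \<longleftrightarrow> x \<in> seq_ideal fs (length fs)" for x
    using coset_in_seq_submodule_iff[of "length fs" fs x] by simp
  have "seq_submodule M fs = carrier M \<longleftrightarrow> I \<subseteq> seq_ideal fs (length fs)"
  proof
    assume "seq_submodule M fs = carrier M"
    thus "I \<subseteq> seq_ideal fs (length fs)" using mem by (simp add: subquotient_carrier) blast
  next
    assume "I \<subseteq> seq_ideal fs (length fs)"
    thus "seq_submodule M fs = carrier M"
      using seq_submodule_subset[of fs] mem by (auto simp: subquotient_carrier)
  qed
  thus ?thesis
    unfolding regular_sequence_def
    by (auto simp: subquotient_carrier subquotient_smult coset_in_seq_submodule_iff)
qed

lemma seq_ideal_mono: "seq_ideal fs i \<subseteq> seq_ideal fs (Suc i)"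
proof
  fix x assume "x \<in> seq_ideal fs i"
  then obtain v where v: "\<And>k. v k \<in> I" "x - (\<Sum>k<i. fs ! k * v k) \<in> J" by (auto simp: seq_ideal_def)
  have "(\<Sum>k<i. fs ! k * (v(i := 0)) k) = (\<Sum>k<i. fs ! k * v k)" by (intro sum.cong) auto
  thus "x \<in> seq_ideal fs (Suc i)" using v ideal_zero[OF I]
    by (auto simp: seq_ideal_def intro!: exI[of _ "v(i := 0)"])
qed

lemma seq_ideal_ideal: "ideal (seq_ideal fs i) polyring"
proof (rule ideal_polyringI)
  show "0 \<in> seq_ideal fs i"
    using ideal_zero[OF I] ideal_zero[OF J] by (auto simp: seq_ideal_def intro!: exI[of _ "\<lambda>_. 0"])
next
  fix x y assume "x \<in> seq_ideal fs i" "y \<in> seq_ideal fs i"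
  then obtain v w where v: "\<And>k. v k \<in> I" "x - (\<Sum>k<i. fs ! k * v k) \<in> J"
    and w: "\<And>k. w k \<in> I" "y - (\<Sum>k<i. fs ! k * w k) \<in> J" by (auto simp: seq_ideal_def)
  have "x + y - (\<Sum>k<i. fs ! k * (v k + w k)) =
      (x - (\<Sum>k<i. fs ! k * v k)) + (y - (\<Sum>k<i. fs ! k * w k))"
    by (simp add: algebra_simps sum.distrib)
  hence "x + y - (\<Sum>k<i. fs ! k * (v k + w k)) \<in> J" using ideal_add[OF J v(2) w(2)] by (simp only:)
  moreover have "v k + w k \<in> I" for k using ideal_add[OF I v(1) w(1)] .
  ultimately show "x + y \<in> seq_ideal fs i" by (intro seq_idealI[of "\<lambda>k. v k + w k"])
next
  fix a x assume "x \<in> seq_ideal fs i"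
  then obtain v where v: "\<And>k. v k \<in> I" "x - (\<Sum>k<i. fs ! k * v k) \<in> J" by (auto simp: seq_ideal_def)
  have "a * x - (\<Sum>k<i. fs ! k * (a * v k)) = a * (x - (\<Sum>k<i. fs ! k * v k))"
    by (simp add: algebra_simps sum_distrib_left)
  hence "a * x - (\<Sum>k<i. fs ! k * (a * v k)) \<in> J" using ideal_mult[OF J v(2)] by (simp only:)
  moreover have "a * v k \<in> I" for k using ideal_mult[OF I v(1)] .
  ultimately show "a * x \<in> seq_ideal fs i" by (intro seq_idealI[of "\<lambda>k. a * v k"])
qed

lemma seq_ideal_0 [simp]: "seq_ideal fs 0 = J"
  using ideal_zero[OF I] by (auto simp: seq_ideal_def)

lemma seq_ideal_1: "x \<in> seq_ideal fs (Suc 0) \<longleftrightarrow> (\<exists>c\<in>I. x - fs ! 0 * c \<in> J)"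
proof
  assume "\<exists>c\<in>I. x - fs ! 0 * c \<in> J"
  then obtain c where "c \<in> I" "x - fs ! 0 * c \<in> J" by blast
  thus "x \<in> seq_ideal fs (Suc 0)" by (intro seq_idealI[of "\<lambda>_. c"]) auto
qed (auto simp: seq_ideal_def)

text \<open>The ideals of the chain are the annihilators of the successive quotients \<open>M / (f\<^sub>0, \<dots>, f\<^bsub>i-1\<^esub>) M\<close>.\<close>

lemma regular_sequence_imp_chain:
  assumes "regular_sequence polyring M fs"
  shows "regular_chain {b. \<forall>x\<in>I. b * x \<in> J} fs"
proof -
  let ?N = "\<lambda>i. {b. \<forall>x\<in>I. b * x \<in> seq_ideal fs i}"
  have id: "ideal (?N i) polyring" for i
    by (rule ideal_colon[OF seq_ideal_ideal])
  have "regular_chain (?N i) (drop i fs)" if "i \<le> length fs" for i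
    using that
  proof (induction rule: inc_induct)
    case base
    have "1 \<notin> ?N (length fs)" using assms by (auto simp: regular_sequence_iff)
    thus ?case using id by (auto intro: regular_chain.Nil)
  next
    case (step i)
    have "regular_chain (?N i) (fs ! i # drop (Suc i) fs)"
    proof (rule regular_chain.Cons[OF id _ _ _ step.IH])
      fix b assume b: "fs ! i * b \<in> ?N i"
      show "b \<in> ?N i"
      proof (clarify)
        fix x assume x: "x \<in> I"
        hence "fs ! i * (b * x) \<in> seq_ideal fs i" using b by (simp add: mult.assoc)
        thus "b * x \<in> seq_ideal fs i" using assms step.hyps ideal_mult[OF I x]
          by (auto simp: regular_sequence_iff)
      qed
    next
      show "?N i \<subseteq> ?N (Suc i)" using seq_ideal_mono by blast
      have "fs ! i * x \<in> seq_ideal fs (Suc i)" if x: "x \<in> I" for x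
      proof -
        let ?v = "\<lambda>k. if k = i then x else 0"
        have "(\<Sum>k<Suc i. fs ! k * ?v k) = fs ! i * x" by simp
        hence "fs ! i * x - (\<Sum>k<Suc i. fs ! k * ?v k) \<in> J" using ideal_zero[OF J] by simp
        moreover have "?v k \<in> I" for k using x ideal_zero[OF I] by simp
        ultimately show ?thesis by (rule seq_idealI[of ?v, rotated])
      qed
      thus "fs ! i \<in> ?N (Suc i)" by blast
    qed
    thus ?case using step.hyps by (simp add: Cons_nth_drop_Suc)
  qed
  from this[of 0] show ?thesis by simp
qed

lemma depth_subquotient_le:
  assumes "term_ideal {t. d < card (supp t)} \<subseteq> {b. \<forall>x\<in>I. b * x \<in> J}"
  shows "depth polyring \<mm> M \<le> enat d"
  unfolding depth_def
  by (rule Sup_least) (use regular_chain_length_le[OF regular_sequence_imp_chain assms] in auto)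

end

section \<open>Krull dimension, depth and Cohen-Macaulayness\<close>

lemma prime_quotient:
  fixes A :: "('x::finite, 'k::field) mpoly set"
  assumes A: "ideal A polyring" and Q: "primeideal Q polyring" and AQ: "A \<subseteq> Q"
  shows "primeideal (coset A ` Q) (polyring Quot A)"
proof -
  interpret R: cring "polyring :: ('x, 'k) mpoly ring" by (rule cring_polyring)
  interpret Q: primeideal Q "polyring :: ('x, 'k) mpoly ring" by (rule Q)
  have mem: "coset A x \<in> coset A ` Q \<longleftrightarrow> x \<in> Q" for x
    using ideal_diff_cancel[OF Q.is_ideal] AQ by (auto simp: coset_eq_iff[OF A])
  have car: "carrier (polyring Quot A) = range (coset A)"
    by (auto simp: FactRing_def A_RCOSETS_def')
  show ?thesis
  proof (rule primeidealI)
    show "ideal (coset A ` Q) (polyring Quot A)"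
      using R.ring_ideal_imp_quot_ideal[OF A Q.is_ideal] .
    show "cring (polyring Quot A)" by (rule ideal.quotient_is_cring[OF A cring_polyring])
    show "carrier (polyring Quot A) \<noteq> coset A ` Q"
      using mem[of 1] Q.I_notcarr Q.one_imp_carrier by (auto simp: car)
  next
    fix C D assume "C \<in> carrier (polyring Quot A)" "D \<in> carrier (polyring Quot A)"
      and CD: "monoid.mult (polyring Quot A) C D \<in> coset A ` Q"
    then obtain x y where xy: "C = coset A x" "D = coset A y" by (auto simp: car)
    hence "coset A (x * y) \<in> coset A ` Q" using CD ideal.rcoset_mult_add[OF A, of x y] by (simp add: FactRing_def)
    hence "x * y \<in> Q" by (simp add: mem)
    thus "C \<in> coset A ` Q \<or> D \<in> coset A ` Q" using Q.I_prime[of x y] by (auto simp: xy)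
  qed
qed

text \<open>Pick an element of each prime that is missing from the preceding one: being outside a prime makes it
  a nonzerodivisor modulo that prime, so a chain of primes is a regular chain.\<close>

lemma krull_dim_quotient_le:
  fixes A :: "('x::finite, 'k::field) mpoly set"
  assumes A: "ideal A polyring" and d: "term_ideal {t. d < card (supp t)} \<subseteq> A"
  shows "krull_dim (polyring Quot A) \<le> enat d"
  unfolding krull_dim_def
proof (rule Sup_least, clarify)
  fix l and P :: "nat \<Rightarrow> ('x, 'k) mpoly set set"
  assume P: "\<forall>i\<le>l. primeideal (P i) (polyring Quot A)" and strict: "\<forall>i<l. P i \<subset> P (Suc i)"
  let ?N = "\<lambda>i. {r. coset A r \<in> P i}"
  have N: "primeideal (?N i) polyring" if "i \<le> l" for i
    using ring_hom_ring.primeideal_vimage[OF ideal.rcos_ring_hom_ring[OF A] cring_polyring, of "P i"] P that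
    by simp
  have car: "carrier (polyring Quot A) = range (coset A)"
    by (auto simp: FactRing_def A_RCOSETS_def')
  have "\<exists>as. length as = l - i \<and> regular_chain (?N i) as" if "i \<le> l" for i
    using that
  proof (induction rule: inc_induct)
    case base
    interpret primeideal "?N l" "polyring :: ('x, 'k) mpoly ring" using N by simp
    have "1 \<notin> ?N l" using I_notcarr one_imp_carrier by auto
    thus ?case using regular_chain.Nil[OF is_ideal] by (intro exI[of _ "[]"]) auto
  next
    case (step i)
    interpret primeideal "?N i" "polyring :: ('x, 'k) mpoly ring" using N step by simp
    obtain as where as: "length as = l - Suc i" "regular_chain (?N (Suc i)) as" using step.IH by blast
    obtain C where C: "C \<in> P (Suc i)" "C \<notin> P i" using strict step by blast
    interpret P': primeideal "P (Suc i)" "polyring Quot A" using P step by simp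
    have "C \<in> carrier (polyring Quot A)" using C P'.Icarr by blast
    then obtain a where a: "C = coset A a" by (auto simp: car)
    have "b \<in> ?N i" if "a * b \<in> ?N i" for b
      using I_prime[of a b] that C a by auto
    moreover have "?N i \<subseteq> ?N (Suc i)" using strict step by blast
    moreover have "a \<in> ?N (Suc i)" using C a by simp
    ultimately have "regular_chain (?N i) (a # as)"
      using regular_chain.Cons[OF is_ideal _ _ _ as(2), of a] by blast
    thus ?case using as(1) step by (intro exI[of _ "a # as"]) auto
  qed
  from this[of 0] obtain as where as: "length as = l" "regular_chain (?N 0) as" by auto
  interpret P0: primeideal "P 0" "polyring Quot A" using P by simp
  have "coset A r \<in> P 0" if "r \<in> A" for r
    using additive_subgroup.zero_closed[OF ideal.axioms(1)[OF P0.is_ideal]] that coset_eq_iff[OF A, of r 0] by (simp add: FactRing_def coset_zero)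
  hence "term_ideal {t. d < card (supp t)} \<subseteq> ?N 0" using d by blast
  from regular_chain_length_le[OF as(2) this] as(1) show "enat l \<le> enat d" by simp
qed

text \<open>Deleting the elements of \<open>F\<close> one by one produces a chain of primes from \<open>P\<^sub>F\<close> up to the graded
  maximal ideal.\<close>

lemma krull_dim_quotient_ge:
  fixes A :: "('x::finite, 'k::field) mpoly set"
  assumes A: "ideal A polyring" and F: "A \<subseteq> face_prime F"
  shows "enat (card F) \<le> krull_dim (polyring Quot A)"
proof -
  obtain xs where xs: "set xs = F" "distinct xs" using finite_distinct_list[of F] by auto
  have len: "length xs = card F" using distinct_card[OF xs(2)] xs(1) by simp
  let ?Q = "\<lambda>i. face_prime (set (drop i xs)) :: ('x, 'k) mpoly set"
  have AQ: "A \<subseteq> ?Q i" for i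
    using F face_ideal_mono[of "Pow (set (drop i xs))" "Pow F"] set_drop_subset[of i xs] xs by blast
  have "primeideal (coset A ` ?Q i) (polyring Quot A)" for i
    by (rule prime_quotient[OF A face_prime_primeideal AQ])
  moreover have "coset A ` ?Q i \<subset> coset A ` ?Q (Suc i)" if i: "i < card F" for i
  proof
    have "set (drop (Suc i) xs) \<subseteq> set (drop i xs)" by (rule set_drop_subset_set_drop) simp
    thus "coset A ` ?Q i \<subseteq> coset A ` ?Q (Suc i)" by (intro image_mono face_ideal_mono) auto
    have "drop i xs = xs ! i # drop (Suc i) xs" using i len by (simp add: Cons_nth_drop_Suc)
    moreover have "distinct (drop i xs)" using xs(2) by simp
    ultimately have "xs ! i \<in> set (drop i xs)" "xs ! i \<notin> set (drop (Suc i) xs)" by simp_all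
    hence v: "variable (xs ! i) \<in> ?Q (Suc i)" "variable (xs ! i) \<notin> ?Q i" by auto
    have "coset A (variable (xs ! i)) \<notin> coset A ` ?Q i"
    proof
      assume "coset A (variable (xs ! i)) \<in> coset A ` ?Q i"
      then obtain x where x: "x \<in> ?Q i" "variable (xs ! i) - x \<in> A" by (auto simp: coset_eq_iff[OF A])
      hence "variable (xs ! i) \<in> ?Q i" using AQ ideal_diff_cancel[OF face_prime_ideal, of _ x] by blast
      with v(2) show False ..
    qed
    with v(1) show "coset A ` ?Q i \<noteq> coset A ` ?Q (Suc i)" by blast
  qed
  ultimately have "\<exists>P. (\<forall>i\<le>card F. primeideal (P i) (polyring Quot A)) \<and> (\<forall>i<card F. P i \<subset> P (Suc i))"
    by (intro exI[of _ "\<lambda>i. coset A ` ?Q i"]) simp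
  thus ?thesis unfolding krull_dim_def by (intro Sup_upper) blast
qed

lemma monomial_degree_add: "monomial_degree (s + t) = monomial_degree s + monomial_degree t"
  by (simp add: monomial_degree_def lookup_add sum.distrib)

lemma monomial_degree_pos: "s \<noteq> 0 \<Longrightarrow> 0 < monomial_degree s"
  by (auto simp: monomial_degree_def poly_mapping_eq_iff fun_eq_iff sum_pos2 intro!: Nat.gr0I)

lemma ideal_UNIV: "ideal (UNIV :: ('x::finite, 'k::field) mpoly set) polyring"
  by (rule ideal_polyringI) auto

context nested_ideals
begin

lemma module_dim_le:
  assumes "term_ideal {t. d < card (supp t)} \<subseteq> {b. \<forall>x\<in>I. b * x \<in> J}"
  shows "module_dim polyring M \<le> enat d"
  unfolding module_dim_def subquotient_annihilator
  by (rule krull_dim_quotient_le[OF ideal_colon[OF J] assms])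

lemma module_dim_ge:
  assumes "{b. \<forall>x\<in>I. b * x \<in> J} \<subseteq> face_prime F"
  shows "enat (card F) \<le> module_dim polyring M"
  unfolding module_dim_def subquotient_annihilator
  by (rule krull_dim_quotient_ge[OF ideal_colon[OF J] assms])

text \<open>The graded Nakayama lemma for monomial ideals: a monomial of least degree in \<open>I\<close> but not in \<open>J\<close> is
  not a combination of products of elements of \<open>I\<close> with polynomials without constant term.\<close>

lemma not_subset_seq_ideal:
  assumes "monomial_ideal I" "monomial_ideal J" "J \<noteq> I" "set fs \<subseteq> face_prime {}" "i \<le> length fs"
  shows "\<not> I \<subseteq> seq_ideal fs i"
proof
  assume sub: "I \<subseteq> seq_ideal fs i"
  obtain U V where U: "upset U" "I = term_ideal U" and V: "upset V" "J = term_ideal V"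
    using assms(1,2) by (auto simp: monomial_ideal_iff)
  have "V \<subset> U" using JI assms(3) by (auto simp: U V)
  hence ex: "\<exists>t. t \<in> U - V" by blast
  define t where "t = arg_min monomial_degree (\<lambda>t. t \<in> U - V)"
  have t: "t \<in> U" "t \<notin> V" and min: "\<And>s. s \<in> U - V \<Longrightarrow> monomial_degree t \<le> monomial_degree s"
    using arg_min_nat_lemma[of "\<lambda>t. t \<in> U - V" _ monomial_degree] ex unfolding t_def by blast+
  have "monomial t \<in> seq_ideal fs i" using sub t(1) by (auto simp: U)
  then obtain v where v: "\<And>k. v k \<in> I" "monomial t - (\<Sum>k<i. fs ! k * v k) \<in> J"
    by (auto simp: seq_ideal_def)
  have "t \<notin> terms (monomial t - (\<Sum>k<i. fs ! k * v k))" using v(2) t(2) by (auto simp: V term_ideal_def)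
  hence "(\<Sum>k<i. Poly_Mapping.lookup (fs ! k * v k) t) = 1"
    by (simp add: in_keys_iff lookup_minus lookup_sum monomial_def)
  hence "\<exists>k<i. t \<in> terms (fs ! k * v k)"
    by (metis (no_types, lifting) in_keys_iff lessThan_iff sum.neutral zero_neq_one)
  then obtain k where k: "k < i" "t \<in> terms (fs ! k * v k)" by blast
  then obtain r s where rs: "r \<in> terms (fs ! k)" "s \<in> terms (v k)" "t = r + s"
    by (auto elim: terms_times_obtain)
  have "fs ! k \<in> face_prime {}" using assms(4,5) k(1) by auto
  hence "r \<noteq> 0" using rs(1) by (auto simp: face_ideal_iff)
  hence "monomial_degree s < monomial_degree t"
    using monomial_degree_pos[of r] by (simp add: rs monomial_degree_add)
  moreover have "s \<in> U" using v(1)[of k] rs(2) by (auto simp: U term_ideal_def)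
  moreover have "s \<notin> V" using t(2) V(1) unfolding rs(3) upset_def by (metis add.commute)
  ultimately show False using min[of s] by simp
qed

lemma regular_sequenceI:
  assumes "monomial_ideal I" "monomial_ideal J" "J \<noteq> I" "set fs \<subseteq> face_prime {}"
    and "\<And>i b. i < length fs \<Longrightarrow> b \<in> I \<Longrightarrow> fs ! i * b \<in> seq_ideal fs i \<Longrightarrow> b \<in> seq_ideal fs i"
  shows "regular_sequence polyring M fs"
  unfolding regular_sequence_iff using assms(5) not_subset_seq_ideal[OF assms(1-4)] by blast

text \<open>If all monomials with more than \<open>card F\<close> variables annihilate the module and some prime \<open>P\<^sub>F\<close> contains
  its annihilator, then its dimension is \<open>card F\<close>, which also bounds its depth; so a regular sequence
  of that length suffices.\<close>

theorem cohen_macaulayI: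
  assumes "term_ideal {t. card F < card (supp t)} \<subseteq> {b. \<forall>x\<in>I. b * x \<in> J}"
    and "{b. \<forall>x\<in>I. b * x \<in> J} \<subseteq> face_prime F"
    and "set fs \<subseteq> face_prime {}" "length fs = card F" "regular_sequence polyring M fs"
  shows "module_dim polyring M = enat (card F)" and "cohen_macaulay M"
proof -
  show dim: "module_dim polyring M = enat (card F)"
    using module_dim_le[OF assms(1)] module_dim_ge[OF assms(2)] by (rule antisym)
  have "enat (card F) \<le> depth polyring (face_prime {}) M"
    unfolding depth_def by (rule Sup_upper) (use assms(3-5) in \<open>auto intro!: exI[of _ fs]\<close>)
  hence "depth polyring (face_prime {}) M = enat (card F)"
    using depth_subquotient_le[OF assms(1)] by (metis antisym)
  thus "cohen_macaulay M" unfolding cohen_macaulay_def maximal_ideal_eq dim .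
qed

text \<open>An isomorphism \<open>I / J \<cong> R / P\<close> amounts to a generator with annihilator \<open>P\<close>: the element \<open>u\<close> that
  corresponds to \<open>1\<close>.\<close>

lemma module_isomorphic_cyclic_iff:
  fixes P :: "('x, 'k) mpoly set"
  assumes P: "ideal P polyring"
  shows "module_isomorphic polyring M (subquotient polyring (carrier polyring) P) \<longleftrightarrow>
    (\<exists>u\<in>I. (\<forall>x\<in>I. \<exists>r. x - r * u \<in> J) \<and> (\<forall>r. r * u \<in> J \<longleftrightarrow> r \<in> P))"
proof -
  interpret N: nested_ideals UNIV P
    by (rule nested_ideals.intro[OF ideal_UNIV P subset_UNIV])
  let ?N = "subquotient polyring (UNIV :: ('x, 'k) mpoly set) P"
  show ?thesis
    unfolding carrier_polyring
  proof
    assume "module_isomorphic polyring M ?N"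
    then obtain \<phi> where hom: "\<phi> \<in> iso (add_monoid M) (add_monoid ?N)"
      and lin: "\<And>a m. m \<in> carrier M \<Longrightarrow> \<phi> (a \<odot>\<^bsub>M\<^esub> m) = a \<odot>\<^bsub>?N\<^esub> \<phi> m"
      unfolding module_isomorphic_def by auto
    have bij: "bij_betw \<phi> (carrier M) (carrier ?N)" using hom by (simp add: iso_def)
    have "coset P 1 \<in> \<phi> ` carrier M"
      unfolding bij_betw_imp_surj_on[OF bij] by (simp add: N.subquotient_carrier)
    then obtain m0 where m0: "m0 \<in> carrier M" "\<phi> m0 = coset P 1" by (auto elim: imageE)
    then obtain u where u: "u \<in> I" "m0 = coset J u" by (auto simp: subquotient_carrier)
    have \<phi>: "\<phi> (coset J (r * u)) = coset P r" for r
      using lin[OF m0(1), of r] by (simp add: u(2) subquotient_smult m0(2)[unfolded u(2)] N.subquotient_smult)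
    have inj: "x - y \<in> J" if "x \<in> I" "y \<in> I" "\<phi> (coset J x) = \<phi> (coset J y)" for x y
      using bij_betw_imp_inj_on[OF bij] that by (auto simp: inj_on_def subquotient_carrier coset_eq_iff[OF J])
    have "\<exists>r. x - r * u \<in> J" if x: "x \<in> I" for x
    proof -
      have "\<phi> (coset J x) \<in> carrier ?N"
        using bij_betw_apply[OF bij] x by (simp add: subquotient_carrier)
      then obtain r where "\<phi> (coset J x) = coset P r" by (auto simp: N.subquotient_carrier)
      hence "x - r * u \<in> J" using \<phi>[of r] x ideal_mult[OF I u(1)] by (intro inj) auto
      thus ?thesis ..
    qed
    moreover have "r * u \<in> J \<longleftrightarrow> r \<in> P" for r
    proof
      assume "r * u \<in> J"
      hence "coset J (r * u) = coset J (0 * u)" by (simp add: coset_eq_iff[OF J])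
      hence "coset P r = coset P 0" using \<phi>[of r] \<phi>[of 0] by (simp only:)
      thus "r \<in> P" by (simp add: coset_eq_iff[OF P])
    next
      assume "r \<in> P"
      hence "coset P r = coset P 0" by (simp add: coset_eq_iff[OF P])
      hence "r * u - 0 * u \<in> J"
        using \<phi>[of r] \<phi>[of 0] ideal_mult[OF I u(1)] ideal_zero[OF I] by (intro inj) auto
      thus "r * u \<in> J" by simp
    qed
    ultimately show "\<exists>u\<in>I. (\<forall>x\<in>I. \<exists>r. x - r * u \<in> J) \<and> (\<forall>r. r * u \<in> J \<longleftrightarrow> r \<in> P)"
      using u(1) by blast
  next
    assume "\<exists>u\<in>I. (\<forall>x\<in>I. \<exists>r. x - r * u \<in> J) \<and> (\<forall>r. r * u \<in> J \<longleftrightarrow> r \<in> P)"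
    then obtain u where u: "u \<in> I" "\<And>x. x \<in> I \<Longrightarrow> \<exists>r. x - r * u \<in> J"
      "\<And>r. r * u \<in> J \<longleftrightarrow> r \<in> P" by blast
    \<comment> \<open>the inverse of \<open>r \<mapsto> r u\<close>: its value at a coset of \<open>J\<close> is a coset of \<open>P\<close>\<close>
    define \<phi> where "\<phi> C = {r. r * u \<in> C}" for C
    have rep: "\<exists>r. coset J x = coset J (r * u)" if "x \<in> I" for x
      using u(2)[OF that] by (simp add: coset_eq_iff[OF J])
    have \<phi>: "\<phi> (coset J (r * u)) = coset P r" for r
      unfolding \<phi>_def by (auto simp: mem_coset_iff u(3) simp flip: left_diff_distrib)
    have car: "carrier M = {coset J (r * u) |r. True}"
      using rep ideal_mult[OF I u(1)] by (auto simp: subquotient_carrier)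
    have inj: "coset J (r * u) = coset J (s * u) \<longleftrightarrow> coset P r = coset P s" for r s
      by (simp add: coset_eq_iff[OF J] coset_eq_iff[OF P] u(3) flip: left_diff_distrib)
    have "bij_betw \<phi> (carrier M) (carrier ?N)"
      unfolding bij_betw_def
    proof
      show "inj_on \<phi> (carrier M)"
      proof (rule inj_onI)
        fix C D assume "C \<in> carrier M" "D \<in> carrier M" and eq: "\<phi> C = \<phi> D"
        then obtain r s where "C = coset J (r * u)" "D = coset J (s * u)" by (auto simp: car)
        thus "C = D" using eq by (simp add: \<phi> inj)
      qed
      show "\<phi> ` carrier M = carrier ?N" unfolding car N.subquotient_carrier using \<phi> by force
    qed
    moreover have "\<phi> (C \<oplus>\<^bsub>M\<^esub> D) = \<phi> C \<oplus>\<^bsub>?N\<^esub> \<phi> D"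
      if C: "C \<in> carrier M" and D: "D \<in> carrier M" for C D
    proof -
      obtain r s where "C = coset J (r * u)" "D = coset J (s * u)" using C D by (auto simp: car)
      thus ?thesis by (simp add: \<phi> subquotient_add N.subquotient_add flip: distrib_right)
    qed
    moreover have "\<phi> (a \<odot>\<^bsub>M\<^esub> C) = a \<odot>\<^bsub>?N\<^esub> \<phi> C" if C: "C \<in> carrier M" for a C
    proof -
      obtain r where "C = coset J (r * u)" using C by (auto simp: car)
      thus ?thesis by (simp add: \<phi> subquotient_smult N.subquotient_smult flip: mult.assoc)
    qed
    ultimately show "module_isomorphic polyring M ?N"
      unfolding module_isomorphic_def iso_def hom_def
      by (intro bexI[of _ \<phi>]) (auto dest: bij_betw_apply)
  qed
qed

end

section \<open>Shellings and prime filtrations\<close>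

lemma exists_term_split:
  fixes p :: "('x::finite, 'k::field) mpoly"
  shows "\<exists>q r. p = q + r \<and> terms q = terms p \<inter> S \<and> terms r = terms p - S"
proof -
  define part where "part T = (\<Sum>t\<in>T. Poly_Mapping.single t (Poly_Mapping.lookup p t))" for T
  have l: "Poly_Mapping.lookup (part T) t = (if t \<in> T then Poly_Mapping.lookup p t else 0)" if "finite T" for T t
    using that by (simp add: part_def lookup_sum lookup_single when_def)
  have "p = part (terms p \<inter> S) + part (terms p - S)"
    by (rule poly_mapping_eqI) (simp add: lookup_add l, simp add: in_keys_iff)
  moreover have "terms (part (terms p \<inter> S)) = terms p \<inter> S" "terms (part (terms p - S)) = terms p - S"
    by (auto simp: in_keys_iff l split: if_splits)
  ultimately show ?thesis by blast
qed

lemma terms_mult_monomial: "terms (r * monomial g) = (\<lambda>s. s + g) ` terms r"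
proof -
  have l: "Poly_Mapping.lookup (r * monomial g) (s + g) = Poly_Mapping.lookup r s" for s
    by (subst lookup_mult_extremal) (auto simp: monomial_def)
  show ?thesis
  proof (intro equalityI subsetI)
    fix t assume "t \<in> terms (r * monomial g)"
    thus "t \<in> (\<lambda>s. s + g) ` terms r" by (auto elim!: terms_times_obtain)
  qed (auto simp: in_keys_iff l)
qed

lemma monomial_mult: "monomial s * monomial t = monomial (s + t)"
  by (simp add: monomial_def mult_single)

lemma monomial_factor:
  fixes q :: "('x::finite, 'k::field) mpoly"
  assumes "\<And>t. t \<in> terms q \<Longrightarrow> G \<subseteq> supp t"
  shows "\<exists>r. q = r * squarefree_monomial G"
proof -
  have "\<forall>t\<in>terms q. \<exists>s. t = s + face_term G"
    using assms face_term_decompose by (metis add.commute)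
  then obtain \<sigma> where \<sigma>: "\<And>t. t \<in> terms q \<Longrightarrow> t = \<sigma> t + face_term G" by metis
  have "q = (\<Sum>t\<in>terms q. const (Poly_Mapping.lookup q t) * monomial t)" by (rule poly_eq_sum_terms)
  also have "\<dots> = (\<Sum>t\<in>terms q. const (Poly_Mapping.lookup q t) * monomial (\<sigma> t) * squarefree_monomial G)"
    by (intro sum.cong refl) (metis \<sigma> monomial_mult mult.assoc squarefree_monomial_eq_face_term)
  also have "\<dots> = (\<Sum>t\<in>terms q. const (Poly_Mapping.lookup q t) * monomial (\<sigma> t)) * squarefree_monomial G"
    by (simp add: sum_distrib_right)
  finally show ?thesis ..
qed

text \<open>The list holds the facets in the order opposite to that of attachment: its head is the facet attached
  last, and the faces that it contributes form an interval \<open>[G, F]\<close>. With this order the head belongs to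
  the lowest step of the filtration of \<open>R / I\<^sub>\<Gamma>\<close>.\<close>

inductive shelling :: "'x::finite set list \<Rightarrow> 'x set set \<Rightarrow> bool" where
  Nil: "shelling [] {}"
| Cons: "shelling Fs \<Gamma>' \<Longrightarrow> simplicial_complex \<Gamma> \<Longrightarrow> \<Gamma> = \<Gamma>' \<union> {H. G \<subseteq> H \<and> H \<subseteq> F} \<Longrightarrow>
     G \<subseteq> F \<Longrightarrow> G \<notin> \<Gamma>' \<Longrightarrow> shelling (F # Fs) \<Gamma>"

lemma shelling_complex: "shelling Fs \<Gamma> \<Longrightarrow> simplicial_complex \<Gamma>"
  by (cases rule: shelling.cases) (auto simp: simplicial_complex_def)

lemma shelling_faces: "shelling Fs \<Gamma> \<Longrightarrow> set Fs \<subseteq> \<Gamma>"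
  by (induction rule: shelling.induct) auto

lemma shelling_subset_facet: "shelling Fs \<Gamma> \<Longrightarrow> H \<in> \<Gamma> \<Longrightarrow> \<exists>F\<in>set Fs. H \<subseteq> F"
  by (induction rule: shelling.induct) auto

context
  fixes \<Gamma> \<Gamma>' :: "'x::finite set set" and F G :: "'x set"
  assumes cx: "simplicial_complex \<Gamma>" "simplicial_complex \<Gamma>'"
    and step: "\<Gamma> = \<Gamma>' \<union> {H. G \<subseteq> H \<and> H \<subseteq> F}" "G \<subseteq> F" "G \<notin> \<Gamma>'"
begin

text \<open>Passing from \<open>\<Gamma>\<close> to \<open>\<Gamma>'\<close> adds to the ideal exactly the terms with support in \<open>[G, F]\<close>, and these are
  multiples of \<open>x\<^sub>G\<close>.\<close>

lemma shelling_step_generates: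
  fixes p :: "('x, 'k::field) mpoly"
  assumes "p \<in> face_ideal \<Gamma>'"
  shows "\<exists>r. p - r * squarefree_monomial G \<in> face_ideal \<Gamma>"
proof -
  obtain q q' where q: "p = q + q'" "terms q = terms p \<inter> {t. G \<subseteq> supp t}" "terms q' = terms p - {t. G \<subseteq> supp t}"
    using exists_term_split[of p "{t. G \<subseteq> supp t}"] by (elim exE conjE) (rule that)
  obtain r where r: "q = r * squarefree_monomial G" using monomial_factor[of q G] q(2) by blast
  have "q' \<in> face_ideal \<Gamma>" using assms by (auto simp: face_ideal_iff q(3) step(1))
  moreover have "q' = p - r * squarefree_monomial G" using q(1) r by simp
  ultimately show ?thesis by metis
qed

text \<open>A set containing \<open>G\<close> is a face of \<open>\<Gamma>\<close> iff it is contained in \<open>F\<close>: otherwise it would be a face of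
  \<open>\<Gamma>'\<close>, and so would \<open>G\<close>.\<close>

lemma shelling_step_colon:
  fixes r :: "('x, 'k::field) mpoly"
  shows "r * squarefree_monomial G \<in> face_ideal \<Gamma> \<longleftrightarrow> r \<in> face_prime F"
proof -
  have "supp s \<union> G \<in> \<Gamma> \<longleftrightarrow> supp s \<subseteq> F" for s
    using step cx(2) unfolding simplicial_complex_def by blast
  thus ?thesis
    by (simp add: face_ideal_iff squarefree_monomial_eq_face_term terms_mult_monomial supp_add)
qed

lemma shelling_step_generator: "squarefree_monomial G \<in> face_ideal \<Gamma>'" "squarefree_monomial G \<notin> face_ideal \<Gamma>"
  using step by (auto simp: squarefree_monomial_eq_face_term)

lemma shelling_step_psubset: "face_ideal \<Gamma> \<subset> (face_ideal \<Gamma>' :: ('x, 'k::field) mpoly set)"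
proof
  show "face_ideal \<Gamma> \<subseteq> (face_ideal \<Gamma>' :: ('x, 'k) mpoly set)" using step(1) by (intro face_ideal_mono) auto
  show "face_ideal \<Gamma> \<noteq> (face_ideal \<Gamma>' :: ('x, 'k) mpoly set)" using shelling_step_generator by metis
qed

lemma shelling_step_isomorphic:
  "module_isomorphic polyring
     (subquotient polyring (face_ideal \<Gamma>') (face_ideal \<Gamma> :: ('x, 'k::field) mpoly set))
     (subquotient polyring (carrier polyring) (face_prime F))"
proof -
  interpret nested_ideals "face_ideal \<Gamma>'" "face_ideal \<Gamma> :: ('x, 'k) mpoly set"
    by (rule nested_ideals.intro[OF face_ideal_ideal[OF cx(2)] face_ideal_ideal[OF cx(1)]
          psubset_imp_subset[OF shelling_step_psubset]])
  show ?thesis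
    unfolding module_isomorphic_cyclic_iff[OF face_prime_ideal]
    using shelling_step_generates shelling_step_colon shelling_step_generator(1) by blast
qed

end

lemma face_ideal_empty [simp]: "face_ideal {} = UNIV"
  by (auto simp: face_ideal_iff)

text \<open>Each step of the shelling contributes the factor \<open>R / P\<^sub>F\<close>, generated by \<open>x\<^sub>G\<close>.\<close>

lemma shelling_filtration:
  assumes "shelling Fs \<Gamma>"
  shows "\<exists>I \<pp>. monomial_prime_filtration (face_ideal \<Gamma> :: ('x::finite, 'k::field) mpoly set) (length Fs) I \<pp> \<and>
     (\<forall>i<length Fs. \<pp> (Suc i) = face_prime (Fs ! i))"
  using assms
proof induction
  case Nil
  have "monomial_ideal (UNIV :: ('x, 'k) mpoly set)"
    using monomial_face_ideal[of "{}"] by (simp add: simplicial_complex_def)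
  thus ?case
    by (intro exI[of _ "\<lambda>_. UNIV"]) (auto simp: monomial_prime_filtration_def)
next
  case (Cons Fs \<Gamma>' \<Gamma> G F)
  obtain I \<pp> where I: "monomial_prime_filtration (face_ideal \<Gamma>' :: ('x, 'k) mpoly set) (length Fs) I \<pp>"
    and \<pp>: "\<forall>i<length Fs. \<pp> (Suc i) = face_prime (Fs ! i)" using Cons.IH by blast
  let ?I = "\<lambda>i. case i of 0 \<Rightarrow> face_ideal \<Gamma> | Suc j \<Rightarrow> I j"
  let ?\<pp> = "\<lambda>i. case i of 0 \<Rightarrow> UNIV | Suc 0 \<Rightarrow> face_prime F | Suc (Suc j) \<Rightarrow> \<pp> (Suc j)"
  note cx = Cons.hyps(2) shelling_complex[OF Cons.hyps(1)]
  have I0: "I 0 = face_ideal \<Gamma>'" using I by (simp add: monomial_prime_filtration_def)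
  have "monomial_prime_filtration (face_ideal \<Gamma>) (Suc (length Fs)) ?I ?\<pp>"
    unfolding monomial_prime_filtration_def
  proof (intro conjI ballI)
    fix i assume i: "i \<in> {0..Suc (length Fs)}"
    show "monomial_ideal (?I i)"
      using I i monomial_face_ideal[OF cx(1)]
      by (auto simp: monomial_prime_filtration_def split: nat.split)
  next
    fix i assume "i \<in> {1..Suc (length Fs)}"
    then obtain j where j: "i = Suc j" "j \<le> length Fs" by (cases i) auto
    have all: "?I (i - 1) \<subset> ?I i \<and> monomial_ideal (?\<pp> i) \<and> primeideal (?\<pp> i) polyring \<and>
      module_isomorphic polyring (subquotient polyring (?I i) (?I (i - 1)))
        (subquotient polyring (carrier polyring) (?\<pp> i))"
    proof (cases j)
      case 0
      thus ?thesis
        by (simp add: j I0 shelling_step_psubset[OF cx Cons.hyps(3-5)] monomial_face_ideal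
          shelling_step_isomorphic[OF cx Cons.hyps(3-5), unfolded carrier_polyring] face_prime_primeideal)
    next
      case (Suc k)
      hence jr: "j \<in> {1..length Fs}" using j by simp
      have "\<forall>i\<in>{1..length Fs}. I (i - 1) \<subset> I i \<and> monomial_ideal (\<pp> i) \<and>
          primeideal (\<pp> i) polyring \<and> module_isomorphic polyring
            (subquotient polyring (I i) (I (i - 1))) (subquotient polyring (carrier polyring) (\<pp> i))"
        using I unfolding monomial_prime_filtration_def by (elim conjE)
      from bspec[OF this jr] show ?thesis using Suc j(1) by simp
    qed
    from all show "?I (i - 1) \<subset> ?I i" "monomial_ideal (?\<pp> i)" "primeideal (?\<pp> i) polyring"
      "module_isomorphic polyring (subquotient polyring (?I i) (?I (i - 1)))
        (subquotient polyring (carrier polyring) (?\<pp> i))" by blast+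
  qed (use I in \<open>auto simp: monomial_prime_filtration_def\<close>)
  moreover have "?\<pp> (Suc i) = face_prime ((F # Fs) ! i)" if "i < Suc (length Fs)" for i
    using that \<pp> by (cases i) auto
  ultimately show ?case by (metis length_Cons)
qed

text \<open>Facets are pairwise incomparable, hence so are the primes of the filtration, and the condition on
  strict inclusions is vacuous.\<close>

theorem pretty_clean_if_shelling:
  assumes sh: "shelling Fs \<Gamma>" and facets: "\<And>F H. F \<in> set Fs \<Longrightarrow> H \<in> \<Gamma> \<Longrightarrow> \<not> F \<subset> H"
  shows "pretty_clean_quotient (face_ideal \<Gamma> :: ('x::finite, 'k::field) mpoly set)"
proof -
  obtain I \<pp> where I: "monomial_prime_filtration (face_ideal \<Gamma> :: ('x, 'k) mpoly set) (length Fs) I \<pp>"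
    and \<pp>: "\<forall>i<length Fs. \<pp> (Suc i) = face_prime (Fs ! i)" using shelling_filtration[OF sh] by blast
  have "\<not> \<pp> i \<subset> \<pp> j" if ij: "i \<in> {1..length Fs}" "j \<in> {1..length Fs}" for i j
  proof
    assume "\<pp> i \<subset> \<pp> j"
    moreover have "\<pp> i = face_prime (Fs ! (i - 1))" "\<pp> j = face_prime (Fs ! (j - 1))"
      using ij \<pp>[rule_format, of "i - 1"] \<pp>[rule_format, of "j - 1"] by auto
    ultimately have "Fs ! (j - 1) \<subset> Fs ! (i - 1)" by (simp add: face_prime_psubset_iff)
    moreover have "Fs ! (j - 1) \<in> set Fs" "Fs ! (i - 1) \<in> set Fs" using ij by auto
    ultimately show False using facets shelling_faces[OF sh] by blast
  qed
  thus ?thesis using I unfolding pretty_clean_quotient_def by blast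
qed

section \<open>A regular sequence on shelled graphs\<close>

text \<open>The elements \<open>f\<close>, \<open>g\<close> satisfy the nonzerodivisor conditions of a regular sequence on \<open>R / N\<close>. Properness
  is left out, so that the condition holds for \<open>N = R\<close>, where the induction along a shelling begins.\<close>

definition regular_pair :: "('x::finite, 'k::field) mpoly \<Rightarrow> ('x, 'k) mpoly \<Rightarrow> ('x, 'k) mpoly set \<Rightarrow> bool" where
  "regular_pair f g N \<longleftrightarrow>
     (\<forall>b. f * b \<in> N \<longrightarrow> b \<in> N) \<and> (\<forall>b c. g * b - f * c \<in> N \<longrightarrow> (\<exists>d. b - f * d \<in> N))"

text \<open>The sequence \<open>0 \<rightarrow> R / P \<rightarrow> R / N \<rightarrow> R / L \<rightarrow> 0\<close> is exact, its first map being multiplication by \<open>u\<close>; a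
  pair that is regular on both ends is regular in the middle, by a diagram chase.\<close>

lemma regular_pair_extension:
  fixes N L P :: "('x::finite, 'k::field) mpoly set"
  assumes N: "ideal N polyring" and L: "ideal L polyring" and NL: "N \<subseteq> L" "u \<in> L"
    and gen: "\<And>x. x \<in> L \<Longrightarrow> \<exists>r. x - r * u \<in> N" and colon: "\<And>r. r * u \<in> N \<longleftrightarrow> r \<in> P"
    and reg: "regular_pair f g L" "regular_pair f g P"
  shows "regular_pair f g N"
  unfolding regular_pair_def
proof (intro conjI allI impI)
  fix b assume b: "f * b \<in> N"
  hence "b \<in> L" using NL(1) reg(1) by (auto simp: regular_pair_def)
  then obtain r where r: "b - r * u \<in> N" using gen by blast
  have "f * b - f * (b - r * u) \<in> N" by (rule ideal_diff[OF N b ideal_mult[OF N r]])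
  hence "f * r * u \<in> N" by (simp add: algebra_simps)
  hence "r \<in> P" using reg(2) by (simp add: colon regular_pair_def)
  thus "b \<in> N" using ideal_diff_cancel[OF N r] by (simp add: colon)
next
  fix b c assume bc: "g * b - f * c \<in> N"
  then obtain d where d: "b - f * d \<in> L" using NL(1) reg(1) unfolding regular_pair_def by blast
  then obtain r where r: "b - f * d - r * u \<in> N" using gen by blast
  have 1: "g * b - f * c - g * (b - f * d - r * u) \<in> N" by (rule ideal_diff[OF N bc ideal_mult[OF N r]])
  \<comment> \<open>modulo \<open>L\<close> the generator \<open>u\<close> vanishes, so that \<open>f\<close> can be cancelled\<close>
  hence "g * b - f * c - g * (b - f * d - r * u) - g * r * u \<in> L"
    using NL ideal_diff[OF L _ ideal_mult[OF L NL(2)]] by blast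
  hence "f * (g * d - c) \<in> L" by (simp add: algebra_simps)
  hence "g * d - c \<in> L" using reg(1) unfolding regular_pair_def by blast
  then obtain s where s: "g * d - c - s * u \<in> N" using gen by blast
  have "g * b - f * c - g * (b - f * d - r * u) - f * (g * d - c - s * u) \<in> N"
    by (rule ideal_diff[OF N 1 ideal_mult[OF N s]])
  also have "g * b - f * c - g * (b - f * d - r * u) - f * (g * d - c - s * u) = (g * r - f * (- s)) * u"
    by (simp add: algebra_simps)
  finally have "g * r - f * (- s) \<in> P" by (simp only: colon)
  then obtain e where "r - f * e \<in> P" using reg(2) unfolding regular_pair_def by blast
  hence "(r - f * e) * u \<in> N" by (simp only: colon)
  hence "(b - f * d - r * u) + (r - f * e) * u \<in> N" by (rule ideal_add[OF N r])
  also have "(b - f * d - r * u) + (r - f * e) * u = b - f * (d + e * u)" by (simp add: algebra_simps)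
  finally show "\<exists>d. b - f * d \<in> N" ..
qed

lemma regular_pair_shelling:
  fixes f g :: "('x::finite, 'k::field) mpoly"
  assumes "shelling Fs \<Gamma>" "\<And>F. F \<in> set Fs \<Longrightarrow> regular_pair f g (face_prime F)"
  shows "regular_pair f g (face_ideal \<Gamma>)"
  using assms
proof induction
  case Nil
  show ?case by (simp add: regular_pair_def)
next
  case (Cons Fs \<Gamma>' \<Gamma> G F)
  note cx = Cons.hyps(2) shelling_complex[OF Cons.hyps(1)]
  show ?case
  proof (rule regular_pair_extension[of _ "face_ideal \<Gamma>'" "squarefree_monomial G" "face_prime F"])
    show "face_ideal \<Gamma> \<subseteq> (face_ideal \<Gamma>' :: ('x, 'k) mpoly set)"
      using shelling_step_psubset[OF cx Cons.hyps(3-5)] by blast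
    show "squarefree_monomial G \<in> (face_ideal \<Gamma>' :: ('x, 'k) mpoly set)"
      by (rule shelling_step_generator[OF cx Cons.hyps(3-5)])
    show "\<exists>r. x - r * squarefree_monomial G \<in> face_ideal \<Gamma>" if "x \<in> face_ideal \<Gamma>'" for x :: "('x, 'k) mpoly"
      by (rule shelling_step_generates[OF cx Cons.hyps(3-5) that])
    show "r * squarefree_monomial G \<in> face_ideal \<Gamma> \<longleftrightarrow> r \<in> face_prime F" for r :: "('x, 'k) mpoly"
      by (rule shelling_step_colon[OF cx Cons.hyps(3-5)])
  qed (use Cons in \<open>auto intro: face_ideal_ideal cx\<close>)
qed

text \<open>The first two elementary symmetric polynomials in the variables. On \<open>R / P\<close> with \<open>P\<close> the prime of an
  edge \<open>{a, b}\<close> they act as \<open>x\<^sub>a + x\<^sub>b\<close> and \<open>x\<^sub>a x\<^sub>b\<close>, so they form a regular sequence over every field.\<close>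

definition vertex_sum :: "('x::finite, 'k::field) mpoly" where
  "vertex_sum = (\<Sum>v\<in>UNIV. variable v)"

definition edge_sum :: "('x::finite, 'k::field) mpoly" where
  "edge_sum = (\<Sum>e\<in>{e. card e = 2}. squarefree_monomial e)"

lemma squarefree_monomial_in_face_ideal [simp]: "squarefree_monomial F \<in> face_ideal \<Gamma> \<longleftrightarrow> F \<notin> \<Gamma>"
  by (simp add: squarefree_monomial_eq_face_term)

lemma vertex_sum_maximal: "vertex_sum \<in> face_prime {}"
  unfolding vertex_sum_def by (rule ideal_sum[OF face_prime_ideal]) simp

lemma edge_sum_maximal: "edge_sum \<in> face_prime {}"
  unfolding edge_sum_def by (rule ideal_sum[OF face_prime_ideal]) auto

lemma vertex_sum_notin_face_prime:
  assumes "F \<noteq> {}"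
  shows "(vertex_sum :: ('x::finite, 'k::field) mpoly) \<notin> face_prime F"
proof -
  obtain a where a: "a \<in> F" using assms by blast
  have "vertex_sum - variable a = (\<Sum>v\<in>UNIV - {a}. variable v :: ('x, 'k) mpoly)"
    unfolding vertex_sum_def by (subst sum.remove[of UNIV a]) auto
  also have "\<dots> \<in> face_prime {a}" by (rule ideal_sum[OF face_prime_ideal]) auto
  finally have "vertex_sum \<in> (face_prime {a} :: ('x, 'k) mpoly set) \<longleftrightarrow> variable a \<in> (face_prime {a} :: ('x, 'k) mpoly set)"
    by (rule ideal_diff_cancel[OF face_prime_ideal])
  hence "(vertex_sum :: ('x, 'k) mpoly) \<notin> face_prime {a}" by simp
  thus ?thesis using a face_ideal_mono[of "Pow {a}" "Pow F"] by blast
qed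

lemma vertex_sum_regular:
  assumes "F \<noteq> {}" "vertex_sum * b \<in> face_prime F"
  shows "b \<in> (face_prime F :: ('x::finite, 'k::field) mpoly set)"
  using face_prime_prime[OF assms(2)] vertex_sum_notin_face_prime[OF assms(1)] by blast

lemma squarefree_monomial_singleton: "squarefree_monomial {a} = variable a"
  by (simp add: squarefree_monomial_def)

text \<open>This is the shelling step from the point \<open>b\<close> to the edge \<open>{a, b}\<close>.\<close>

lemma face_prime_pair:
  fixes c :: "('x::finite, 'k::field) mpoly"
  assumes "a \<noteq> b"
  shows "c \<in> face_prime {b} \<Longrightarrow> \<exists>d. c - d * variable a \<in> face_prime {a, b}"
    and "d * variable a \<in> face_prime {a, b} \<longleftrightarrow> d \<in> (face_prime {a, b} :: ('x, 'k) mpoly set)"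
proof -
  have step: "Pow {a, b} = Pow {b} \<union> {H. {a} \<subseteq> H \<and> H \<subseteq> {a, b}}" "{a} \<subseteq> {a, b}" "{a} \<notin> Pow {b}"
    using assms by auto
  show "\<exists>d. c - d * variable a \<in> face_prime {a, b}" if "c \<in> face_prime {b}"
    using shelling_step_generates[OF simplicial_complex_Pow simplicial_complex_Pow step that]
    unfolding squarefree_monomial_singleton .
  show "d * variable a \<in> face_prime {a, b} \<longleftrightarrow> d \<in> (face_prime {a, b} :: ('x, 'k) mpoly set)"
    using shelling_step_colon[OF simplicial_complex_Pow simplicial_complex_Pow step]
    unfolding squarefree_monomial_singleton .
qed

text \<open>Modulo \<open>P = P\<^bsub>{a,b}\<^esub>\<close> the sum of the variables is \<open>x\<^sub>a + x\<^sub>b\<close>. If it divides \<open>x\<^sub>a p\<close>, then setting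
  \<open>x\<^sub>a = 0\<close> shows that the cofactor is divisible by \<open>x\<^sub>a\<close>, which then cancels.\<close>

lemma variable_regular_mod_vertex_sum:
  fixes p c :: "('x::finite, 'k::field) mpoly"
  assumes ab: "a \<noteq> b" and p: "variable a * p - vertex_sum * c \<in> face_prime {a, b}"
  shows "\<exists>d. p - vertex_sum * d \<in> face_prime {a, b}"
proof -
  have "variable a * p - vertex_sum * c \<in> face_prime {b}"
    using p face_ideal_mono[of "Pow {b}" "Pow {a, b}"] by blast
  moreover have "variable a * p \<in> face_prime {b}"
    using ab by (intro ideal_mult_right[OF face_prime_ideal]) simp
  ultimately have "vertex_sum * c \<in> face_prime {b}" using ideal_diff_cancel[OF face_prime_ideal] by blast
  hence "c \<in> face_prime {b}" by (rule vertex_sum_regular[rotated]) simp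
  then obtain d where d: "c - d * variable a \<in> face_prime {a, b}"
    using face_prime_pair(1)[OF ab] by blast
  have "variable a * p - vertex_sum * c + vertex_sum * (c - d * variable a) \<in> face_prime {a, b}"
    by (rule ideal_add[OF face_prime_ideal p ideal_mult[OF face_prime_ideal d]])
  also have "variable a * p - vertex_sum * c + vertex_sum * (c - d * variable a) =
      (p - vertex_sum * d) * variable a" by (simp add: algebra_simps)
  finally show ?thesis using face_prime_pair(2)[OF ab] by blast
qed

text \<open>The second element is \<open>x\<^sub>a x\<^sub>b\<close> modulo the prime, and both factors are regular modulo the first.\<close>

lemma regular_pair_edge:
  assumes ab: "a \<noteq> b"
  shows "regular_pair vertex_sum edge_sum (face_prime {a, b} :: ('x::finite, 'k::field) mpoly set)"
  unfolding regular_pair_def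
proof (intro conjI allI impI)
  fix p assume "vertex_sum * p \<in> (face_prime {a, b} :: ('x, 'k) mpoly set)"
  thus "p \<in> face_prime {a, b}" by (rule vertex_sum_regular[rotated]) simp
next
  fix p c assume p: "edge_sum * p - vertex_sum * c \<in> (face_prime {a, b} :: ('x, 'k) mpoly set)"
  have "edge_sum - squarefree_monomial {a, b} =
      (\<Sum>e\<in>{e. card e = 2} - {{a, b}}. squarefree_monomial e :: ('x, 'k) mpoly)"
    unfolding edge_sum_def by (subst sum.remove[of "{e. card e = 2}" "{a, b}"]) (use ab in auto)
  also have "\<dots> \<in> face_prime {a, b}"
  proof (rule ideal_sum[OF face_prime_ideal])
    fix e assume "e \<in> {e. card e = 2} - {{a, b}}"
    hence "\<not> e \<subseteq> {a, b}" using card_subset_eq[of "{a, b}" e] ab by auto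
    thus "squarefree_monomial e \<in> (face_prime {a, b} :: ('x, 'k) mpoly set)" by simp
  qed
  finally have "(edge_sum - squarefree_monomial {a, b}) * p \<in> face_prime {a, b}"
    by (rule ideal_mult_right[OF face_prime_ideal])
  hence "edge_sum * p - vertex_sum * c - (edge_sum - squarefree_monomial {a, b}) * p \<in> face_prime {a, b}"
    by (rule ideal_diff[OF face_prime_ideal p])
  also have "edge_sum * p - vertex_sum * c - (edge_sum - squarefree_monomial {a, b}) * p =
      variable a * (variable b * p) - vertex_sum * c"
    using ab by (simp add: squarefree_monomial_def algebra_simps)
  finally obtain d where "variable b * p - vertex_sum * d \<in> face_prime {a, b}"
    using variable_regular_mod_vertex_sum[OF ab] by blast
  thus "\<exists>d. p - vertex_sum * d \<in> face_prime {a, b}"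
    using variable_regular_mod_vertex_sum[of b a p d] ab by (simp add: insert_commute)
qed

section \<open>Cohen-Macaulay subquotients of graph ideals\<close>

lemma monomial_ideal_UNIV: "monomial_ideal (UNIV :: ('x::finite, 'k::field) mpoly set)"
proof -
  have "monomial_ideal (face_ideal {} :: ('x, 'k) mpoly set)"
    by (rule monomial_face_ideal) (simp add: simplicial_complex_def)
  thus ?thesis by simp
qed

lemma annihilator_quotient:
  assumes "ideal J polyring"
  shows "{b. \<forall>x\<in>UNIV. b * x \<in> J} = (J :: ('x::finite, 'k::field) mpoly set)"
proof (intro equalityI subsetI)
  fix b assume "b \<in> {b. \<forall>x\<in>UNIV. b * x \<in> J}"
  hence "b * 1 \<in> J" by blast
  thus "b \<in> J" by simp
qed (auto intro: ideal_mult_right[OF assms])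

lemma face_ideal_neq_UNIV: "{} \<in> \<Gamma> \<Longrightarrow> (face_ideal \<Gamma> :: ('x::finite, 'k::field) mpoly set) \<noteq> UNIV"
proof
  assume "{} \<in> \<Gamma>" and eq: "(face_ideal \<Gamma> :: ('x, 'k) mpoly set) = UNIV"
  have "(1 :: ('x, 'k) mpoly) \<in> face_ideal \<Gamma>" unfolding eq ..
  thus False using \<open>{} \<in> \<Gamma>\<close> by (simp add: face_ideal_iff)
qed

lemma large_terms_in_face_ideal:
  assumes "\<And>H. H \<in> \<Gamma> \<Longrightarrow> card H \<le> d"
  shows "term_ideal {t. d < card (supp t)} \<subseteq> face_ideal \<Gamma>"
  unfolding face_ideal_def term_ideal_subset_iff using assms by fastforce

text \<open>The dimension is two because the complex has an edge and no larger face; regularity of the pair passes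
  from the edges to the complex along the shelling.\<close>

lemma cohen_macaulay_edges:
  fixes \<Gamma> :: "'x::finite set set"
  assumes sh: "shelling Fs \<Gamma>" and Fs: "Fs \<noteq> []" "\<And>F. F \<in> set Fs \<Longrightarrow> card F = 2"
  shows "module_dim polyring (subquotient polyring UNIV (face_ideal \<Gamma> :: ('x, 'k::field) mpoly set)) = enat 2"
    and "cohen_macaulay (subquotient polyring UNIV (face_ideal \<Gamma> :: ('x, 'k) mpoly set))"
proof -
  note cx = shelling_complex[OF sh]
  note J = face_ideal_ideal[OF cx]
  interpret nested_ideals UNIV "face_ideal \<Gamma> :: ('x, 'k) mpoly set"
    by (rule nested_ideals.intro[OF ideal_UNIV J subset_UNIV])
  define e where "e = hd Fs"
  have e: "e \<in> \<Gamma>" "card e = 2" using Fs shelling_faces[OF sh] by (auto simp: e_def)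
  have small: "card H \<le> card e" if "H \<in> \<Gamma>" for H
    using shelling_subset_facet[OF sh that] Fs(2) e(2) by (metis card_mono finite)
  have sub: "Pow e \<subseteq> \<Gamma>" using e(1) cx by (auto simp: simplicial_complex_def)
  have pair: "regular_pair vertex_sum edge_sum (face_ideal \<Gamma> :: ('x, 'k) mpoly set)"
  proof (rule regular_pair_shelling[OF sh])
    fix F assume "F \<in> set Fs"
    then obtain a b where "F = {a, b}" "a \<noteq> b" using Fs(2) card_2_iff by metis
    thus "regular_pair vertex_sum edge_sum (face_prime F :: ('x, 'k) mpoly set)"
      using regular_pair_edge by blast
  qed
  let ?fs = "[vertex_sum, edge_sum] :: ('x, 'k) mpoly list"
  have max: "set ?fs \<subseteq> face_prime {}" using vertex_sum_maximal edge_sum_maximal by simp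
  have reg: "regular_sequence polyring M ?fs"
  proof (rule regular_sequenceI[OF monomial_ideal_UNIV monomial_face_ideal[OF cx] _ max])
    show "face_ideal \<Gamma> \<noteq> (UNIV :: ('x, 'k) mpoly set)" using sub by (intro face_ideal_neq_UNIV) blast
  next
    fix i b assume i: "i < length ?fs" and b: "?fs ! i * b \<in> seq_ideal ?fs i"
    have "i = 0 \<or> i = Suc 0" using i by auto
    thus "b \<in> seq_ideal ?fs i"
    proof
      assume "i = 0"
      thus ?thesis using b pair by (simp add: regular_pair_def)
    next
      assume i: "i = Suc 0"
      then obtain c where "edge_sum * b - vertex_sum * c \<in> face_ideal \<Gamma>" using b by (auto simp: seq_ideal_1)
      then obtain d where "b - vertex_sum * d \<in> face_ideal \<Gamma>" using pair unfolding regular_pair_def by blast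
      thus ?thesis by (auto simp: i seq_ideal_1)
    qed
  qed
  note cm = cohen_macaulayI[of e, unfolded annihilator_quotient[OF J], OF large_terms_in_face_ideal[OF small]
      face_ideal_mono[OF sub] max _ reg]
  show "module_dim polyring M = enat 2" "cohen_macaulay M" using cm e(2) by simp_all
qed

text \<open>A term of an element of \<open>I\<^bsub>\<Gamma>'\<^esub>\<close> that is missing from \<open>I\<^sub>\<Gamma>\<close> has its support inside one of the new
  vertices \<open>w\<close>. Modulo the prime \<open>P\<^bsub>{w}\<^esub>\<close>, which contains \<open>I\<^sub>\<Gamma>\<close>, the sum of the variables is a
  nonzerodivisor. Taking \<open>\<Gamma>'\<close> empty covers complexes that consist of points only.\<close>

lemma cohen_macaulay_vertices:
  fixes \<Gamma> \<Gamma>' :: "'x::finite set set"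
  assumes cx: "simplicial_complex \<Gamma>" "simplicial_complex \<Gamma>'" and sub: "\<Gamma>' \<subset> \<Gamma>"
    and new: "\<And>H. H \<in> \<Gamma> - \<Gamma>' \<Longrightarrow> \<exists>w. H \<subseteq> {w} \<and> {w} \<in> \<Gamma> - \<Gamma>'"
  shows "module_dim polyring (subquotient polyring (face_ideal \<Gamma>') (face_ideal \<Gamma> :: ('x, 'k::field) mpoly set)) = enat 1"
    and "cohen_macaulay (subquotient polyring (face_ideal \<Gamma>') (face_ideal \<Gamma> :: ('x, 'k) mpoly set))"
proof -
  interpret nested_ideals "face_ideal \<Gamma>'" "face_ideal \<Gamma> :: ('x, 'k) mpoly set"
    by (rule nested_ideals.intro[OF face_ideal_ideal face_ideal_ideal face_ideal_mono]) (use cx sub in auto)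
  let ?I = "face_ideal \<Gamma>' :: ('x, 'k) mpoly set" and ?J = "face_ideal \<Gamma> :: ('x, 'k) mpoly set"
  obtain w where w: "{w} \<in> \<Gamma> - \<Gamma>'" using new sub by blast
  have large: "term_ideal {t. card {w} < card (supp t)} \<subseteq> {b. \<forall>x\<in>?I. b * x \<in> ?J}"
  proof (intro subsetI CollectI ballI)
    fix b x :: "('x, 'k) mpoly" assume b: "b \<in> term_ideal {t. card {w} < card (supp t)}" and x: "x \<in> ?I"
    show "b * x \<in> ?J"
      unfolding face_ideal_iff
    proof (intro ballI notI)
      fix t assume t: "t \<in> terms (b * x)" and face: "supp t \<in> \<Gamma>"
      obtain r s where rs: "r \<in> terms b" "s \<in> terms x" "t = r + s" using t by (rule terms_times_obtain)
      have "supp s \<notin> \<Gamma>'" using x rs(2) by (simp add: face_ideal_iff)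
      hence "supp t \<in> \<Gamma> - \<Gamma>'" using face cx(2) by (auto simp: rs(3) supp_add simplicial_complex_def)
      then obtain v where "supp t \<subseteq> {v}" using new by blast
      hence "supp r \<subseteq> {v}" by (simp add: rs(3) supp_add)
      hence "card (supp r) \<le> 1" by (metis card_mono finite is_singletonI is_singleton_altdef)
      moreover have "1 < card (supp r)" using b rs(1) by (auto simp: term_ideal_def)
      ultimately show False by simp
    qed
  qed
  have ann: "{b. \<forall>x\<in>?I. b * x \<in> ?J} \<subseteq> face_prime {w}"
  proof (intro subsetI)
    fix b :: "('x, 'k) mpoly" assume "b \<in> {b. \<forall>x\<in>?I. b * x \<in> ?J}"
    hence "b * squarefree_monomial {w} \<in> ?J" using w by simp
    hence "\<forall>s\<in>terms b. supp s \<union> {w} \<notin> \<Gamma>"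
      by (simp add: face_ideal_iff squarefree_monomial_eq_face_term terms_mult_monomial supp_add)
    moreover have "supp s \<union> {w} \<in> \<Gamma>" if "supp s \<subseteq> {w}" for s using that w by (auto simp: Un_absorb1 simp del: Un_insert_right)
    ultimately show "b \<in> face_prime {w}" unfolding face_prime_iff by blast
  qed
  let ?fs = "[vertex_sum] :: ('x, 'k) mpoly list"
  have max: "set ?fs \<subseteq> face_prime {}" using vertex_sum_maximal by simp
  have reg: "regular_sequence polyring M ?fs"
  proof (rule regular_sequenceI[OF monomial_face_ideal[OF cx(2)] monomial_face_ideal[OF cx(1)] _ max])
    show "?J \<noteq> ?I" using sub by (auto simp only: set_eq_subset face_ideal_subset_iff psubset_eq)
  next
    fix i b assume i: "i < length ?fs" and bI: "b \<in> ?I" and b: "?fs ! i * b \<in> seq_ideal ?fs i"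
    have fb: "vertex_sum * b \<in> ?J" using i b by simp
    have "b \<in> ?J"
      unfolding face_ideal_iff
    proof (intro ballI notI)
      fix t assume t: "t \<in> terms b" "supp t \<in> \<Gamma>"
      hence "supp t \<in> \<Gamma> - \<Gamma>'" using bI by (simp add: face_ideal_iff)
      then obtain v where v: "supp t \<subseteq> {v}" "{v} \<in> \<Gamma>" using new by blast
      have "Pow {v} \<subseteq> \<Gamma>" using v(2) cx(1) unfolding simplicial_complex_def by blast
      hence "vertex_sum * b \<in> face_prime {v}" using fb face_ideal_mono by blast
      hence "b \<in> face_prime {v}" by (rule vertex_sum_regular[rotated]) simp
      thus False using t(1) v(1) unfolding face_prime_iff by blast
    qed
    thus "b \<in> seq_ideal ?fs i" using i by simp
  qed
  show "module_dim polyring M = enat 1" "cohen_macaulay M"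
    using cohen_macaulayI[OF large ann max _ reg] by simp_all
qed

lemma cohen_macaulay_point:
  "cohen_macaulay (subquotient polyring UNIV (face_prime {} :: ('x::finite, 'k::field) mpoly set))"
proof -
  interpret nested_ideals UNIV "face_prime {} :: ('x, 'k) mpoly set"
    by (rule nested_ideals.intro[OF ideal_UNIV face_prime_ideal subset_UNIV])
  have reg: "regular_sequence polyring M []"
    by (rule regular_sequenceI[OF monomial_ideal_UNIV monomial_face_ideal[OF simplicial_complex_Pow] face_ideal_neq_UNIV])
      auto
  have "term_ideal {t. card {} < card (supp t)} \<subseteq> (face_prime {} :: ('x, 'k) mpoly set)"
    by (rule large_terms_in_face_ideal) auto
  thus ?thesis
    by (intro cohen_macaulayI(2)[of "{}", unfolded annihilator_quotient[OF face_prime_ideal], OF _ _ _ _ reg]) auto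
qed

section \<open>Connected edges yield a shelling\<close>

text \<open>All edges belong to one connected component, expressed through sets of vertices that no edge leaves.
  Isolated vertices are ignored.\<close>

definition edge_connected :: "'x::finite set set \<Rightarrow> bool" where
  "edge_connected \<Gamma> \<longleftrightarrow>
     (\<forall>A. (\<forall>F\<in>\<Gamma>. card F = 2 \<longrightarrow> F \<subseteq> A \<or> F \<inter> A = {}) \<longrightarrow>
        (\<forall>F\<in>\<Gamma>. card F = 2 \<longrightarrow> F \<subseteq> A) \<or> (\<forall>F\<in>\<Gamma>. card F = 2 \<longrightarrow> F \<inter> A = {}))"

text \<open>The subcomplex generated by the edges, the pure part of dimension one.\<close>

definition pure_edges :: "'x::finite set set \<Rightarrow> 'x set set" where
  "pure_edges \<Gamma> = {H. \<exists>e\<in>\<Gamma>. card e = 2 \<and> H \<subseteq> e}"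

text \<open>An edge that touches the present complex contributes either itself alone or itself and its one new
  vertex, and in both cases the new faces form an interval.\<close>

lemma shelling_insert_edge:
  assumes sh: "shelling Fs \<Gamma>" and e: "card e = 2" "e \<notin> \<Gamma>" "e \<inter> \<Union>\<Gamma> \<noteq> {}"
  shows "\<exists>\<Gamma>'. shelling (e # Fs) \<Gamma>' \<and> \<Gamma> \<subseteq> \<Gamma>'"
proof -
  let ?A = "\<Union>\<Gamma>"
  note cx = shelling_complex[OF sh]
  have vertex: "{v} \<in> \<Gamma>" if "v \<in> ?A" for v
    using that cx unfolding simplicial_complex_def by (metis UnionE empty_subsetI insert_subset)
  have empty: "{} \<in> \<Gamma>" using e(3) cx unfolding simplicial_complex_def by blast
  \<comment> \<open>the smallest new face\<close>
  define G where "G = (if e \<subseteq> ?A then e else e - ?A)"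
  have G: "G \<subseteq> e" "G \<noteq> {}" using e by (auto simp: G_def)
  have "G \<notin> \<Gamma>"
  proof
    assume "G \<in> \<Gamma>"
    hence "G \<subseteq> ?A" by blast
    thus False using e(2) G \<open>G \<in> \<Gamma>\<close> by (auto simp: G_def split: if_splits)
  qed
  moreover have "simplicial_complex (\<Gamma> \<union> {H. G \<subseteq> H \<and> H \<subseteq> e})"
    unfolding simplicial_complex_def
  proof (intro ballI allI impI)
    fix H K assume H: "H \<in> \<Gamma> \<union> {H. G \<subseteq> H \<and> H \<subseteq> e}" and K: "K \<subseteq> H"
    show "K \<in> \<Gamma> \<union> {H. G \<subseteq> H \<and> H \<subseteq> e}"
    proof (cases "H \<in> \<Gamma> \<or> G \<subseteq> K")
      case True
      thus ?thesis using H K cx unfolding simplicial_complex_def by blast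
    next
      case False
      hence Ke: "K \<subseteq> e" "\<not> G \<subseteq> K" using H K by auto
      have "K \<subset> e" using Ke G by blast
      hence "card K < 2" using e(1) psubset_card_mono[of e K] by simp
      hence "K = {} \<or> (\<exists>v. K = {v})" by (cases "card K = 0") (auto simp: card_1_singleton_iff less_2_cases_iff)
      moreover have "v \<in> ?A" if "K = {v}" for v
      proof (cases "e \<subseteq> ?A")
        case True
        thus ?thesis using that Ke by blast
      next
        case F: False
        obtain a b where ab: "e = {a, b}" "a \<noteq> b" using e(1) card_2_iff by metis
        show ?thesis using F ab that Ke e(3) by (auto simp: G_def)
      qed
      ultimately show ?thesis using vertex empty by blast
    qed
  qed
  ultimately have "shelling (e # Fs) (\<Gamma> \<union> {H. G \<subseteq> H \<and> H \<subseteq> e})"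
    using shelling.Cons[OF sh _ refl G(1)] by blast
  thus ?thesis by blast
qed

text \<open>Take a largest complex shelled by edges. Edges outside it do not touch it, so its vertex set separates
  the edges, and by connectedness there are none outside.\<close>

lemma shelling_pure_edges:
  assumes cx: "simplicial_complex \<Gamma>" and conn: "edge_connected \<Gamma>" and e: "e \<in> \<Gamma>" "card e = 2"
  shows "\<exists>Fs. Fs \<noteq> [] \<and> (\<forall>F\<in>set Fs. F \<in> \<Gamma> \<and> card F = 2) \<and> shelling Fs (pure_edges \<Gamma>)"
proof -
  let ?ok = "\<lambda>\<Delta>. \<exists>Fs. Fs \<noteq> [] \<and> (\<forall>F\<in>set Fs. F \<in> \<Gamma> \<and> card F = 2) \<and> shelling Fs \<Delta>"
  have "shelling [e] (Pow e)"
    by (rule shelling.Cons[OF shelling.Nil simplicial_complex_Pow, of _ "{}"]) auto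
  hence "?ok (Pow e)" using e by (intro exI[of _ "[e]"]) auto
  hence "{\<Delta>. ?ok \<Delta>} \<noteq> {}" by blast
  then obtain \<Delta> where \<Delta>: "?ok \<Delta>" and max: "\<And>\<Delta>'. ?ok \<Delta>' \<Longrightarrow> \<Delta> \<subseteq> \<Delta>' \<Longrightarrow> \<Delta> = \<Delta>'"
    using finite_has_maximal[of "{\<Delta>. ?ok \<Delta>}"] by auto
  then obtain Fs where Fs: "Fs \<noteq> []" "\<And>F. F \<in> set Fs \<Longrightarrow> F \<in> \<Gamma> \<and> card F = 2" and sh: "shelling Fs \<Delta>"
    by blast
  have sub: "\<Delta> \<subseteq> pure_edges \<Gamma>"
    using shelling_subset_facet[OF sh] Fs(2) unfolding pure_edges_def by blast
  have step: "f \<inter> \<Union>\<Delta> = {}" if f: "f \<in> \<Gamma>" "card f = 2" "f \<notin> \<Delta>" for f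
  proof (rule ccontr)
    assume "f \<inter> \<Union>\<Delta> \<noteq> {}"
    then obtain \<Delta>' where D: "shelling (f # Fs) \<Delta>'" "\<Delta> \<subseteq> \<Delta>'"
      using shelling_insert_edge[OF sh f(2,3)] by blast
    have "?ok \<Delta>'" using D(1) Fs f by (intro exI[of _ "f # Fs"]) auto
    hence "\<Delta> = \<Delta>'" using max D(2) by blast
    thus False using shelling_faces[OF D(1)] f(3) by auto
  qed
  have "f \<in> \<Delta>" if f: "f \<in> \<Gamma>" "card f = 2" for f
  proof (rule ccontr)
    assume "f \<notin> \<Delta>"
    hence "f \<inter> \<Union>\<Delta> = {}" "f \<noteq> {}" using step f by auto
    moreover have "hd Fs \<in> \<Delta>" "hd Fs \<in> \<Gamma>" "card (hd Fs) = 2"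
      using Fs shelling_faces[OF sh] by auto
    moreover from this have "hd Fs \<noteq> {}" by (metis card.empty zero_neq_numeral)
    ultimately have "hd Fs \<in> \<Gamma>" "card (hd Fs) = 2" "hd Fs \<inter> \<Union>\<Delta> \<noteq> {}" "f \<inter> \<Union>\<Delta> = {}" "f \<noteq> {}"
      by blast+
    moreover have "\<forall>g\<in>\<Gamma>. card g = 2 \<longrightarrow> g \<subseteq> \<Union>\<Delta> \<or> g \<inter> \<Union>\<Delta> = {}" using step by blast
    hence "(\<forall>g\<in>\<Gamma>. card g = 2 \<longrightarrow> g \<subseteq> \<Union>\<Delta>) \<or> (\<forall>g\<in>\<Gamma>. card g = 2 \<longrightarrow> g \<inter> \<Union>\<Delta> = {})"
      using mp[OF spec[OF conn[unfolded edge_connected_def], of "\<Union>\<Delta>"]] by blast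
    hence "f \<subseteq> \<Union>\<Delta> \<or> hd Fs \<inter> \<Union>\<Delta> = {}" using f \<open>hd Fs \<in> \<Gamma>\<close> \<open>card (hd Fs) = 2\<close> by blast
    ultimately show False by blast
  qed
  hence "pure_edges \<Gamma> \<subseteq> \<Delta>"
    using shelling_complex[OF sh] unfolding pure_edges_def simplicial_complex_def by blast
  with sub have "\<Delta> = pure_edges \<Gamma>" by blast
  with \<Delta> show ?thesis by simp
qed

lemma shelling_add_vertices:
  assumes sh: "shelling Fs \<Gamma>" and ne: "\<Gamma> \<noteq> {}" and W: "\<And>w. w \<in> W \<Longrightarrow> {w} \<notin> \<Gamma>"
  shows "\<exists>Gs. shelling (Gs @ Fs) (\<Gamma> \<union> (\<lambda>w. {w}) ` W) \<and> set Gs \<subseteq> (\<lambda>w. {w}) ` W"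
proof -
  have "finite W" by simp
  thus ?thesis using W
  proof (induction W rule: finite_induct)
    case empty
    show ?case using sh by (intro exI[of _ "[]"]) simp
  next
    case (insert w W)
    let ?D = "\<Gamma> \<union> (\<lambda>w. {w}) ` W"
    obtain Gs where Gs: "shelling (Gs @ Fs) ?D" "set Gs \<subseteq> (\<lambda>w. {w}) ` W" using insert by auto
    have "{} \<in> \<Gamma>" using ne shelling_complex[OF sh] unfolding simplicial_complex_def by blast
    hence "simplicial_complex (?D \<union> {{w}})"
      using shelling_complex[OF Gs(1)] unfolding simplicial_complex_def by (auto simp: subset_singleton_iff)
    moreover have "{H. {w} \<subseteq> H \<and> H \<subseteq> {w}} = {{w}}" by auto
    moreover have "{w} \<notin> ?D" using insert by auto
    ultimately have "shelling ({w} # Gs @ Fs) (?D \<union> {{w}})"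
      by (intro shelling.Cons[OF Gs(1), of _ "{w}"]) auto
    moreover have "?D \<union> {{w}} = \<Gamma> \<union> (\<lambda>w. {w}) ` insert w W" by auto
    ultimately show ?case using Gs(2) by (intro exI[of _ "{w} # Gs"]) auto
  qed
qed

lemma pure_edges_complex: "simplicial_complex (pure_edges \<Gamma>)"
  unfolding pure_edges_def simplicial_complex_def by blast

lemma pure_edges_subset: "simplicial_complex \<Gamma> \<Longrightarrow> pure_edges \<Gamma> \<subseteq> \<Gamma>"
  unfolding pure_edges_def simplicial_complex_def by blast

lemma new_face_is_vertex:
  assumes dim: "\<forall>F\<in>\<Gamma>. card F \<le> 2" and H: "H \<in> \<Gamma> - pure_edges \<Gamma>" "H \<noteq> {}"
  shows "\<exists>w. H = {w}"
proof -
  have "card H \<noteq> 2" using H(1) by (auto simp: pure_edges_def)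
  moreover have "card H \<noteq> 0" using H(2) by simp
  moreover have "card H \<le> 2" using dim H(1) by blast
  ultimately have "card H = 1" by linarith
  thus ?thesis by (simp add: card_1_singleton_iff)
qed

text \<open>Shell the edges first and then attach the isolated vertices; without edges, start from a vertex.\<close>

lemma exists_facet_shelling:
  assumes cx: "simplicial_complex \<Gamma>" and dim: "\<forall>F\<in>\<Gamma>. card F \<le> 2" and conn: "edge_connected \<Gamma>"
  shows "\<exists>Fs. shelling Fs \<Gamma> \<and> (\<forall>F\<in>set Fs. \<forall>H\<in>\<Gamma>. \<not> F \<subset> H)"
proof -
  have nf: "\<exists>w. H = {w}" if "H \<in> \<Gamma> - pure_edges \<Gamma>" "H \<noteq> {}" for H
    by (rule new_face_is_vertex[OF dim that])
  have up: "card H = 2" if "{w} \<subset> H" "H \<in> \<Gamma>" for w H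
    using psubset_card_mono[OF _ that(1)] bspec[OF dim that(2)] by simp
  consider (void) "\<Gamma> = {}" | (edge) e where "e \<in> \<Gamma>" "card e = 2"
    | (vertex) w0 where "{w0} \<in> \<Gamma>" "\<forall>e\<in>\<Gamma>. card e \<noteq> 2" | (point) "\<Gamma> = {{}}"
  proof (cases "\<exists>e\<in>\<Gamma>. card e = 2")
    case False
    show ?thesis
    proof (cases "\<exists>w. {w} \<in> \<Gamma>")
      case no_vertex: False
      have "H = {}" if "H \<in> \<Gamma>" for H
        using nf[of H] that False no_vertex by (auto simp: pure_edges_def)
      thus ?thesis using void point by blast
    qed (use vertex False in blast)
  qed (use edge in blast)
  thus ?thesis
  proof cases
    case void
    thus ?thesis using shelling.Nil by (intro exI[of _ "[]"]) auto
  next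
    case (edge e)
    obtain Fs where Fs: "\<And>F. F \<in> set Fs \<Longrightarrow> F \<in> \<Gamma> \<and> card F = 2" "shelling Fs (pure_edges \<Gamma>)"
      using shelling_pure_edges[OF cx conn edge] by blast
    let ?W = "{w. {w} \<in> \<Gamma> - pure_edges \<Gamma>}"
    have empty: "{} \<in> pure_edges \<Gamma>" using edge unfolding pure_edges_def by blast
    obtain Gs where Gs: "shelling (Gs @ Fs) (pure_edges \<Gamma> \<union> (\<lambda>w. {w}) ` ?W)" "set Gs \<subseteq> (\<lambda>w. {w}) ` ?W"
      using shelling_add_vertices[OF Fs(2), of ?W] empty by blast
    have "pure_edges \<Gamma> \<union> (\<lambda>w. {w}) ` ?W = \<Gamma>"
      using pure_edges_subset[OF cx] nf empty by auto
    moreover have "\<not> F \<subset> H" if F: "F \<in> set (Gs @ Fs)" and H: "H \<in> \<Gamma>" for F H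
    proof
      assume FH: "F \<subset> H"
      show False
      proof (cases "F \<in> set Fs")
        case True
        thus False using Fs(1) psubset_card_mono[OF _ FH] bspec[OF dim H] by fastforce
      next
        case False
        then obtain w where "F = {w}" "{w} \<notin> pure_edges \<Gamma>" using F Gs(2) by auto
        thus False using up[of w H] FH H unfolding pure_edges_def by blast
      qed
    qed
    ultimately show ?thesis using Gs(1) by (intro exI[of _ "Gs @ Fs"]) auto
  next
    case (vertex w0)
    let ?W = "{w. {w} \<in> \<Gamma> \<and> w \<noteq> w0}"
    have base: "shelling [{w0}] (Pow {w0})"
      by (rule shelling.Cons[OF shelling.Nil simplicial_complex_Pow, of _ "{}"]) auto
    obtain Gs where Gs: "shelling (Gs @ [{w0}]) (Pow {w0} \<union> (\<lambda>w. {w}) ` ?W)" "set Gs \<subseteq> (\<lambda>w. {w}) ` ?W"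
      using shelling_add_vertices[OF base, of ?W] by auto
    have "H = {} \<or> (\<exists>w. H = {w})" if "H \<in> \<Gamma>" for H
      using nf[of H] that vertex(2) by (auto simp: pure_edges_def)
    moreover have "{} \<in> \<Gamma>" using vertex(1) cx unfolding simplicial_complex_def by blast
    ultimately have "Pow {w0} \<union> (\<lambda>w. {w}) ` ?W = \<Gamma>" using vertex(1) by (fastforce simp: subset_singleton_iff)
    moreover have "\<not> F \<subset> H" if F: "F \<in> set (Gs @ [{w0}])" and H: "H \<in> \<Gamma>" for F H
      using F Gs(2) up[OF _ H] vertex(2) H by auto
    ultimately show ?thesis using Gs(1) by (intro exI[of _ "Gs @ [{w0}]"]) auto
  next
    case point
    have "shelling [{}] (Pow {} :: 'a set set)"
      by (rule shelling.Cons[OF shelling.Nil simplicial_complex_Pow, of _ "{}"]) auto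
    thus ?thesis using point by (intro exI[of _ "[{}]"]) auto
  qed
qed

theorem pretty_clean_if_edge_connected:
  assumes "simplicial_complex \<Gamma>" "\<forall>F\<in>\<Gamma>. card F \<le> 2" "edge_connected \<Gamma>"
  shows "pretty_clean_quotient (face_ideal \<Gamma> :: ('x::finite, 'k::field) mpoly set)"
proof -
  obtain Fs where "shelling Fs \<Gamma>" "\<forall>F\<in>set Fs. \<forall>H\<in>\<Gamma>. \<not> F \<subset> H"
    using exists_facet_shelling[OF assms] by (elim exE conjE)
  thus ?thesis by (intro pretty_clean_if_shelling) blast+
qed

section \<open>Connected edges yield sequential Cohen-Macaulayness\<close>

lemma sequentially_cohen_macaulay_one_step:
  fixes J :: "('x::finite, 'k::field) mpoly set"
  assumes "monomial_ideal J" "J \<noteq> UNIV" "cohen_macaulay (subquotient polyring UNIV J)"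
  shows "sequentially_cohen_macaulay_quotient J"
  unfolding sequentially_cohen_macaulay_quotient_def
proof (intro exI conjI ballI allI impI)
  let ?I = "\<lambda>i::nat. if i = 0 then J else UNIV"
  show "?I 0 = J" "?I 1 = carrier polyring" by simp_all
  show "monomial_ideal (?I i)" if "i \<in> {0..1}" for i by (simp add: assms(1) monomial_ideal_UNIV)
  show "?I (i - 1) \<subset> ?I i" "cohen_macaulay (subquotient polyring (?I i) (?I (i - 1)))"
    if "i \<in> {1..1}" for i using that assms by auto
qed simp

lemma sequentially_cohen_macaulay_two_steps:
  fixes J L :: "('x::finite, 'k::field) mpoly set"
  assumes "monomial_ideal J" "monomial_ideal L" "J \<subset> L" "L \<noteq> UNIV"
    and "cohen_macaulay (subquotient polyring L J)" "cohen_macaulay (subquotient polyring UNIV L)"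
    and "module_dim polyring (subquotient polyring L J) < module_dim polyring (subquotient polyring UNIV L)"
  shows "sequentially_cohen_macaulay_quotient J"
  unfolding sequentially_cohen_macaulay_quotient_def
proof (intro exI conjI ballI allI impI)
  let ?I = "\<lambda>i::nat. if i = 0 then J else if i = 1 then L else UNIV"
  show "?I 0 = J" "?I 2 = carrier polyring" by simp_all
  show "monomial_ideal (?I i)" if "i \<in> {0..2}" for i by (simp add: assms(1,2) monomial_ideal_UNIV)
  show "?I (i - 1) \<subset> ?I i" "cohen_macaulay (subquotient polyring (?I i) (?I (i - 1)))"
    if "i \<in> {1..2}" for i
  proof -
    have "i = 1 \<or> i = 2" using that by auto
    thus "?I (i - 1) \<subset> ?I i" "cohen_macaulay (subquotient polyring (?I i) (?I (i - 1)))"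
      using assms by auto
  qed
  show "module_dim polyring (subquotient polyring (?I i) (?I (i - 1)))
          < module_dim polyring (subquotient polyring (?I (i + 1)) (?I i))" if "1 \<le> i \<and> i < 2" for i
  proof -
    have "i = 1" using that by auto
    thus ?thesis using assms by simp
  qed
qed

text \<open>If there are both edges and isolated vertices, the ideal of the pure part is the middle term of a
  filtration with factors of dimensions one and two. Otherwise \<open>R / I\<^sub>\<Gamma>\<close> is zero or itself
  Cohen-Macaulay.\<close>

theorem sequentially_cohen_macaulay_if_edge_connected:
  fixes \<Gamma> :: "'x::finite set set"
  assumes cx: "simplicial_complex \<Gamma>" and dim: "\<forall>F\<in>\<Gamma>. card F \<le> 2" and conn: "edge_connected \<Gamma>"
  shows "sequentially_cohen_macaulay_quotient (face_ideal \<Gamma> :: ('x, 'k::field) mpoly set)"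
proof (cases "\<Gamma> = {}")
  case True
  thus ?thesis unfolding sequentially_cohen_macaulay_quotient_def
    by (intro exI[of _ 0] exI[of _ "\<lambda>_. UNIV"]) (auto simp: monomial_ideal_UNIV)
next
  case False
  have nf: "\<exists>w. H = {w}" if "H \<in> \<Gamma> - pure_edges \<Gamma>" "H \<noteq> {}" for H
    by (rule new_face_is_vertex[OF dim that])
  let ?J = "face_ideal \<Gamma> :: ('x, 'k) mpoly set"
  have empty: "{} \<in> \<Gamma>" using False cx unfolding simplicial_complex_def by blast
  note one = sequentially_cohen_macaulay_one_step[OF monomial_face_ideal[OF cx] face_ideal_neq_UNIV[OF empty]]
  show ?thesis
  proof (cases "\<exists>e\<in>\<Gamma>. card e = 2")
    case True
    then obtain e Fs where e: "e \<in> \<Gamma>" "card e = 2" and Fs: "Fs \<noteq> []" "\<And>F. F \<in> set Fs \<Longrightarrow> card F = 2"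
      and sh: "shelling Fs (pure_edges \<Gamma>)"
      using shelling_pure_edges[OF cx conn] by blast
    note top = cohen_macaulay_edges[OF sh Fs, where 'k='k]
    have empty': "{} \<in> pure_edges \<Gamma>" using e unfolding pure_edges_def by blast
    show ?thesis
    proof (cases "pure_edges \<Gamma> = \<Gamma>")
      case True
      thus ?thesis using top one by simp
    next
      case False
      hence sub: "pure_edges \<Gamma> \<subset> \<Gamma>" using pure_edges_subset[OF cx] by blast
      have "\<exists>w. H \<subseteq> {w} \<and> {w} \<in> \<Gamma> - pure_edges \<Gamma>" if H: "H \<in> \<Gamma> - pure_edges \<Gamma>" for H
        using nf[OF H] H empty' by blast
      note bottom = cohen_macaulay_vertices[OF cx pure_edges_complex sub this, where 'k='k]
      show ?thesis
      proof (rule sequentially_cohen_macaulay_two_steps[of _ "face_ideal (pure_edges \<Gamma>)"])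
        show "?J \<subset> face_ideal (pure_edges \<Gamma>)"
          using sub by (auto simp only: psubset_eq set_eq_subset face_ideal_subset_iff)
        show "face_ideal (pure_edges \<Gamma>) \<noteq> (UNIV :: ('x, 'k) mpoly set)" by (rule face_ideal_neq_UNIV[OF empty'])
      qed (use top bottom in \<open>auto intro: monomial_face_ideal cx pure_edges_complex\<close>)
    qed
  next
    case no_edge: False
    have vertex: "H = {} \<or> (\<exists>w. H = {w})" if "H \<in> \<Gamma>" for H
      using nf[of H] that no_edge by (auto simp: pure_edges_def)
    show ?thesis
    proof (cases "\<Gamma> = {{}}")
      case True
      thus ?thesis using one cohen_macaulay_point[where 'x='x and 'k='k] by simp
    next
      case False
      then obtain w where "{w} \<in> \<Gamma>" using vertex empty by blast
      hence "\<exists>w. H \<subseteq> {w} \<and> {w} \<in> \<Gamma> - {}" if "H \<in> \<Gamma> - {}" for H using vertex that by blast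
      from cohen_macaulay_vertices(2)[OF cx _ _ this, where 'k='k] show ?thesis
        using one empty by (auto simp: simplicial_complex_def psubset_eq)
    qed
  qed
qed

section \<open>Sequential Cohen-Macaulayness forces connected edges\<close>

lemma face_prime_subset_maximal: "face_prime F \<subseteq> (face_prime {} :: ('x::finite, 'k::field) mpoly set)"
  by (rule face_ideal_mono) auto

lemma face_in_complex: "face_ideal \<Gamma> \<subseteq> (face_prime F :: ('x::finite, 'k::field) mpoly set) \<Longrightarrow> F \<in> \<Gamma>"
  unfolding face_ideal_subset_iff by blast

lemma face_ideal_subset_face_prime:
  "simplicial_complex \<Gamma> \<Longrightarrow> F \<in> \<Gamma> \<Longrightarrow> face_ideal \<Gamma> \<subseteq> (face_prime F :: ('x::finite, 'k::field) mpoly set)"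
  unfolding face_ideal_subset_iff simplicial_complex_def by blast

lemma exists_regular_pair:
  fixes L :: "('x::finite, 'k::field) mpoly set"
  assumes L: "ideal L polyring" "L \<subseteq> face_prime e" and e: "card e = 2"
    and cm: "cohen_macaulay (subquotient polyring UNIV L)"
  shows "\<exists>f\<in>face_prime {}. \<exists>g\<in>face_prime {}. regular_pair f g L"
proof -
  interpret nested_ideals UNIV L by (rule nested_ideals.intro[OF ideal_UNIV L(1) subset_UNIV])
  have "enat 2 \<le> module_dim polyring M"
    using module_dim_ge[of e] L(2) e unfolding annihilator_quotient[OF L(1)] by simp
  hence "enat 1 < module_dim polyring M" by (rule order.strict_trans2[rotated]) simp
  hence "enat 1 < depth polyring (face_prime {}) M"
    using cm by (simp only: cohen_macaulay_def maximal_ideal_eq)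
  then obtain fs where fs: "1 < length fs" "set fs \<subseteq> face_prime {}" "regular_sequence polyring M fs"
    unfolding depth_def less_Sup_iff by auto
  have "regular_pair (fs ! 0) (fs ! 1) L"
    unfolding regular_pair_def
  proof (intro conjI allI impI)
    fix b assume "fs ! 0 * b \<in> L"
    hence "fs ! 0 * b \<in> seq_ideal fs 0" by simp
    hence "b \<in> seq_ideal fs 0" using fs(1,3) unfolding regular_sequence_iff by (metis UNIV_I less_trans zero_less_one)
    thus "b \<in> L" by simp
  next
    fix b c assume "fs ! 1 * b - fs ! 0 * c \<in> L"
    hence "fs ! 1 * b \<in> seq_ideal fs 1" by (auto simp: seq_ideal_1)
    hence "b \<in> seq_ideal fs 1" using fs(1,3) unfolding regular_sequence_iff by (metis UNIV_I)
    thus "\<exists>d. b - fs ! 0 * d \<in> L" by (auto simp: seq_ideal_1)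
  qed
  moreover have "fs ! 0 \<in> set fs" "fs ! 1 \<in> set fs" by (rule nth_mem, use fs(1) in linarith)+
  hence "fs ! 0 \<in> face_prime {}" "fs ! 1 \<in> face_prime {}" using fs(2) by blast+
  ultimately show ?thesis by blast
qed

definition separates :: "'x::finite set \<Rightarrow> 'x set set \<Rightarrow> bool" where
  "separates A \<Gamma> \<longleftrightarrow> (\<forall>F\<in>\<Gamma>. F \<subseteq> A \<or> F \<inter> A = {})"

text \<open>The support of a term of the product meets both \<open>A\<close> and its complement, so it is a nonface.\<close>

lemma separated_mult:
  fixes p q :: "('x::finite, 'k::field) mpoly"
  assumes "separates A \<Gamma>" "\<And>t. t \<in> terms p \<Longrightarrow> supp t \<inter> A \<noteq> {}" "\<And>t. t \<in> terms q \<Longrightarrow> \<not> supp t \<subseteq> A"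
  shows "p * q \<in> face_ideal \<Gamma>"
  unfolding face_ideal_iff
proof (intro ballI notI)
  fix t assume t: "t \<in> terms (p * q)" "supp t \<in> \<Gamma>"
  obtain r s where "r \<in> terms p" "s \<in> terms q" "t = r + s" using t(1) by (rule terms_times_obtain)
  thus False using assms t(2) unfolding separates_def by (metis Un_subset_iff inf_sup_distrib2 sup_eq_bot_iff supp_add)
qed

text \<open>The prime of a facet \<open>e\<close> is annihilated by \<open>x\<^sub>e\<close> modulo the face ideal.\<close>

lemma facet_prime_zero_divisor:
  fixes f :: "('x::finite, 'k::field) mpoly"
  assumes "\<And>H. H \<in> \<Gamma> \<Longrightarrow> \<not> e \<subset> H" "f \<in> face_prime e"
  shows "f * squarefree_monomial e \<in> face_ideal \<Gamma>"
proof -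
  have "supp t \<union> e \<notin> \<Gamma>" if "t \<in> terms f" for t
    using that assms(1)[of "supp t \<union> e"] assms(2) unfolding face_prime_iff by blast
  thus ?thesis by (simp add: face_ideal_iff squarefree_monomial_eq_face_term terms_mult_monomial supp_add)
qed

text \<open>Split \<open>f = f' + f''\<close>, where the terms of \<open>f'\<close> meet \<open>A\<close> and those of \<open>f''\<close> avoid \<open>A\<close>, and split \<open>g\<close> in the
  same way. Mixed products vanish modulo \<open>L\<close>, whence \<open>g f' \<equiv> f g'\<close>; regularity then yields
  \<open>f' \<equiv> f h\<close>, so that \<open>h\<close> acts as \<open>0\<close> on the side of \<open>e1\<close> and as \<open>1\<close> on the side of \<open>e2\<close>. This is the
  disconnectedness of the punctured spectrum: both \<open>h\<close> and \<open>1 - h\<close> would lie in the maximal ideal.\<close>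

lemma no_regular_pair_if_separated:
  fixes L :: "('x::finite, 'k::field) mpoly set"
  assumes L: "ideal L polyring" "face_ideal \<Gamma> \<subseteq> L" and sep: "separates A \<Gamma>"
    and facets: "\<And>H. H \<in> \<Gamma> \<Longrightarrow> \<not> e1 \<subset> H" "\<And>H. H \<in> \<Gamma> \<Longrightarrow> \<not> e2 \<subset> H"
    and e: "e1 \<inter> A = {}" "e2 \<subseteq> A" "L \<subseteq> face_prime e1" "L \<subseteq> face_prime e2"
    and fg: "f \<in> face_prime {}" "g \<in> face_prime {}"
  shows "\<not> regular_pair f g L"
proof
  assume reg: "regular_pair f g L"
  have split: "\<exists>p' p''. p = p' + p'' \<and> (\<forall>t\<in>terms p'. supp t \<inter> A \<noteq> {}) \<and> (\<forall>t\<in>terms p''. supp t \<inter> A = {} \<and> \<not> supp t \<subseteq> A)"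
    if "p \<in> face_prime {}" for p :: "('x, 'k) mpoly"
  proof -
    obtain p' p'' where p: "p = p' + p''" "terms p' = terms p \<inter> {t. supp t \<inter> A \<noteq> {}}"
      "terms p'' = terms p - {t. supp t \<inter> A \<noteq> {}}"
      using exists_term_split[of p "{t. supp t \<inter> A \<noteq> {}}"] by (elim exE conjE) (rule that)
    have "\<not> supp t \<subseteq> A" if "t \<in> terms p''" for t
      using \<open>p \<in> face_prime {}\<close> that unfolding p(3) face_prime_iff by blast
    with p show ?thesis by (intro exI[of _ p'] exI[of _ p'']) auto
  qed
  obtain f' f'' where f: "f = f' + f''" "\<And>t. t \<in> terms f' \<Longrightarrow> supp t \<inter> A \<noteq> {}"
    "\<And>t. t \<in> terms f'' \<Longrightarrow> supp t \<inter> A = {} \<and> \<not> supp t \<subseteq> A" using split[OF fg(1)] by metis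
  obtain g' g'' where g: "g = g' + g''" "\<And>t. t \<in> terms g' \<Longrightarrow> supp t \<inter> A \<noteq> {}"
    "\<And>t. t \<in> terms g'' \<Longrightarrow> supp t \<inter> A = {} \<and> \<not> supp t \<subseteq> A" using split[OF fg(2)] by metis
  have mult: "p * q \<in> L" if "\<forall>t\<in>terms p. supp t \<inter> A \<noteq> {}" "\<forall>t\<in>terms q. supp t \<inter> A = {} \<and> \<not> supp t \<subseteq> A" for p q
    by (rule subsetD[OF L(2) separated_mult[OF sep]]) (use that in simp_all)
  have ff: "f' * f'' \<in> L" and fg'': "f' * g'' \<in> L" and gf'': "g' * f'' \<in> L"
    by (rule mult; use f(2,3) g(2,3) in simp)+
  have notin: "f \<notin> face_prime d" if d: "\<And>H. H \<in> \<Gamma> \<Longrightarrow> \<not> d \<subset> H" "L \<subseteq> face_prime d" for d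
  proof
    assume "f \<in> face_prime d"
    hence "f * squarefree_monomial d \<in> L" by (intro subsetD[OF L(2)] facet_prime_zero_divisor d)
    hence "squarefree_monomial d \<in> L" using reg unfolding regular_pair_def by blast
    hence "squarefree_monomial d \<in> (face_prime d :: ('x, 'k) mpoly set)" using d(2) by blast
    thus False by simp
  qed
  have "f' \<in> face_prime e1" using f(2) e(1) unfolding face_prime_iff by blast
  hence f''1: "f'' \<notin> face_prime e1" using notin[OF facets(1) e(3)] unfolding f(1) by (auto dest: ideal_add[OF face_prime_ideal])
  have "f'' \<in> face_prime e2" using f(3) e(2) unfolding face_prime_iff by blast
  hence f'2: "f' \<notin> face_prime e2" using notin[OF facets(2) e(4)] unfolding f(1) by (auto dest: ideal_add[OF face_prime_ideal])
  have "f' * g'' - g' * f'' \<in> L" by (rule ideal_diff[OF L(1) fg'' gf''])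
  also have "f' * g'' - g' * f'' = g * f' - f * g'" by (simp add: f(1) g(1) algebra_simps)
  finally obtain h where h: "f' - f * h \<in> L" using reg unfolding regular_pair_def by blast
  \<comment> \<open>\<open>f'' (f' - f h)\<close> is congruent to \<open>- f'' (f'' h)\<close>, as mixed products vanish\<close>
  have "f' * f'' * (1 - h) - f'' * (f' - f * h) \<in> L"
    by (rule ideal_diff[OF L(1) ideal_mult_right[OF L(1) ff] ideal_mult[OF L(1) h]])
  also have "f' * f'' * (1 - h) - f'' * (f' - f * h) = f'' * (f'' * h)" by (simp add: f(1) algebra_simps)
  finally have "f'' * (f'' * h) \<in> face_prime e1" using e(3) by blast
  hence "h \<in> face_prime e1"
    using f''1 face_prime_prime[of f'' "f'' * h" e1] face_prime_prime[of f'' h e1] by blast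
  hence h1: "h \<in> face_prime {}" using face_prime_subset_maximal by blast
  \<comment> \<open>likewise \<open>f' (f' - f h)\<close> is congruent to \<open>f' (f' (1 - h))\<close>\<close>
  have "f' * f'' * h + f' * (f' - f * h) \<in> L"
    by (rule ideal_add[OF L(1) ideal_mult_right[OF L(1) ff] ideal_mult[OF L(1) h]])
  also have "f' * f'' * h + f' * (f' - f * h) = f' * (f' * (1 - h))" by (simp add: f(1) algebra_simps)
  finally have "f' * (f' * (1 - h)) \<in> face_prime e2" using e(4) by blast
  hence "1 - h \<in> face_prime e2"
    using f'2 face_prime_prime[of f' "f' * (1 - h)" e2] face_prime_prime[of f' "1 - h" e2] by blast
  hence "1 - h \<in> face_prime {}" using face_prime_subset_maximal by blast
  hence "(1 - h) + h \<in> face_prime {}" using h1 by (rule ideal_add[OF face_prime_ideal])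
  thus False by (simp add: face_ideal_iff)
qed

lemma filtration_mono:
  fixes I :: "nat \<Rightarrow> 'a set"
  assumes "\<forall>i\<in>{1..r}. I (i - 1) \<subseteq> I i" "i \<le> j" "j \<le> r"
  shows "I i \<subseteq> I j"
  using assms(2,3)
proof (induction rule: dec_induct)
  case (step j)
  have "I j \<subseteq> I (Suc j)" using bspec[OF assms(1), of "Suc j"] step by simp
  thus ?case using step by auto
qed simp

lemma filtration_leaves_prime:
  fixes I :: "nat \<Rightarrow> 'a set"
  assumes "I 0 \<subseteq> P" "\<not> I r \<subseteq> P"
  shows "\<exists>i\<in>{1..r}. I (i - 1) \<subseteq> P \<and> \<not> I i \<subseteq> P"
proof -
  define i where "i = (LEAST i. \<not> I i \<subseteq> P)"
  have i: "\<not> I i \<subseteq> P" "i \<le> r" unfolding i_def using assms(2) by (rule LeastI, rule Least_le)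
  have "i \<noteq> 0" using i(1) assms(1) by metis
  hence "I (i - 1) \<subseteq> P" using not_less_Least[of "i - 1" "\<lambda>i. \<not> I i \<subseteq> P"] by (auto simp: i_def)
  thus ?thesis using i \<open>i \<noteq> 0\<close> by (intro bexI[of _ i]) auto
qed

text \<open>The step of the filtration that leaves \<open>P\<^sub>e\<close> has dimension at least two. No later step can have a
  larger dimension, as everything is annihilated by \<open>I\<^sub>\<Gamma>\<close>, so this step is the last one, for every
  edge \<open>e\<close>.\<close>

lemma sequentially_cohen_macaulay_top:
  fixes \<Gamma> :: "'x::finite set set"
  assumes cx: "simplicial_complex \<Gamma>" and dim: "\<forall>F\<in>\<Gamma>. card F \<le> 2" and ne: "{} \<in> \<Gamma>"
    and scm: "sequentially_cohen_macaulay_quotient (face_ideal \<Gamma> :: ('x, 'k::field) mpoly set)"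
  shows "\<exists>L :: ('x, 'k) mpoly set. ideal L polyring \<and> face_ideal \<Gamma> \<subseteq> L \<and>
      (\<forall>e\<in>\<Gamma>. card e = 2 \<longrightarrow> L \<subseteq> face_prime e) \<and> cohen_macaulay (subquotient polyring UNIV L)"
proof -
  let ?J = "face_ideal \<Gamma> :: ('x, 'k) mpoly set"
  obtain r and I :: "nat \<Rightarrow> ('x, 'k) mpoly set" where I0: "I 0 = ?J" and Ir: "I r = carrier polyring"
    and mon: "\<forall>i\<in>{0..r}. monomial_ideal (I i)"
    and step: "\<forall>i\<in>{1..r}. I (i - 1) \<subset> I i \<and> cohen_macaulay (subquotient polyring (I i) (I (i - 1)))"
    and lt: "\<forall>i. 1 \<le> i \<and> i < r \<longrightarrow> module_dim polyring (subquotient polyring (I i) (I (i - 1)))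
             < module_dim polyring (subquotient polyring (I (i + 1)) (I i))"
    using scm unfolding sequentially_cohen_macaulay_quotient_def by (elim exE conjE) (rule that)
  have I: "I 0 = ?J" "I r = UNIV" "\<And>i. i \<le> r \<Longrightarrow> monomial_ideal (I i)"
    "\<And>i. i \<in> {1..r} \<Longrightarrow> I (i - 1) \<subset> I i"
    and cm: "\<And>i. i \<in> {1..r} \<Longrightarrow> cohen_macaulay (subquotient polyring (I i) (I (i - 1)))"
    using I0 Ir mon step by simp_all
  have id: "ideal (I i) polyring" if "i \<le> r" for i using I(3)[OF that] by (rule monomial_ideal_ideal)
  have mono: "I i \<subseteq> I j" if "i \<le> j" "j \<le> r" for i j by (rule filtration_mono[of r I]) (use step that in auto)
  have "r \<noteq> 0" using I(1,2) face_ideal_neq_UNIV[OF ne, where 'k='k] by metis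
  have "I (r - 1) \<subseteq> face_prime e" if e: "e \<in> \<Gamma>" "card e = 2" for e
  proof -
    have "I 0 \<subseteq> face_prime e" unfolding I(1) using cx e(1) by (rule face_ideal_subset_face_prime)
    moreover have "\<not> I r \<subseteq> face_prime e" unfolding I(2) using one_notin_face_prime by blast
    ultimately obtain i where i: "i \<in> {1..r}" "I (i - 1) \<subseteq> face_prime e" "\<not> I i \<subseteq> face_prime e"
      using filtration_leaves_prime by metis
    interpret N: nested_ideals "I i" "I (i - 1)"
      by (rule nested_ideals.intro) (use i id mono in auto)
    obtain u where u: "u \<in> I i" "u \<notin> face_prime e" using i(3) by blast
    have "{b. \<forall>x\<in>I i. b * x \<in> I (i - 1)} \<subseteq> face_prime e"
      using u i(2) face_prime_prime by blast
    from N.module_dim_ge[OF this]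
    have ge: "enat 2 \<le> module_dim polyring (subquotient polyring (I i) (I (i - 1)))"
      unfolding e(2) .
    have "i = r"
    proof (rule ccontr)
      assume "i \<noteq> r"
      hence ir: "1 \<le> i" "i < r" using i(1) by auto
      interpret N': nested_ideals "I (i + 1)" "I i"
        by (rule nested_ideals.intro) (use ir id mono in auto)
      have "term_ideal {t. 2 < card (supp t)} \<subseteq> ?J" by (rule large_terms_in_face_ideal) (use dim in auto)
      also have "?J \<subseteq> I i" using mono[of 0 i] ir I(1) by simp
      also have "I i \<subseteq> {b. \<forall>x\<in>I (i + 1). b * x \<in> I i}" using ideal_mult_right[OF id[of i]] ir by auto
      finally have "module_dim polyring (subquotient polyring (I (i + 1)) (I i)) \<le> enat 2"
        by (rule N'.module_dim_le)
      moreover have "module_dim polyring (subquotient polyring (I i) (I (i - 1)))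
           < module_dim polyring (subquotient polyring (I (i + 1)) (I i))" using lt ir by blast
      ultimately show False using ge by (meson leD order_le_less_trans)
    qed
    thus ?thesis using i(2) by simp
  qed
  moreover have "face_ideal \<Gamma> \<subseteq> I (r - 1)" using mono[of 0 "r - 1"] I(1) by simp
  moreover have "cohen_macaulay (subquotient polyring UNIV (I (r - 1)))" using cm[of r] I(2) \<open>r \<noteq> 0\<close> by simp
  ultimately show ?thesis using id[of "r - 1"] by (intro exI[of _ "I (r - 1)"]) simp
qed

text \<open>Faces with at most one vertex are never cut, so separating the edges is the same as separating all
  faces.\<close>

lemma edge_connectedI:
  fixes \<Gamma> :: "'x::finite set set"
  assumes dim: "\<forall>F\<in>\<Gamma>. card F \<le> 2"
    and "\<And>A e1 e2. separates A \<Gamma> \<Longrightarrow> e1 \<in> \<Gamma> \<Longrightarrow> e2 \<in> \<Gamma> \<Longrightarrow> card e1 = 2 \<Longrightarrow> card e2 = 2 \<Longrightarrow>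
       e1 \<inter> A = {} \<Longrightarrow> e2 \<subseteq> A \<Longrightarrow> False"
  shows "edge_connected \<Gamma>"
  unfolding edge_connected_def
proof (intro allI impI, rule ccontr)
  fix A assume sep: "\<forall>F\<in>\<Gamma>. card F = 2 \<longrightarrow> F \<subseteq> A \<or> F \<inter> A = {}"
    and n: "\<not> ((\<forall>F\<in>\<Gamma>. card F = 2 \<longrightarrow> F \<subseteq> A) \<or> (\<forall>F\<in>\<Gamma>. card F = 2 \<longrightarrow> F \<inter> A = {}))"
  have "F \<subseteq> A \<or> F \<inter> A = {}" if "F \<in> \<Gamma>" for F
  proof (cases "card F = 2")
    case False
    moreover have "card F \<le> 2" using dim that by blast
    ultimately have "card F = 0 \<or> card F = 1" by linarith
    hence "F = {} \<or> (\<exists>v. F = {v})" by (metis card_0_eq card_1_singleton_iff finite One_nat_def)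
    thus ?thesis by auto
  qed (use sep that in blast)
  hence "separates A \<Gamma>" by (simp add: separates_def)
  moreover obtain e1 e2 where "e1 \<in> \<Gamma>" "card e1 = 2" "\<not> e1 \<subseteq> A" "e2 \<in> \<Gamma>" "card e2 = 2" "e2 \<inter> A \<noteq> {}"
    using n by blast
  ultimately show False using assms(2)[of A e1 e2] sep by blast
qed

lemma edge_is_facet:
  assumes "\<forall>F\<in>\<Gamma>. card F \<le> 2" "card e = 2" "H \<in> \<Gamma>"
  shows "\<not> (e :: 'x::finite set) \<subset> H"
  using psubset_card_mono[of H e] assms by fastforce

theorem edge_connected_if_sequentially_cohen_macaulay:
  fixes \<Gamma> :: "'x::finite set set"
  assumes cx: "simplicial_complex \<Gamma>" and dim: "\<forall>F\<in>\<Gamma>. card F \<le> 2"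
    and scm: "sequentially_cohen_macaulay_quotient (face_ideal \<Gamma> :: ('x, 'k::field) mpoly set)"
  shows "edge_connected \<Gamma>"
proof (rule edge_connectedI[OF dim])
  fix A e1 e2 assume sep: "separates A \<Gamma>" and e: "e1 \<in> \<Gamma>" "e2 \<in> \<Gamma>" "card e1 = 2" "card e2 = 2"
    "e1 \<inter> A = {}" "e2 \<subseteq> A"
  \<comment> \<open>the complex is not void, so \<open>R / I\<^sub>\<Gamma>\<close> is nonzero and the filtration has a last step\<close>
  have "{} \<in> \<Gamma>" using cx e(1) unfolding simplicial_complex_def by blast
  then obtain L :: "('x, 'k) mpoly set" where L: "ideal L polyring" "face_ideal \<Gamma> \<subseteq> L"
    "\<And>e. e \<in> \<Gamma> \<Longrightarrow> card e = 2 \<Longrightarrow> L \<subseteq> face_prime e" and cm: "cohen_macaulay (subquotient polyring UNIV L)"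
    using sequentially_cohen_macaulay_top[OF cx dim _ scm] by blast
  obtain f g where "f \<in> face_prime {}" "g \<in> face_prime {}" "regular_pair f g L"
    using exists_regular_pair[OF L(1) L(3)[OF e(1,3)] e(3) cm] by blast
  moreover have "\<And>H. H \<in> \<Gamma> \<Longrightarrow> \<not> e1 \<subset> H" "\<And>H. H \<in> \<Gamma> \<Longrightarrow> \<not> e2 \<subset> H"
    using edge_is_facet[OF dim] e by blast+
  ultimately show False
    using no_regular_pair_if_separated[OF L(1,2) sep _ _ e(5,6) L(3)[OF e(1,3)] L(3)[OF e(2,4)]] by blast
qed

section \<open>Pretty cleanness forces connected edges\<close>

text \<open>A monomial is a product of variables.\<close>

lemma variables_generate_prime:
  fixes P :: "('x::finite, 'k::field) mpoly set"
  assumes P: "primeideal P polyring"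
  shows "monomial t \<in> P \<longleftrightarrow> (\<exists>v\<in>supp t. variable v \<in> P)"
proof (induction t rule: measure_induct_rule[of monomial_degree])
  case (less t)
  interpret primeideal P "polyring :: ('x, 'k) mpoly ring" by (rule P)
  show ?case
  proof (cases "t = 0")
    case True
    have "(1 :: ('x, 'k) mpoly) \<notin> P" using I_notcarr one_imp_carrier by auto
    thus ?thesis using True by (simp add: monomial_def)
  next
    case False
    then obtain v where v: "v \<in> supp t" by fastforce
    then obtain s where s: "t = face_term {v} + s" using face_term_decompose[of "{v}" t] by auto
    have split: "monomial t = variable v * (monomial s :: ('x, 'k) mpoly)"
      by (simp add: s monomial_mult squarefree_monomial_eq_face_term flip: squarefree_monomial_singleton)
    have "face_term {v} \<noteq> 0" using supp_face_term[of "{v}"] by force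
    hence "monomial_degree s < monomial_degree t"
      using monomial_degree_pos[of "face_term {v}"] by (simp add: s monomial_degree_add)
    hence IH: "monomial s \<in> P \<longleftrightarrow> (\<exists>v\<in>supp s. variable v \<in> P)" by (rule less.IH)
    have "monomial t \<in> P \<longleftrightarrow> variable v \<in> P \<or> monomial s \<in> P"
      using I_prime[of "variable v" "monomial s"] ideal_mult[OF is_ideal, of "monomial s" "variable v"]
        ideal_mult_right[OF is_ideal, of "variable v" "monomial s"] by (auto simp: split)
    thus ?thesis unfolding IH by (auto simp: s supp_add)
  qed
qed

lemma monomial_prime_eq_face_prime:
  fixes P :: "('x::finite, 'k::field) mpoly set"
  assumes "monomial_ideal P" "primeideal P polyring"
  shows "\<exists>F. P = face_prime F"
proof -
  obtain U where U: "P = term_ideal U" using assms(1) by (auto simp: monomial_ideal_iff)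
  define F where "F = {v. variable v \<notin> P}"
  have "t \<in> U \<longleftrightarrow> \<not> supp t \<subseteq> F" for t
    using variables_generate_prime[OF assms(2), of t] by (auto simp: F_def) (simp_all add: U)
  hence "U = {t. supp t \<notin> Pow F}" by auto
  thus ?thesis unfolding U face_ideal_def by blast
qed

text \<open>In the polynomial ring \<open>R / P\<^bsub>{a,b}\<^esub>\<close>, a divisor of a power of \<open>x\<^sub>a\<close> that \<open>x\<^sub>a\<close> does not divide is a unit:
  setting \<open>x\<^sub>a = 0\<close> kills the cofactor, so a factor \<open>x\<^sub>a\<close> can be cancelled from both sides.\<close>

lemma cyclic_generator_unit:
  fixes u :: "('x::finite, 'k::field) mpoly"
  assumes ab: "a \<noteq> b" and u: "u \<notin> face_prime {b}"
  shows "variable a ^ n - s * u \<in> face_prime {a, b} \<Longrightarrow> \<exists>s. 1 - s * u \<in> face_prime {a, b}"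
proof (induction n arbitrary: s)
  case (Suc n)
  have "variable a ^ Suc n - s * u \<in> face_prime {b}"
    using Suc.prems face_ideal_mono[of "Pow {b}" "Pow {a, b}"] by blast
  moreover have "variable a ^ Suc n \<in> face_prime {b}"
    using ab by (simp add: ideal_mult_right[OF face_prime_ideal])
  ultimately have "s * u \<in> face_prime {b}" using ideal_diff_cancel[OF face_prime_ideal] by blast
  hence "s \<in> face_prime {b}" using u face_prime_prime[of s u] by blast
  then obtain s' where s': "s - s' * variable a \<in> face_prime {a, b}" using face_prime_pair(1)[OF ab] by blast
  have "variable a ^ Suc n - s * u + (s - s' * variable a) * u \<in> face_prime {a, b}"
    by (rule ideal_add[OF face_prime_ideal Suc.prems ideal_mult_right[OF face_prime_ideal s']])
  also have "variable a ^ Suc n - s * u + (s - s' * variable a) * u = (variable a ^ n - s' * u) * variable a"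
    by (simp add: algebra_simps)
  finally have "variable a ^ n - s' * u \<in> face_prime {a, b}" using face_prime_pair(2)[OF ab] by blast
  thus ?case by (rule Suc.IH)
qed auto

lemma power_notin_face_prime:
  "variable v \<notin> face_prime F \<Longrightarrow> variable v ^ n \<notin> (face_prime F :: ('x::finite, 'k::field) mpoly set)"
proof (induction n)
  case 0
  show ?case using one_notin_face_prime by (metis power_0)
next
  case (Suc n)
  thus ?case using face_prime_prime[of "variable v" "variable v ^ n" F] by auto
qed

text \<open>A pretty clean filtration of \<open>R / I\<^sub>\<Gamma>\<close> in which each step is described by a generator \<open>u i\<close> and
  by the face \<open>F i\<close> whose prime is its annihilator.\<close>

locale prime_filtration =
  fixes \<Gamma> :: "'x::finite set set" and r :: nat
    and I :: "nat \<Rightarrow> ('x, 'k::field) mpoly set" and u :: "nat \<Rightarrow> ('x, 'k) mpoly" and F :: "nat \<Rightarrow> 'x set"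
  assumes complex: "simplicial_complex \<Gamma>" and dim: "\<forall>F\<in>\<Gamma>. card F \<le> 2"
    and bottom: "I 0 = face_ideal \<Gamma>" and top: "I r = UNIV"
    and ideals: "i \<le> r \<Longrightarrow> ideal (I i) polyring"
    and increasing: "i \<in> {1..r} \<Longrightarrow> I (i - 1) \<subseteq> I i"
    and generator: "i \<in> {1..r} \<Longrightarrow> u i \<in> I i"
    and generates: "i \<in> {1..r} \<Longrightarrow> x \<in> I i \<Longrightarrow> \<exists>s. x - s * u i \<in> I (i - 1)"
    and colon: "i \<in> {1..r} \<Longrightarrow> s * u i \<in> I (i - 1) \<longleftrightarrow> s \<in> face_prime (F i)"
    and pretty: "i \<in> {1..r} \<Longrightarrow> j \<in> {1..r} \<Longrightarrow> F j \<subset> F i \<Longrightarrow> j < i"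
begin

lemma mono: "i \<le> j \<Longrightarrow> j \<le> r \<Longrightarrow> I i \<subseteq> I j"
  by (rule filtration_mono[of r I]) (use increasing in auto)

lemma subset_prime: "i \<in> {1..r} \<Longrightarrow> I (i - 1) \<subseteq> face_prime (F i)"
  using colon ideal_mult_right[OF ideals[of "i - 1"]] by fastforce

lemma face:
  assumes "i \<in> {1..r}"
  shows "F i \<in> \<Gamma>"
proof -
  have "I 0 \<subseteq> I (i - 1)" by (rule mono) (use assms in auto)
  thus ?thesis using subset_prime[OF assms] face_in_complex unfolding bottom by blast
qed

lemma prime_mult:
  assumes "i \<in> {1..r}" "x \<in> I i" "p \<in> face_prime (F i)"
  shows "p * x \<in> I (i - 1)"
proof -
  have id: "ideal (I (i - 1)) polyring" using assms(1) by (intro ideals) auto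
  obtain s where s: "x - s * u i \<in> I (i - 1)" using generates assms by blast
  have "p * u i \<in> I (i - 1)" using colon assms by blast
  hence "s * (p * u i) + p * (x - s * u i) \<in> I (i - 1)"
    by (rule ideal_add[OF id ideal_mult[OF id] ideal_mult[OF id s]])
  thus ?thesis by (simp add: algebra_simps)
qed

text \<open>The step that leaves \<open>P\<^sub>e\<close> has its annihilator inside \<open>P\<^sub>e\<close>, and \<open>P\<^sub>e\<close> is a minimal prime.\<close>

lemma edge_occurs:
  assumes e: "e \<in> \<Gamma>" "card e = 2"
  shows "\<exists>i\<in>{1..r}. F i = e"
proof -
  have "I 0 \<subseteq> face_prime e" unfolding bottom using complex e(1) by (rule face_ideal_subset_face_prime)
  moreover have "\<not> I r \<subseteq> face_prime e" unfolding top using one_notin_face_prime by blast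
  ultimately obtain i where i: "i \<in> {1..r}" "I (i - 1) \<subseteq> face_prime e" "\<not> I i \<subseteq> face_prime e"
    using filtration_leaves_prime by metis
  then obtain x where x: "x \<in> I i" "x \<notin> face_prime e" by blast
  have "face_prime (F i) \<subseteq> (face_prime e :: ('x, 'k) mpoly set)"
    using prime_mult[OF i(1) x(1)] i(2) x(2) face_prime_prime by blast
  hence "e \<subseteq> F i" unfolding face_ideal_subset_iff by blast
  hence "F i = e" using edge_is_facet[OF dim e(2) face[OF i(1)]] by blast
  thus ?thesis using i(1) by blast
qed

text \<open>Multiplication by \<open>x\<^sub>v\<close> moves each of the steps above \<open>k\<close> one ideal down.\<close>

lemma power_in_filtration:
  assumes k: "k \<le> r" and v: "\<And>j. j \<in> {k<..r} \<Longrightarrow> v \<notin> F j"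
  shows "variable v ^ (r - k) \<in> I k"
  using k
proof (induction rule: inc_induct)
  case base
  show ?case by (simp add: top)
next
  case (step j)
  have "variable v \<in> face_prime (F (Suc j))" using v[of "Suc j"] step by simp
  hence "variable v * variable v ^ (r - Suc j) \<in> I (Suc j - 1)"
    using step by (intro prime_mult) auto
  moreover have "r - j = Suc (r - Suc j)" using step by simp
  ultimately show ?case by simp
qed

text \<open>Let \<open>k\<close> be the last step whose face meets \<open>A\<close> and suppose that \<open>k < r\<close>. The face is not a single vertex,
  because the prime of an edge through that vertex would have to come later, which pretty cleanness
  allows only for steps after \<open>k\<close>. So it is an edge \<open>{a, b}\<close> inside \<open>A\<close>. Since the later faces avoid \<open>A\<close>,
  powers of \<open>x\<^sub>a\<close> and of \<open>x\<^sub>b\<close> lie in \<open>I k\<close>, hence are multiples of the generator \<open>u k\<close> modulo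
  \<open>P\<^bsub>{a,b}\<^esub>\<close>. This makes the generator a unit there, although \<open>I k\<close> lies in the maximal ideal.\<close>

lemma separated_meets_top:
  assumes sep: "separates A \<Gamma>" and edges: "\<And>v. v \<in> A \<Longrightarrow> \<exists>e\<in>\<Gamma>. card e = 2 \<and> v \<in> e"
    and e: "e \<in> \<Gamma>" "card e = 2" "e \<subseteq> A"
  shows "F r \<inter> A \<noteq> {}"
proof (rule ccontr)
  assume Fr: "\<not> F r \<inter> A \<noteq> {}"
  define K where "K = {i \<in> {1..r}. F i \<inter> A \<noteq> {}}"
  define k where "k = Max K"
  have "e \<noteq> {}" using e(2) by auto
  hence "K \<noteq> {}" using edge_occurs[OF e(1,2)] e(3) unfolding K_def by blast
  hence "k \<in> K" unfolding k_def by (intro Max_in) (auto simp: K_def)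
  hence k: "k \<in> {1..r}" "F k \<inter> A \<noteq> {}" by (auto simp: K_def)
  have later: "F j \<inter> A = {}" if "j \<in> {k<..r}" for j
  proof (rule ccontr)
    assume "F j \<inter> A \<noteq> {}"
    hence "j \<in> K" using that k(1) by (auto simp: K_def)
    hence "j \<le> k" unfolding k_def by (intro Max_ge) (auto simp: K_def)
    thus False using that by simp
  qed
  have "k \<noteq> r" using k(2) Fr by blast
  hence kr: "Suc k \<in> {1..r}" using k(1) by auto
  have "F k \<subseteq> A" using sep face[OF k(1)] k(2) unfolding separates_def by blast
  have "card (F k) = 2"
  proof (rule ccontr)
    assume c: "card (F k) \<noteq> 2"
    obtain v where v: "v \<in> F k" "v \<in> A" using k(2) by blast
    hence "card (F k) = 1" using c dim face[OF k(1)] card_0_eq[of "F k"] by fastforce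
    hence Fk: "F k = {v}" using v(1) by (auto simp: card_1_singleton_iff)
    obtain d where d: "d \<in> \<Gamma>" "card d = 2" "v \<in> d" using edges v(2) by blast
    obtain j where j: "j \<in> {1..r}" "F j = d" using edge_occurs[OF d(1,2)] by blast
    have "F k \<subset> F j" using d(2,3) by (auto simp: Fk j(2))
    hence "k < j" using pretty j(1) k(1) by blast
    hence "F j \<inter> A = {}" using later j(1) by simp
    thus False using d(3) v(2) j(2) by blast
  qed
  then obtain a b where ab: "F k = {a, b}" "a \<noteq> b" by (auto simp: card_2_iff)
  have notin: "v \<notin> F j" if "v \<in> F k" "j \<in> {k<..r}" for v j using later[OF that(2)] that(1) \<open>F k \<subseteq> A\<close> by blast
  have pow: "variable v ^ (r - k) \<in> I k" if "v \<in> F k" for v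
    using k(1) notin[OF that] by (intro power_in_filtration) auto
  have below: "I (k - 1) \<subseteq> face_prime {a, b}" using subset_prime[OF k(1)] ab(1) by simp
  have "u k \<notin> face_prime {b}"
  proof
    assume ub: "u k \<in> face_prime {b}"
    obtain s where "variable b ^ (r - k) - s * u k \<in> I (k - 1)"
      using generates[OF k(1) pow[of b]] ab(1) by auto
    hence diff: "variable b ^ (r - k) - s * u k \<in> face_prime {b}"
      using below face_ideal_mono[of "Pow {b}" "Pow {a, b}"] by blast
    have "variable b ^ (r - k) \<in> (face_prime {b} :: ('x, 'k) mpoly set)"
      using ideal_diff_cancel[OF face_prime_ideal diff] ideal_mult[OF face_prime_ideal ub, of s] by simp
    moreover have "variable b \<notin> (face_prime {b} :: ('x, 'k) mpoly set)" by simp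
    from power_notin_face_prime[OF this] have "variable b ^ (r - k) \<notin> (face_prime {b} :: ('x, 'k) mpoly set)" .
    ultimately show False by contradiction
  qed
  moreover obtain s where "variable a ^ (r - k) - s * u k \<in> face_prime {a, b}"
    using generates[OF k(1) pow[of a]] ab(1) below by auto
  ultimately obtain s where s: "1 - s * u k \<in> face_prime {a, b}"
    using cyclic_generator_unit[OF ab(2)] by blast
  have "u k \<in> face_prime (F (Suc k))" using generator[OF k(1)] subset_prime[OF kr] by auto
  hence "s * u k \<in> face_prime {}" using face_prime_subset_maximal ideal_mult[OF face_prime_ideal] by blast
  moreover have "1 - s * u k \<in> face_prime {}" using s face_prime_subset_maximal by blast
  ultimately have "(1 - s * u k) + s * u k \<in> face_prime {}" by (intro ideal_add[OF face_prime_ideal])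
  thus False by (simp add: face_ideal_iff)
qed

text \<open>Two separated groups of edges would both have to meet the single face \<open>F r\<close>. Isolated vertices are
  removed from both groups, because the preceding lemma needs every vertex to lie on an edge.\<close>

lemma edge_connected_complex: "edge_connected \<Gamma>"
proof (rule edge_connectedI[OF dim])
  fix A e1 e2 assume sep: "separates A \<Gamma>" and e: "e1 \<in> \<Gamma>" "e2 \<in> \<Gamma>" "card e1 = 2" "card e2 = 2"
    "e1 \<inter> A = {}" "e2 \<subseteq> A"
  \<comment> \<open>the vertices that are not isolated\<close>
  let ?V = "\<Union>{e \<in> \<Gamma>. card e = 2}"
  have edge_or: "F \<inter> ?V = {} \<or> F \<subseteq> ?V" if "F \<in> \<Gamma>" for F
  proof (cases "card F = 2")
    case False
    hence "card F \<le> 1" using dim that by force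
    thus ?thesis using card_le_Suc0_iff_eq[of F] by auto
  qed (use that in blast)
  have "separates (A \<inter> ?V) \<Gamma>" "separates (?V - A) \<Gamma>"
    using sep edge_or unfolding separates_def by blast+
  hence "F r \<inter> (A \<inter> ?V) \<noteq> {}" "F r \<inter> (?V - A) \<noteq> {}"
    using separated_meets_top[of "A \<inter> ?V" e2] separated_meets_top[of "?V - A" e1] e by blast+
  moreover have "r \<in> {1..r}" using edge_occurs[OF e(1,3)] by auto
  hence "F r \<in> \<Gamma>" by (rule face)
  ultimately show False using sep unfolding separates_def by blast
qed

end

theorem edge_connected_if_pretty_clean:
  fixes \<Gamma> :: "'x::finite set set"
  assumes cx: "simplicial_complex \<Gamma>" and dim: "\<forall>F\<in>\<Gamma>. card F \<le> 2"
    and pc: "pretty_clean_quotient (face_ideal \<Gamma> :: ('x, 'k::field) mpoly set)"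
  shows "edge_connected \<Gamma>"
proof -
  obtain r I \<pp> where filt: "monomial_prime_filtration (face_ideal \<Gamma> :: ('x, 'k) mpoly set) r I \<pp>"
    and pretty: "\<forall>i\<in>{1..r}. \<forall>j\<in>{1..r}. \<pp> i \<subset> \<pp> j \<longrightarrow> j < i"
    using pc unfolding pretty_clean_quotient_def by (elim exE conjE) (rule that)
  have I0: "I 0 = face_ideal \<Gamma>" and Ir: "I r = carrier polyring"
    and mon: "\<forall>i\<in>{0..r}. monomial_ideal (I i)"
    and step: "\<forall>i\<in>{1..r}. I (i - 1) \<subset> I i \<and> monomial_ideal (\<pp> i) \<and> primeideal (\<pp> i) polyring \<and>
        module_isomorphic polyring
          (subquotient polyring (I i) (I (i - 1))) (subquotient polyring (carrier polyring) (\<pp> i))"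
    using filt unfolding monomial_prime_filtration_def by blast+
  have id: "ideal (I i) polyring" if "i \<le> r" for i using mon that by (intro monomial_ideal_ideal) auto
  have "\<forall>i. \<exists>F. i \<in> {1..r} \<longrightarrow> \<pp> i = face_prime F"
    using step monomial_prime_eq_face_prime by blast
  then obtain F where F: "\<And>i. i \<in> {1..r} \<Longrightarrow> \<pp> i = face_prime (F i)" by metis
  have "\<forall>i. \<exists>u. i \<in> {1..r} \<longrightarrow> u \<in> I i \<and> (\<forall>x\<in>I i. \<exists>s. x - s * u \<in> I (i - 1)) \<and>
      (\<forall>s. s * u \<in> I (i - 1) \<longleftrightarrow> s \<in> face_prime (F i))"
  proof
    fix i
    show "\<exists>u. i \<in> {1..r} \<longrightarrow> u \<in> I i \<and> (\<forall>x\<in>I i. \<exists>s. x - s * u \<in> I (i - 1)) \<and>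
      (\<forall>s. s * u \<in> I (i - 1) \<longleftrightarrow> s \<in> face_prime (F i))"
    proof (cases "i \<in> {1..r}")
      case True
      interpret nested_ideals "I i" "I (i - 1)"
        by (rule nested_ideals.intro) (use True id step in auto)
      have "module_isomorphic polyring (subquotient polyring (I i) (I (i - 1)))
          (subquotient polyring (carrier polyring) (face_prime (F i)))"
        using bspec[OF step True] F[OF True] by simp
      thus ?thesis unfolding module_isomorphic_cyclic_iff[OF face_prime_ideal] by blast
    qed blast
  qed
  then obtain u where u: "\<And>i. i \<in> {1..r} \<Longrightarrow> u i \<in> I i \<and> (\<forall>x\<in>I i. \<exists>s. x - s * u i \<in> I (i - 1)) \<and>
      (\<forall>s. s * u i \<in> I (i - 1) \<longleftrightarrow> s \<in> face_prime (F i))" by metis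
  interpret prime_filtration \<Gamma> r I u F
  proof (rule prime_filtration.intro)
    show "simplicial_complex \<Gamma>" "\<forall>F\<in>\<Gamma>. card F \<le> 2" "I 0 = face_ideal \<Gamma>" by fact+
    show "I r = UNIV" using Ir by simp
    show "j < i" if "i \<in> {1..r}" "j \<in> {1..r}" "F j \<subset> F i" for i j
    proof -
      have "\<pp> i \<subset> \<pp> j"
        unfolding F[OF that(1)] F[OF that(2)] face_prime_psubset_iff by (rule that(3))
      thus ?thesis using pretty that(1,2) by blast
    qed
  qed (use u id step in auto)
  show ?thesis by (rule edge_connected_complex)
qed

section \<open>Alexander duality\<close>

lemma dual_complex_complex: "simplicial_complex \<Delta> \<Longrightarrow> simplicial_complex (dual_complex \<Delta>)"
  unfolding simplicial_complex_def dual_complex_def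
proof (clarify)
  fix A F assume "\<forall>F\<in>\<Delta>. \<forall>G\<subseteq>F. G \<in> \<Delta>" "F \<subseteq> UNIV - A" "A \<notin> \<Delta>"
  hence "UNIV - F \<notin> \<Delta>" "F = UNIV - (UNIV - F)" by blast+
  thus "\<exists>A. F = UNIV - A \<and> A \<notin> \<Delta>" by blast
qed

lemma monomial_dvd_imp:
  assumes "(monomial s :: ('x::finite, 'k::field) mpoly) dvd monomial t"
  shows "\<exists>r. t = s + r"
proof -
  obtain q where "(monomial t :: ('x, 'k) mpoly) = q * monomial s" using assms by (metis dvdE mult.commute)
  hence "t \<in> terms (q * (monomial s :: ('x, 'k) mpoly))" by (metis insertI1 terms_monomial)
  thus ?thesis by (auto simp: terms_mult_monomial add.commute)
qed

text \<open>A smallest nonface \<open>G\<close> inside the complement of \<open>F\<close> is the support of a minimal generator; so \<open>G\<close>, and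
  with it the complement of \<open>F\<close>, has at least \<open>n - 2\<close> elements.\<close>

lemma dual_complex_dimension:
  fixes \<Delta> :: "'x::finite set set"
  assumes cx: "simplicial_complex \<Delta>"
    and deg: "degree_at_least (face_ideal \<Delta> :: ('x, 'k::field) mpoly set) (int CARD('x) - 2)"
    and F: "F \<in> dual_complex \<Delta>"
  shows "card F \<le> 2"
proof -
  obtain A where A: "F = UNIV - A" "A \<notin> \<Delta>" using F by (auto simp: dual_complex_def)
  obtain G where G: "G \<subseteq> A" "G \<notin> \<Delta>" and min: "\<And>H. H \<subset> G \<Longrightarrow> H \<in> \<Delta>"
  proof -
    have "\<exists>G\<in>{G. G \<notin> \<Delta>}. G \<subseteq> A \<and> (\<forall>H\<in>{G. G \<notin> \<Delta>}. H \<subseteq> G \<longrightarrow> G = H)"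
      by (rule finite_has_minimal2) (use A(2) in auto)
    thus ?thesis using that by blast
  qed
  have "face_term G \<in> minimal_generators (face_ideal \<Delta> :: ('x, 'k) mpoly set)"
    unfolding minimal_generators_def
  proof (intro CollectI conjI allI impI)
    show "(monomial (face_term G) :: ('x, 'k) mpoly) \<in> face_ideal \<Delta>" using G by simp
    fix s assume "(monomial s :: ('x, 'k) mpoly) \<in> face_ideal \<Delta> \<and>
        (monomial s :: ('x, 'k) mpoly) dvd monomial (face_term G)"
    then obtain r where s: "supp s \<notin> \<Delta>" and r: "face_term G = s + r" using monomial_dvd_imp by auto
    have "G = supp s \<union> supp r" using arg_cong[OF r, of supp] by (simp add: supp_add)
    hence "supp s = G" using min s by blast
    show "s = face_term G"
    proof (rule poly_mapping_eqI)
      fix v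
      have "Poly_Mapping.lookup s v + Poly_Mapping.lookup r v = (if v \<in> G then 1 else 0)"
        using lookup_face_term[of G v] by (simp add: r lookup_add)
      moreover have "v \<in> G \<longleftrightarrow> Poly_Mapping.lookup s v \<noteq> 0" using \<open>supp s = G\<close> by (auto simp: in_keys_iff)
      ultimately show "Poly_Mapping.lookup s v = Poly_Mapping.lookup (face_term G) v"
        by (simp add: lookup_face_term split: if_splits)
    qed
  qed
  hence "int CARD('x) - 2 \<le> int (monomial_degree (face_term G))" using deg unfolding degree_at_least_def by blast
  also have "monomial_degree (face_term G) = card G" by (simp add: monomial_degree_def lookup_face_term sum.If_cases)
  also have "card G \<le> card A" using G(1) by (simp add: card_mono)
  finally have "CARD('x) \<le> card A + 2" by linarith
  thus ?thesis unfolding A(1) by (simp add: card_Diff_subset)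
qed

theorem corollary2p13:
  fixes I :: "('x::finite, 'k::field) mpoly set"
  assumes "squarefree_monomial_ideal I"
    and "degree_at_least I (int CARD('x) - 2)"
  shows "sequentially_cohen_macaulay_quotient (alexander_dual I) \<longleftrightarrow>
         pretty_clean_quotient (alexander_dual I)"
proof -
  define \<Delta> where "\<Delta> = stanley_reisner_complex I"
  have \<Delta>: "simplicial_complex \<Delta>" "I = stanley_reisner_ideal \<Delta>"
    using theI'[OF ex1_stanley_reisner_complex[OF assms(1)]]
    unfolding \<Delta>_def stanley_reisner_complex_def by blast+
  let ?\<Gamma> = "dual_complex \<Delta>"
  have cx: "simplicial_complex ?\<Gamma>" by (rule dual_complex_complex[OF \<Delta>(1)])
  have dual: "alexander_dual I = face_ideal ?\<Gamma>"
    using stanley_reisner_ideal_eq[OF cx] by (simp only: alexander_dual_def \<Delta>_def)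
  have "degree_at_least (face_ideal \<Delta> :: ('x, 'k) mpoly set) (int CARD('x) - 2)"
    using assms(2) unfolding \<Delta>(2) stanley_reisner_ideal_eq[OF \<Delta>(1)] .
  hence dim: "\<forall>F\<in>?\<Gamma>. card F \<le> 2" using dual_complex_dimension[OF \<Delta>(1)] by blast
  show ?thesis
    unfolding dual
    using edge_connected_if_pretty_clean[OF cx dim] pretty_clean_if_edge_connected[OF cx dim]
      edge_connected_if_sequentially_cohen_macaulay[OF cx dim]
      sequentially_cohen_macaulay_if_edge_connected[OF cx dim]
    by blast
qed

end
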